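(* Let $R$ be the coinvariant ring (over $\mathbb{R}$) of the irreducible Coxeter group of type $H_4$, that is, $R=\mathbb{R}[x_1,x_2,x_3,x_4]/(I_2,I_{12},I_{20},I_{30})$, where $I_{2k}$ is the sum of the $2k$-th powers of the 60 positive roots of type $H_4$, regarded as linear forms in $x_1,x_2,x_3,x_4$. Then the graded ring $R$ has the strong Lefschetz property.
   Context: Strong Lefschetz property: let $R=\bigoplus_{i\ge 0}R_i$ be a graded ring over a field $K$ with $\dim_K R_i<\infty$ for all $i$. $R$ is said to have the strong Lefschetz property if there exists an element $l\in R_1$ such that for every $i\ge 0$ and every $s>0$ the multiplication map $\times l^s: R_i\to R_{i+s}$, $f\mapsto l^s f$, is full-rank (i.e. injective or surjective, equivalently its rank is $\min(\dim_K R_i,\dim_K R_{i+s})$). Such an $l$ is called a (strong) Lefschetz element. Coxeter group of type $H_4$: the irreducible finite reflection group of order 14,400, acting on a 4-dimensional real vector space, whose root system has 120 roots (60 positive roots and their negatives). Its coinvariant ring is the quotient of the polynomial ring $\mathbb{R}[x_1,x_2,x_3,x_4]$ (standard grading, $\deg x_i=1$) by the ideal generated by the homogeneous invariants of positive degree; $I_2,I_{12},I_{20},I_{30}$ are fundamental invariants of the group, so this ideal is $(I_2,I_{12},I_{20},I_{30})$. Explicit realization: let $\tau\in\mathbb{R}$ be a root of $\tau^2-\tau-1$. The 60 positive roots (all with a common normalization; the positive system is chosen up to sign of each root, which does not affect the even powers) are the following linear forms: (a) the 4 forms $2x_1,2x_2,2x_3,2x_4$; (b) the 8 forms $x_1\pm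 x_2\pm x_3\pm x_4$; (c) the 48 forms which, up to an overall sign, are $\pm\tau x_{\sigma(1)}\pm\tau^{-1}x_{\sigma(2)}\pm x_{\sigma(3)}$, where $\sigma$ runs over the 12 even permutations of $\{1,2,3,4\}$ and the signs are arbitrary (4 forms up to overall sign for each $\sigma$). For a positive integer $k$, $I_{2k}=I_{2k}(x_1,x_2,x_3,x_4)$ denotes the sum of the $2k$-th powers of these 60 linear forms; the generators used are those with $k=1,6,10,15$. *)

theory Defs
  imports
    "HOL-Algebra.QuotRing"
    "HOL-Algebra.Embedded_Algebras"
    "HOL-Combinatorics.Permutations"
    "HOL-Library.Poly_Mapping"
    "HOL-Library.Numeral_Type"
    Complex_Main
begin

section \<open>Graded algebras and the strong Lefschetz property\<close>

text \<open>
  A commutative ring \<open>R\<close> containing the field \<open>K\<close>, with a direct sum decomposition into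
  finite-dimensional \<open>K\<close>-subspaces \<open>gr i\<close>. In the library, \<^const>\<open>subalgebra\<close> \<open>K V R\<close> only says
  that \<open>V\<close> is a \<open>K\<close>-linear subspace of \<open>R\<close>; closure of \<open>V\<close> under multiplication is not required.
\<close>

locale graded_algebra = cring R for R (structure) +
  fixes K :: "'a set" and gr :: "nat \<Rightarrow> 'a set"
  assumes K_subfield: "subfield K R"
    and gr_subspace: "subalgebra K (gr i) R"
    and gr_decomp: "x \<in> carrier R \<Longrightarrow>
      \<exists>!c. (\<forall>i. c i \<in> gr i) \<and> finite {i. c i \<noteq> \<zero>} \<and> x = (\<Oplus>i\<in>{i. c i \<noteq> \<zero>}. c i)"
    and gr_mult: "x \<in> gr i \<Longrightarrow> y \<in> gr j \<Longrightarrow> x \<otimes> y \<in> gr (i + j)"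
    and gr_finite_dimension: "finite_dimension K (gr i)"

definition strong_lefschetz_element :: "('a, 'b) ring_scheme \<Rightarrow> (nat \<Rightarrow> 'a set) \<Rightarrow> 'a \<Rightarrow> bool" where
  "strong_lefschetz_element R gr l \<longleftrightarrow> l \<in> gr 1 \<and>
    (\<forall>i s. s > 0 \<longrightarrow>
      inj_on (\<lambda>f. l [^]\<^bsub>R\<^esub> s \<otimes>\<^bsub>R\<^esub> f) (gr i) \<or>
      (\<lambda>f. l [^]\<^bsub>R\<^esub> s \<otimes>\<^bsub>R\<^esub> f) ` gr i = gr (i + s))"

definition strong_lefschetz_property :: "('a, 'b) ring_scheme \<Rightarrow> (nat \<Rightarrow> 'a set) \<Rightarrow> bool" where
  "strong_lefschetz_property R gr \<longleftrightarrow> (\<exists>l. strong_lefschetz_element R gr l)"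

section \<open>Real polynomials in four variables\<close>

text \<open>
  The variables are indexed by the four-element type \<open>4\<close>, whose elements are \<open>1\<close>, \<open>2\<close>, \<open>3\<close> and
  \<open>4\<close> (with \<open>4 = 0\<close>, as arithmetic in this type is modulo 4). A monomial is its exponent vector.
\<close>

type_synonym mpoly4 = "(4 \<Rightarrow>\<^sub>0 nat) \<Rightarrow>\<^sub>0 real"

definition Const :: "real \<Rightarrow> mpoly4" where
  "Const c = Poly_Mapping.single 0 c"

definition Var :: "4 \<Rightarrow> mpoly4" where
  "Var i = Poly_Mapping.single (Poly_Mapping.single i 1) 1"

definition homogeneous :: "nat \<Rightarrow> mpoly4 \<Rightarrow> bool" where
  "homogeneous d p \<longleftrightarrow>
    (\<forall>m \<in> Poly_Mapping.keys p. (\<Sum>i\<in>UNIV. Poly_Mapping.lookup m i) = d)"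

definition poly_ring4 :: "mpoly4 ring" where
  "poly_ring4 = \<lparr>carrier = UNIV, monoid.mult = (*), one = 1, zero = 0, add = (+)\<rparr>"

section \<open>The coinvariant ring of type \<open>H\<^sub>4\<close>\<close>

text \<open>
  In the third family the sign of each root is fixed by making the coefficient of
  \<open>Var (\<sigma> 3)\<close> equal to \<open>1\<close>.
\<close>

definition H4_positive_roots :: "real \<Rightarrow> mpoly4 set" where
  "H4_positive_roots \<tau> =
     {2 * Var i | i. True} \<union>
     {Var 1 + Const a * Var 2 + Const b * Var 3 + Const c * Var 4 | a b c.
        a \<in> {1, -1} \<and> b \<in> {1, -1} \<and> c \<in> {1, -1}} \<union>
     {Const (a * \<tau>) * Var (\<sigma> 1) + Const (b * inverse \<tau>) * Var (\<sigma> 2) + Var (\<sigma> 3) | \<sigma> a b.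
        \<sigma> permutes UNIV \<and> evenperm \<sigma> \<and> a \<in> {1, -1} \<and> b \<in> {1, -1}}"

text \<open>\<open>H4_invariant \<tau> d\<close> is \<open>I\<^sub>d\<close>, the sum of the \<open>d\<close>-th powers of the 60 positive roots.\<close>

definition H4_invariant :: "real \<Rightarrow> nat \<Rightarrow> mpoly4" where
  "H4_invariant \<tau> d = (\<Sum>r\<in>H4_positive_roots \<tau>. r ^ d)"

definition H4_ideal :: "real \<Rightarrow> mpoly4 set" where
  "H4_ideal \<tau> = Idl\<^bsub>poly_ring4\<^esub> (H4_invariant \<tau> ` {2, 12, 20, 30})"

definition H4_coinvariant_ring :: "real \<Rightarrow> mpoly4 set ring" where
  "H4_coinvariant_ring \<tau> = poly_ring4 Quot (H4_ideal \<tau>)"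

text \<open>The copy of the real numbers inside the coinvariant ring.\<close>

definition H4_scalars :: "real \<Rightarrow> mpoly4 set set" where
  "H4_scalars \<tau> = {H4_ideal \<tau> +>\<^bsub>poly_ring4\<^esub> Const c | c. True}"

definition H4_grading :: "real \<Rightarrow> nat \<Rightarrow> mpoly4 set set" where
  "H4_grading \<tau> i = {H4_ideal \<tau> +>\<^bsub>poly_ring4\<^esub> f | f. homogeneous i f}"

end

theory Submission
  imports Defs "HOL-Computational_Algebra.Formal_Power_Series"
begin

text \<open>
  The coinvariant ring has socle degree 60, and the strong Lefschetz property amounts to bijectivity of
  the multiplications from degree \<open>j\<close> to degree \<open>60 - j\<close>. The proof compares the ring with a
  direct sum of tensor products of truncated polynomial rings, for which this follows from the
  representation theory of \<open>sl\<^sub>2\<close>.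

  The comparison comes from the chain of parabolic subgroups
  \<open>1 \<subset> A\<^sub>1 \<subset> H\<^sub>2 \<subset> H\<^sub>3 \<subset> H\<^sub>4\<close>. With adapted coordinates \<open>d, c, b, a\<close> (an orthogonal system
  up to scaling), a homogeneous polynomial is expanded modulo the ideal in the products
  \<open>a ^ p\<^sub>4 * \<sigma> s * \<beta> t * b ^ p\<^sub>3 * c ^ p\<^sub>2 * d ^ p\<^sub>1\<close>, where \<open>p\<^sub>1 < 2\<close>, \<open>p\<^sub>2 < 5\<close>, where \<open>p\<^sub>3 < 11\<close> if
  \<open>\<beta> t = 1\<close> and \<open>p\<^sub>3 < 1\<close> if \<open>\<beta> t = \<sigma>5\<close> has degree 5, and where \<open>p\<^sub>4\<close> is below 46, 34, 26 and 14 for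
  four polynomials \<open>\<sigma> s\<close> of degrees 0, 6, 10 and 16 invariant under \<open>H\<^sub>3\<close>. For every choice of
  \<open>(s, t)\<close> the exponents fill a box that is symmetric about degree 30. When a multiplication by a
  variable leaves its box, the product is a combination of products of smaller weight, for a weight
  that counts \<open>d\<close> with 55, \<open>c\<close> with 11, \<open>\<sigma>5\<close> with 5 and \<open>b\<close> with 1; for \<open>a\<close> it even vanishes.

  Therefore the linear form \<open>\<Sum> t ^ W\<^sub>v * x\<^sub>v\<close>, written in the basis rescaled by the weights, acts as the
  sum of the shifts in the boxes plus an error of order \<open>t\<close>. The sum of the shifts is a raising operator
  of an \<open>sl\<^sub>2\<close>-action, hence its powers are injective between opposite degrees (\<open>shift_pow_eq_0\<close>),
  and this survives for small \<open>t\<close>: the power of the form maps degree \<open>j\<close> onto degree \<open>60 - j\<close>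
  (\<open>strong_lefschetz_surjective\<close>). Only spanning, and no linear independence, enters here.
  Injectivity follows by counting: the products in degrees up to 30 together with their multiples by
  powers of the form generate the polynomial ring over the four generators of the ideal, and their
  Hilbert series leaves no room for a relation (\<open>independent_mod_ideal\<close>, \<open>hilbert_H4\<close>).

  It remains to find the relations. Modulo the quadratic invariant each root power sum becomes a
  polynomial in the invariants of a pentagon in the plane of \<open>a, b\<close> and of one in the plane of
  \<open>d, c\<close>, because the 60 roots are obtained by combining the two pentagons. These power sums become the
  polynomials \<open>F12\<close>, \<open>F20\<close>, \<open>F30\<close> in \<open>\<alpha> = \<tau> * a\<^sup>2\<close> and two invariants \<open>\<phi>6\<close>, \<open>\<phi>10\<close> of \<open>H\<^sub>3\<close>, and the
  relations between \<open>a\<close> and the \<open>\<sigma> s\<close> are explicit combinations of these three.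
\<close>

section \<open>The sl2 action on functions on a box\<close>

text \<open>A function on exponent vectors is thought of as the values of a functional on the monomials; \<open>shift\<close> is the transpose of multiplication by the sum of the variables.\<close>

definition shift :: "(('k::finite \<Rightarrow> nat) \<Rightarrow> real) \<Rightarrow> ('k \<Rightarrow> nat) \<Rightarrow> real" where
  "shift \<phi> p = (\<Sum>k\<in>UNIV. \<phi> (p(k := Suc (p k))))"

text \<open>The lowering operator of the tensor product of the irreducible \<open>sl\<^sub>2\<close>-modules of dimensions \<open>m k\<close>.\<close>

definition unshift :: "('k::finite \<Rightarrow> nat) \<Rightarrow> (('k \<Rightarrow> nat) \<Rightarrow> real) \<Rightarrow> ('k \<Rightarrow> nat) \<Rightarrow> real" where
  "unshift m \<phi> p = (\<Sum>k\<in>UNIV. real (p k) * (real (m k) - real (p k)) * \<phi> (p(k := p k - 1)))"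

definition box_supported :: "('k::finite \<Rightarrow> nat) \<Rightarrow> nat \<Rightarrow> (('k \<Rightarrow> nat) \<Rightarrow> real) \<Rightarrow> bool" where
  "box_supported m i \<phi> \<longleftrightarrow> (\<forall>p. \<phi> p \<noteq> 0 \<longrightarrow> (\<forall>k. p k < m k) \<and> sum p UNIV = i)"

lemma sum_fun_upd:
  fixes p :: "'k::finite \<Rightarrow> nat"
  shows "sum (p(k := n)) UNIV + p k = sum p UNIV + n"
proof -
  have "sum (p(k := n)) UNIV = n + sum p (UNIV - {k})"
    by (subst sum.remove[of _ k]) (auto intro!: sum.cong)
  moreover have "sum p UNIV = p k + sum p (UNIV - {k})"
    by (subst sum.remove[of _ k]) auto
  ultimately show ?thesis by simp
qed

lemma box_supported_shift:
  assumes "box_supported m (Suc i) \<phi>"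
  shows "box_supported m i (shift \<phi>)"
  unfolding box_supported_def
proof (intro allI impI)
  fix p :: "'a \<Rightarrow> nat" assume "shift \<phi> p \<noteq> 0"
  then obtain k where "\<phi> (p(k := Suc (p k))) \<noteq> 0"
    unfolding shift_def by (meson sum.not_neutral_contains_not_neutral)
  then have *: "\<forall>j. (p(k := Suc (p k))) j < m j" "sum (p(k := Suc (p k))) UNIV = Suc i"
    using assms unfolding box_supported_def by blast+
  have "p j < m j" for j
    using *(1)[rule_format, of j] by (cases "j = k") auto
  moreover have "sum p UNIV = i" using sum_fun_upd[of p k "Suc (p k)"] *(2) by simp
  ultimately show "(\<forall>k. p k < m k) \<and> sum p UNIV = i" by blast
qed

lemma box_supported_unshift:
  assumes "box_supported m i \<phi>"
  shows "box_supported m (Suc i) (unshift m \<phi>)"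
  unfolding box_supported_def
proof (intro allI impI)
  fix p :: "'a \<Rightarrow> nat" assume "unshift m \<phi> p \<noteq> 0"
  then obtain k where "real (p k) * (real (m k) - real (p k)) * \<phi> (p(k := p k - 1)) \<noteq> 0"
    unfolding unshift_def by (meson sum.not_neutral_contains_not_neutral)
  then have nz: "p k \<noteq> 0" "p k \<noteq> m k" "\<phi> (p(k := p k - 1)) \<noteq> 0" by auto
  then have *: "\<forall>j. (p(k := p k - 1)) j < m j" "sum (p(k := p k - 1)) UNIV = i"
    using assms unfolding box_supported_def by blast+
  have "p j < m j" for j
    using *(1)[rule_format, of j] nz by (cases "j = k") auto
  moreover have "sum p UNIV = Suc i" using sum_fun_upd[of p k "p k - 1"] *(2) nz by simp
  ultimately show "(\<forall>k. p k < m k) \<and> sum p UNIV = Suc i" by blast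
qed

text \<open>On functions supported in degree \<open>D\<close> the commutator is a scalar, the weight: this is the relation \<open>[e, f] = h\<close> of \<open>sl\<^sub>2\<close>.\<close>

lemma shift_unshift_commutator:
  "shift (unshift m \<phi>) p = unshift m (shift \<phi>) p + (\<Sum>k\<in>UNIV. real (m k) - 1 - 2 * real (p k)) * \<phi> p"
proof -
  define up where "up j = p(j := Suc (p j))" for j
  define A where "A j k = real (up j k) * (real (m k) - real (up j k)) * \<phi> ((up j)(k := up j k - 1))" for j k
  define B where "B j k = real (p k) * (real (m k) - real (p k)) *
    \<phi> ((p(k := p k - 1))(j := Suc ((p(k := p k - 1)) j)))" for j k
  have l: "shift (unshift m \<phi>) p = (\<Sum>j\<in>UNIV. \<Sum>k\<in>UNIV. A j k)"
    by (simp add: shift_def unshift_def A_def up_def)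
  have "unshift m (shift \<phi>) p = (\<Sum>k\<in>UNIV. \<Sum>j\<in>UNIV. B j k)"
    by (simp add: shift_def unshift_def B_def sum_distrib_left)
  then have r: "unshift m (shift \<phi>) p = (\<Sum>j\<in>UNIV. \<Sum>k\<in>UNIV. B j k)"
    by (rule trans) (rule sum.swap)
  have off: "A j k = B j k" if "j \<noteq> k" for j k
  proof -
    have "(up j)(k := up j k - 1) = (p(k := p k - 1))(j := Suc ((p(k := p k - 1)) j))"
      using that by (auto simp: up_def fun_eq_iff)
    then show ?thesis using that by (simp add: A_def B_def up_def)
  qed
  have diag: "A k k = B k k + (real (m k) - 1 - 2 * real (p k)) * \<phi> p" for k
  proof -
    have A: "A k k = real (Suc (p k)) * (real (m k) - real (Suc (p k))) * \<phi> p"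
      by (simp add: A_def up_def)
    have B: "B k k = real (p k) * (real (m k) - real (p k)) * \<phi> p"
      by (cases "p k") (auto simp: B_def fun_upd_idem)
    show ?thesis unfolding A B by (simp add: algebra_simps)
  qed
  have "(\<Sum>k\<in>UNIV. A j k) = (\<Sum>k\<in>UNIV. B j k) + (real (m j) - 1 - 2 * real (p j)) * \<phi> p" for j
  proof -
    have "(\<Sum>k\<in>UNIV. A j k) = A j j + (\<Sum>k\<in>UNIV-{j}. A j k)" by (subst sum.remove[of _ j]) auto
    also have "(\<Sum>k\<in>UNIV-{j}. A j k) = (\<Sum>k\<in>UNIV-{j}. B j k)" using off by (intro sum.cong) auto
    also have "A j j + \<dots> = (B j j + (\<Sum>k\<in>UNIV-{j}. B j k)) + (real (m j) - 1 - 2 * real (p j)) * \<phi> p"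
      by (simp add: diag)
    also have "B j j + (\<Sum>k\<in>UNIV-{j}. B j k) = (\<Sum>k\<in>UNIV. B j k)" by (subst (2) sum.remove[of _ j]) auto
    finally show ?thesis .
  qed
  then show ?thesis unfolding l r by (simp add: sum.distrib sum_distrib_right)
qed

lemma shift_unshift_weight:
  assumes "box_supported m i \<phi>" and "(\<Sum>k\<in>UNIV. m k) = N + CARD('k::finite)"
  shows "shift (unshift m \<phi>) = (\<lambda>p. unshift m (shift \<phi>) p + (real N - 2 * real i) * \<phi> (p :: 'k \<Rightarrow> nat))"
proof
  fix p :: "'k \<Rightarrow> nat"
  have "(\<Sum>k\<in>UNIV. real (m k) - 1 - 2 * real (p k)) * \<phi> p = (real N - 2 * real i) * \<phi> p"
  proof (cases "\<phi> p = 0")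
    case False
    then have "sum p UNIV = i" using assms by (auto simp: box_supported_def)
    moreover have "(\<Sum>k\<in>UNIV. real (m k) - 1 - 2 * real (p k)) =
        real (\<Sum>k\<in>UNIV. m k) - real CARD('k) - 2 * real (sum p UNIV)"
      by (simp add: sum_subtractf sum_distrib_left)
    ultimately show ?thesis by (simp add: assms(2))
  qed simp
  then show "shift (unshift m \<phi>) p = unshift m (shift \<phi>) p + (real N - 2 * real i) * \<phi> p"
    using shift_unshift_commutator[of m \<phi> p] by simp
qed

lemma shift_zero [simp]: "shift (\<lambda>_. 0) = (\<lambda>_. 0)"
  by (simp add: shift_def fun_eq_iff)

lemma shift_pow_zero [simp]: "(shift ^^ n) (\<lambda>_. 0) = (\<lambda>_. 0)"
  by (induction n) auto

lemma unshift_zero [simp]: "unshift m (\<lambda>_. 0) = (\<lambda>_. 0)"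
  by (simp add: unshift_def fun_eq_iff)

lemma shift_add: "shift (\<lambda>p. f p + c * g p) = (\<lambda>p. shift f p + c * shift g p)"
  by (simp add: shift_def fun_eq_iff sum.distrib sum_distrib_left)


lemma box_supported_shift_pow:
  assumes "box_supported m i \<phi>" "n \<le> i"
  shows "box_supported m (i - n) ((shift ^^ n) \<phi>)"
  using assms(2)
proof (induction n)
  case (Suc n)
  then have "box_supported m (Suc (i - Suc n)) ((shift ^^ n) \<phi>)" by (simp add: Suc_diff_Suc)
  then show ?case using box_supported_shift by auto
qed (use assms in auto)

lemma shift_pow_unshift:
  fixes \<phi> :: "('k::finite \<Rightarrow> nat) \<Rightarrow> real"
  assumes "box_supported m i \<phi>" and "(\<Sum>k\<in>UNIV. m k) = N + CARD('k)" "n \<le> i"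
  shows "(shift ^^ Suc n) (unshift m \<phi>) =
    (\<lambda>p. unshift m ((shift ^^ Suc n) \<phi>) p + real (Suc n) * (real N + real n - 2 * real i) * (shift ^^ n) \<phi> p)"
  using assms(3)
proof (induction n)
  case 0
  then show ?case using shift_unshift_weight[OF assms(1,2)] by simp
next
  case (Suc n)
  have "(shift ^^ Suc (Suc n)) (unshift m \<phi>) = shift ((shift ^^ Suc n) (unshift m \<phi>))" by simp
  also have "\<dots> = shift (\<lambda>p. unshift m ((shift ^^ Suc n) \<phi>) p +
      real (Suc n) * (real N + real n - 2 * real i) * (shift ^^ n) \<phi> p)"
    using Suc by simp
  also have "\<dots> = (\<lambda>p. shift (unshift m ((shift ^^ Suc n) \<phi>)) p +
      real (Suc n) * (real N + real n - 2 * real i) * (shift ^^ Suc n) \<phi> p)"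
    by (subst shift_add) simp
  also have "shift (unshift m ((shift ^^ Suc n) \<phi>)) =
    (\<lambda>p. unshift m ((shift ^^ Suc (Suc n)) \<phi>) p + (real N - 2 * real (i - Suc n)) * (shift ^^ Suc n) \<phi> p)"
    by (subst shift_unshift_weight[OF box_supported_shift_pow[OF assms(1) Suc.prems] assms(2)]) simp
  finally show ?case
    using Suc.prems by (simp add: fun_eq_iff of_nat_diff algebra_simps)
qed

lemma shift_pow_descend:
  fixes \<phi> :: "('k::finite \<Rightarrow> nat) \<Rightarrow> real"
  assumes "box_supported m i \<phi>" and "(\<Sum>k\<in>UNIV. m k) = N + CARD('k)" and "n \<le> i"
    and "unshift m \<phi> = (\<lambda>_. 0)" and "(shift ^^ Suc n) \<phi> = (\<lambda>_. 0)"
    and "real N + real n \<noteq> 2 * real i"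
  shows "(shift ^^ n) \<phi> = (\<lambda>_. 0)"
proof
  fix p
  have "real (Suc n) * (real N + real n - 2 * real i) * (shift ^^ n) \<phi> p = 0"
    using fun_cong[OF shift_pow_unshift[OF assms(1-3)], of p] unfolding assms(4,5) shift_pow_zero unshift_zero
    by simp
  then show "(shift ^^ n) \<phi> p = 0" using assms(6) by (simp del: of_nat_Suc)
qed

text \<open>The standard \<open>sl\<^sub>2\<close> argument: a vector killed by a power of the raising operator that only reaches the opposite degree must vanish, because the commutation relation produces nonzero integer factors.\<close>

theorem shift_pow_eq_0:
  fixes \<phi> :: "('k::finite \<Rightarrow> nat) \<Rightarrow> real"
  assumes "(\<Sum>k\<in>UNIV. m k) = N + CARD('k)" and "box_supported m (N - j) \<phi>" "2 * j \<le> N"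
    and "(shift ^^ (N - 2 * j)) \<phi> = (\<lambda>_. 0)"
  shows "\<phi> = (\<lambda>_. 0)"
proof -
  have *: "\<phi> = (\<lambda>_. 0)"
    if "box_supported m (N - j) \<phi>" "2 * j \<le> N" "(shift ^^ (N - 2 * j)) \<phi> = (\<lambda>_. 0)"
      "unshift m \<phi> = (\<lambda>_. 0)" for j \<phi>
  proof -
    have "(shift ^^ (N - 2 * j - k)) \<phi> = (\<lambda>_. 0)" if "k \<le> N - 2 * j" for k
      using that
    proof (induction k)
      case (Suc k)
      define n where "n = N - 2 * j - Suc k"
      have n: "N - 2 * j - k = Suc n" "n \<le> N - j" using Suc.prems by (auto simp: n_def)
      have "real N + real n \<noteq> 2 * real (N - j)"
      proof
        assume "real N + real n = 2 * real (N - j)"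
        then have "N + n = 2 * (N - j)" by linarith
        then show False using Suc.prems by (simp add: n_def)
      qed
      then show ?case
        using shift_pow_descend[OF \<open>box_supported m (N - j) \<phi>\<close> assms(1) n(2) \<open>unshift m \<phi> = _\<close>]
          Suc n(1) unfolding n_def[symmetric] by simp
    qed (use \<open>(shift ^^ (N - 2 * j)) \<phi> = _\<close> in simp)
    from this[of "N - 2 * j"] show ?thesis by simp
  qed
  show ?thesis
    using assms(2-)
  proof (induction j arbitrary: \<phi>)
    case (0 \<phi>)
    have "unshift m \<phi> p = 0" for p
    proof (rule ccontr)
      assume "unshift m \<phi> p \<noteq> 0"
      then have p: "\<forall>k. p k < m k" "sum p UNIV = Suc N"
        using box_supported_unshift[OF 0(1)] by (auto simp: box_supported_def)
      have "sum (\<lambda>k. Suc (p k)) UNIV \<le> sum m UNIV" using p(1) by (intro sum_mono) (simp add: Suc_leI)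
      then show False using p(2) assms(1) by (simp add: sum_Suc)
    qed
    then show ?case using *[of 0 \<phi>] 0 by blast
  next
    case (Suc j \<phi>)
    define n where "n = N - 2 * Suc j"
    define i where "i = N - Suc j"
    have ni: "n \<le> i" using Suc.prems by (auto simp: n_def i_def)
    have nN: "real N + real n = 2 * real i"
      using Suc.prems by (simp add: n_def i_def of_nat_diff)
    have sup: "box_supported m i \<phi>" using Suc.prems by (simp add: i_def)
    have z1: "(shift ^^ Suc n) \<phi> = (\<lambda>_. 0)" using Suc.prems by (simp add: n_def)
    have "(shift ^^ Suc n) (unshift m \<phi>) = (\<lambda>_. 0)"
      unfolding shift_pow_unshift[OF sup assms(1) ni] z1 using nN by simp
    then have z2: "(shift ^^ Suc (Suc n)) (unshift m \<phi>) = (\<lambda>_. 0)" by simp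
    have e: "Suc (Suc n) = N - 2 * j" "Suc i = N - j" using Suc.prems by (auto simp: n_def i_def)
    have "unshift m \<phi> = (\<lambda>_. 0)"
      using Suc.IH[of "unshift m \<phi>"] box_supported_unshift[OF sup] z2 Suc.prems unfolding e by simp
    then show ?case using *[of "Suc j" \<phi>] Suc.prems by blast
  qed
qed


section \<open>Surjectivity by degeneration to boxes\<close>

lemma separating_functional:
  fixes U :: "'a::real_vector set"
  assumes "subspace U" "x \<notin> U"
  obtains \<phi> :: "'a \<Rightarrow> real" where "linear \<phi>" "\<And>u. u \<in> U \<Longrightarrow> \<phi> u = 0" "\<phi> x \<noteq> 0"
proof -
  obtain B where B: "B \<subseteq> U" "independent B" "U \<subseteq> span B"
    using maximal_independent_subset by blast
  have "span B = U" using B assms(1) by (simp add: span_minimal subset_antisym)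
  then have "independent (insert x B)" using B(2) assms(2) by (simp add: independent_insertI)
  then obtain \<phi> :: "'a \<Rightarrow> real" where \<phi>: "linear \<phi>" "\<forall>y\<in>insert x B. \<phi> y = (if y = x then 1 else 0)"
    using linear_independent_extend[of "insert x B" "\<lambda>y. if y = x then 1 else 0"] by blast
  have "\<phi> u = 0" if "u \<in> U" for u
  proof (rule linear_eq_0_on_span[OF \<phi>(1), of B])
    show "\<phi> b = 0" if "b \<in> B" for b using that \<phi>(2) B(1) assms(2) by auto
    show "u \<in> span B" using that B(3) by blast
  qed
  then show ?thesis using that[of \<phi>] \<phi> by auto
qed

text \<open>Injectivity of a finite linear system, in the quantitative form that is stable under small perturbations. Proved by Gaussian elimination of one unknown.\<close>

lemma injective_bounded_below:
  fixes M :: "'p \<Rightarrow> 'q \<Rightarrow> real"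
  assumes "finite Q" "finite P"
    and "\<And>\<phi>. (\<forall>p\<in>P. (\<Sum>q\<in>Q. M p q * \<phi> q) = 0) \<Longrightarrow> \<forall>q\<in>Q. \<phi> q = 0"
  shows "\<exists>C. \<forall>\<phi>. \<forall>q\<in>Q. \<bar>\<phi> q\<bar> \<le> C * (\<Sum>p\<in>P. \<bar>\<Sum>q\<in>Q. M p q * \<phi> q\<bar>)"
  using assms(1,3)
proof (induction Q arbitrary: M)
  case (insert q0 Q)
  have "\<exists>p0\<in>P. M p0 q0 \<noteq> 0"
  proof (rule ccontr)
    assume a: "\<not> (\<exists>p0\<in>P. M p0 q0 \<noteq> 0)"
    have "\<forall>q\<in>insert q0 Q. (if q = q0 then 1 else 0 :: real) = 0"
      using a by (intro insert.prems) (auto intro!: sum.neutral)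
    then show False by simp
  qed
  then obtain p0 where p0: "p0 \<in> P" "M p0 q0 \<noteq> 0" by blast
  define c where "c p = M p q0 / M p0 q0" for p
  define M' where "M' p q = M p q - c p * M p0 q" for p q
  define r where "r \<phi> p = (\<Sum>q\<in>insert q0 Q. M p q * \<phi> q)" for \<phi> p
  define R where "R \<phi> = (\<Sum>p\<in>P. \<bar>r \<phi> p\<bar>)" for \<phi>
  have r: "r \<phi> p = M p q0 * \<phi> q0 + (\<Sum>q\<in>Q. M p q * \<phi> q)" for \<phi> p
    using insert.hyps by (simp add: r_def)
  have M': "(\<Sum>q\<in>Q. M' p q * \<phi> q) = r \<phi> p - c p * r \<phi> p0" for p \<phi>
  proof -
    have "(\<Sum>q\<in>Q. M' p q * \<phi> q) = (\<Sum>q\<in>Q. M p q * \<phi> q) - c p * (\<Sum>q\<in>Q. M p0 q * \<phi> q)"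
      by (simp add: M'_def algebra_simps sum_subtractf sum_distrib_left)
    also have "\<dots> = r \<phi> p - c p * r \<phi> p0" using p0 by (simp add: r c_def field_simps)
    finally show ?thesis .
  qed
  have "\<forall>q\<in>Q. \<phi> q = 0" if z: "\<forall>p\<in>P. (\<Sum>q\<in>Q. M' p q * \<phi> q) = 0" for \<phi>
  proof -
    define \<psi> where "\<psi> = \<phi>(q0 := - (\<Sum>q\<in>Q. M p0 q * \<phi> q) / M p0 q0)"
    have eq: "(\<Sum>q\<in>Q. M p q * \<psi> q) = (\<Sum>q\<in>Q. M p q * \<phi> q)" for p
      using insert.hyps by (intro sum.cong) (auto simp: \<psi>_def)
    have eq': "(\<Sum>q\<in>Q. M' p q * \<psi> q) = (\<Sum>q\<in>Q. M' p q * \<phi> q)" for p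
      using insert.hyps by (intro sum.cong) (auto simp: \<psi>_def)
    have "r \<psi> p0 = 0" unfolding r eq using p0 by (simp add: \<psi>_def)
    then have "r \<psi> p = 0" if "p \<in> P" for p using M'[of p \<psi>] z that eq' by simp
    then have "\<forall>q\<in>insert q0 Q. \<psi> q = 0" by (intro insert.prems) (auto simp: r_def)
    then show ?thesis using insert.hyps by (auto simp: \<psi>_def split: if_splits)
  qed
  from insert.IH[OF this] obtain C where C: "\<And>\<phi> q. q \<in> Q \<Longrightarrow> \<bar>\<phi> q\<bar> \<le> C * (\<Sum>p\<in>P. \<bar>\<Sum>q\<in>Q. M' p q * \<phi> q\<bar>)"
    by blast
  define C1 where "C1 = max C 0 * (1 + (\<Sum>p\<in>P. \<bar>c p\<bar>))"
  have Rr: "\<bar>r \<phi> p\<bar> \<le> R \<phi>" if "p \<in> P" for \<phi> p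
    unfolding R_def using that assms(2) by (intro member_le_sum) auto
  have R0: "R \<phi> \<ge> 0" for \<phi> by (simp add: R_def sum_nonneg)
  have C1: "\<bar>\<phi> q\<bar> \<le> C1 * R \<phi>" if "q \<in> Q" for \<phi> q
  proof -
    have "(\<Sum>p\<in>P. \<bar>\<Sum>q\<in>Q. M' p q * \<phi> q\<bar>) \<le> (\<Sum>p\<in>P. \<bar>r \<phi> p\<bar> + \<bar>c p\<bar> * R \<phi>)"
    proof (rule sum_mono)
      fix p
      have "\<bar>r \<phi> p - c p * r \<phi> p0\<bar> \<le> \<bar>r \<phi> p\<bar> + \<bar>c p * r \<phi> p0\<bar>" by (rule abs_triangle_ineq4)
      also have "\<bar>c p * r \<phi> p0\<bar> \<le> \<bar>c p\<bar> * R \<phi>" using Rr[OF p0(1)] by (simp add: abs_mult mult_left_mono)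
      finally show "\<bar>\<Sum>q\<in>Q. M' p q * \<phi> q\<bar> \<le> \<bar>r \<phi> p\<bar> + \<bar>c p\<bar> * R \<phi>" unfolding M' by simp
    qed
    also have "\<dots> = (1 + (\<Sum>p\<in>P. \<bar>c p\<bar>)) * R \<phi>"
      by (simp add: sum.distrib sum_distrib_right R_def algebra_simps)
    finally have le: "(\<Sum>p\<in>P. \<bar>\<Sum>q\<in>Q. M' p q * \<phi> q\<bar>) \<le> (1 + (\<Sum>p\<in>P. \<bar>c p\<bar>)) * R \<phi>" .
    have "\<bar>\<phi> q\<bar> \<le> C * (\<Sum>p\<in>P. \<bar>\<Sum>q\<in>Q. M' p q * \<phi> q\<bar>)" using C[OF that] .
    also have "\<dots> \<le> max C 0 * (\<Sum>p\<in>P. \<bar>\<Sum>q\<in>Q. M' p q * \<phi> q\<bar>)"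
      by (intro mult_right_mono) (auto simp: sum_nonneg)
    also have "\<dots> \<le> max C 0 * ((1 + (\<Sum>p\<in>P. \<bar>c p\<bar>)) * R \<phi>)" using le by (intro mult_left_mono) auto
    finally show ?thesis by (simp add: C1_def mult.assoc)
  qed
  define C2 where "C2 = (1 + (\<Sum>q\<in>Q. \<bar>M p0 q\<bar>) * C1) / \<bar>M p0 q0\<bar>"
  have C1': "C1 \<ge> 0" unfolding C1_def by (intro mult_nonneg_nonneg add_nonneg_nonneg sum_nonneg) auto
  have C2: "\<bar>\<phi> q0\<bar> \<le> C2 * R \<phi>" for \<phi>
  proof -
    have "M p0 q0 * \<phi> q0 = r \<phi> p0 - (\<Sum>q\<in>Q. M p0 q * \<phi> q)" by (simp add: r)
    then have "\<bar>M p0 q0\<bar> * \<bar>\<phi> q0\<bar> = \<bar>r \<phi> p0 - (\<Sum>q\<in>Q. M p0 q * \<phi> q)\<bar>" by (simp add: abs_mult[symmetric])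
    also have "\<dots> \<le> \<bar>r \<phi> p0\<bar> + \<bar>\<Sum>q\<in>Q. M p0 q * \<phi> q\<bar>" by (rule abs_triangle_ineq4)
    also have "\<bar>\<Sum>q\<in>Q. M p0 q * \<phi> q\<bar> \<le> (\<Sum>q\<in>Q. \<bar>M p0 q\<bar> * (C1 * R \<phi>))"
      by (rule order_trans[OF sum_abs]) (auto intro!: sum_mono mult_left_mono C1 simp: abs_mult)
    also have "\<bar>r \<phi> p0\<bar> \<le> R \<phi>" using Rr[OF p0(1)] .
    finally have "\<bar>M p0 q0\<bar> * \<bar>\<phi> q0\<bar> \<le> (1 + (\<Sum>q\<in>Q. \<bar>M p0 q\<bar>) * C1) * R \<phi>"
      by (simp add: sum_distrib_right distrib_right mult.assoc)
    then show ?thesis using p0(2) by (simp add: C2_def field_simps)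
  qed
  have "\<bar>\<phi> q\<bar> \<le> max C1 C2 * (\<Sum>p\<in>P. \<bar>\<Sum>q\<in>insert q0 Q. M p q * \<phi> q\<bar>)" if "q \<in> insert q0 Q" for \<phi> q
  proof -
    have "\<bar>\<phi> q\<bar> \<le> C1 * R \<phi> \<or> \<bar>\<phi> q\<bar> \<le> C2 * R \<phi>" using that C1 C2 by auto
    moreover have "C1 * R \<phi> \<le> max C1 C2 * R \<phi>" "C2 * R \<phi> \<le> max C1 C2 * R \<phi>"
      using R0 by (auto intro!: mult_right_mono)
    ultimately have "\<bar>\<phi> q\<bar> \<le> max C1 C2 * R \<phi>" by linarith
    then show ?thesis by (simp add: R_def r_def)
  qed
  then show ?case by blast
qed simp

lemma shift_pow_sum:
  "finite Q \<Longrightarrow> (shift ^^ n) (\<lambda>p. \<Sum>q\<in>Q. c q * f q p) p = (\<Sum>q\<in>Q. c q * (shift ^^ n) (f q) p)"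
proof (induction n arbitrary: p)
  case (Suc n)
  have "(shift ^^ Suc n) (\<lambda>p. \<Sum>q\<in>Q. c q * f q p) p = shift ((shift ^^ n) (\<lambda>p. \<Sum>q\<in>Q. c q * f q p)) p" by simp
  also have "(shift ^^ n) (\<lambda>p. \<Sum>q\<in>Q. c q * f q p) = (\<lambda>p. \<Sum>q\<in>Q. c q * (shift ^^ n) (f q) p)"
    using Suc by auto
  also have "shift \<dots> p = (\<Sum>q\<in>Q. c q * (shift ^^ Suc n) (f q) p)"
    unfolding shift_def by (subst sum.swap) (simp add: sum_distrib_left shift_def)
  finally show ?case .
qed simp

lemma finite_box: "finite {p :: 'k::finite \<Rightarrow> nat. \<forall>k. p k < m k}"
proof -
  have "{p :: 'k \<Rightarrow> nat. \<forall>k. p k < m k} \<subseteq> PiE UNIV (\<lambda>k. {..<m k})" by auto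
  then show ?thesis by (rule finite_subset) (auto intro: finite_PiE)
qed

text \<open>Quantitative form of the injectivity on boxes: a finite linear system with trivial kernel is bounded below.\<close>

lemma shift_pow_bounded_below:
  fixes m :: "'k::finite \<Rightarrow> nat"
  assumes "(\<Sum>k\<in>UNIV. m k) = N + CARD('k)" "2 * j \<le> N"
  shows "\<exists>C. \<forall>\<phi> b. box_supported m (N - j) \<phi> \<longrightarrow> (\<forall>p. \<bar>(shift ^^ (N - 2 * j)) \<phi> p\<bar> \<le> b) \<longrightarrow> (\<forall>p. \<bar>\<phi> p\<bar> \<le> C * b)"
proof -
  define B where "B = {p. \<forall>k. p k < m k}"
  define Q where "Q = {p \<in> B. sum p UNIV = N - j}"
  have fin: "finite B" "finite Q" unfolding Q_def B_def using finite_box[of m] by auto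
  define n where "n = N - 2 * j"
  define M where "M p q = (shift ^^ n) (\<lambda>p. if p = q then 1 else 0) p" for p q :: "'k \<Rightarrow> nat"
  have M: "(shift ^^ n) \<phi> p = (\<Sum>q\<in>Q. M p q * \<phi> q)" if "box_supported m (N - j) \<phi>" for \<phi> p
  proof -
    have "\<phi> = (\<lambda>p. \<Sum>q\<in>Q. \<phi> q * (if p = q then 1 else 0))"
    proof
      fix p show "\<phi> p = (\<Sum>q\<in>Q. \<phi> q * (if p = q then 1 else 0))"
      proof -
        have "(\<Sum>q\<in>Q. \<phi> q * (if p = q then 1 else 0)) = (\<Sum>q\<in>Q. if p = q then \<phi> q else 0)"
          by (intro sum.cong) auto
        also have "\<dots> = (if p \<in> Q then \<phi> p else 0)" using fin(2) by simp
        also have "\<dots> = \<phi> p" using that by (auto simp: box_supported_def Q_def B_def)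
        finally show ?thesis by simp
      qed
    qed
    then have "(shift ^^ n) \<phi> p = (shift ^^ n) (\<lambda>p. \<Sum>q\<in>Q. \<phi> q * (if p = q then 1 else 0)) p" by simp
    also have "\<dots> = (\<Sum>q\<in>Q. M p q * \<phi> q)" by (subst shift_pow_sum[OF fin(2)]) (simp add: M_def mult.commute)
    finally show ?thesis .
  qed
  have supp: "box_supported m (N - j) (\<lambda>p. if p \<in> Q then \<phi> p else 0)" for \<phi>
    by (auto simp: box_supported_def Q_def B_def)
  have "\<forall>q\<in>Q. \<phi> q = 0" if z: "\<forall>p\<in>B. (\<Sum>q\<in>Q. M p q * \<phi> q) = 0" for \<phi>
  proof -
    define \<psi> where "\<psi> p = (if p \<in> Q then \<phi> p else 0)" for p
    have s: "box_supported m (N - j) \<psi>" using supp unfolding \<psi>_def .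
    have "(shift ^^ n) \<psi> p = 0" for p
    proof (cases "p \<in> B")
      case True
      have "(shift ^^ n) \<psi> p = (\<Sum>q\<in>Q. M p q * \<phi> q)" unfolding M[OF s] by (intro sum.cong) (auto simp: \<psi>_def)
      then show ?thesis using z True by simp
    next
      case False
      have "box_supported m (N - j - n) ((shift ^^ n) \<psi>)"
        by (rule box_supported_shift_pow[OF s]) (auto simp: n_def)
      then show ?thesis using False by (auto simp: box_supported_def B_def)
    qed
    then have "\<psi> = (\<lambda>_. 0)" using shift_pow_eq_0[OF assms(1) s assms(2)] unfolding n_def by auto
    then show ?thesis unfolding \<psi>_def by (meson)
  qed
  from injective_bounded_below[OF fin(2,1) this] obtain C where
    C: "\<And>\<phi> q. q \<in> Q \<Longrightarrow> \<bar>\<phi> q\<bar> \<le> C * (\<Sum>p\<in>B. \<bar>\<Sum>q\<in>Q. M p q * \<phi> q\<bar>)" by blast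
  have "\<bar>\<phi> p\<bar> \<le> max C 0 * real (card B) * b"
    if s: "box_supported m (N - j) \<phi>" and b: "\<forall>p. \<bar>(shift ^^ n) \<phi> p\<bar> \<le> b" for \<phi> b p
  proof (cases "p \<in> Q")
    case True
    have "(\<Sum>p\<in>B. \<bar>\<Sum>q\<in>Q. M p q * \<phi> q\<bar>) \<le> (\<Sum>p\<in>B. b)"
      using b unfolding M[OF s] by (intro sum_mono) auto
    then have le: "(\<Sum>p\<in>B. \<bar>\<Sum>q\<in>Q. M p q * \<phi> q\<bar>) \<le> real (card B) * b" by simp
    have "\<bar>\<phi> p\<bar> \<le> C * (\<Sum>p\<in>B. \<bar>\<Sum>q\<in>Q. M p q * \<phi> q\<bar>)" using C True by blast
    also have "\<dots> \<le> max C 0 * (\<Sum>p\<in>B. \<bar>\<Sum>q\<in>Q. M p q * \<phi> q\<bar>)"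
      by (intro mult_right_mono) (auto simp: sum_nonneg)
    also have "\<dots> \<le> max C 0 * (real (card B) * b)" using le by (intro mult_left_mono) auto
    finally show ?thesis by (simp add: mult.assoc)
  next
    case False
    have "b \<ge> 0" using b abs_ge_zero order_trans by blast
    moreover have "\<phi> p = 0" using s False by (auto simp: box_supported_def Q_def B_def)
    ultimately show ?thesis by simp
  qed
  then show ?thesis unfolding n_def by blast
qed


lemma span_finite_Un_subspace:
  assumes "finite Q" "subspace J" "y \<in> span (f ` Q \<union> J)"
  shows "\<exists>c. y - (\<Sum>q\<in>Q. c q *\<^sub>R f q) \<in> J"
proof -
  have "y \<in> {u + v |u v. u \<in> span (f ` Q) \<and> v \<in> span J}" using assms(3) by (simp add: span_Un)
  then obtain u v where uv: "u \<in> span (f ` Q)" "v \<in> J" "y = u + v"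
    using assms(2) by (auto simp: span_eq_iff[THEN iffD2])
  have "\<exists>c. u = (\<Sum>q\<in>Q. c q *\<^sub>R f q)" using uv(1)
  proof (induction rule: span_induct_alt)
    case base
    show ?case by (rule exI[of _ "\<lambda>_. 0"]) simp
  next
    case (step a x z)
    then obtain q c where q: "q \<in> Q" "x = f q" "z = (\<Sum>q\<in>Q. c q *\<^sub>R f q)" by auto
    have "(\<Sum>p\<in>Q. ((if p = q then a else 0) + c p) *\<^sub>R f p) =
        (\<Sum>p\<in>Q. if p = q then a *\<^sub>R f p else 0) + (\<Sum>p\<in>Q. c p *\<^sub>R f p)"
      unfolding sum.distrib[symmetric] by (intro sum.cong) (auto simp: algebra_simps)
    then have "a *\<^sub>R x + z = (\<Sum>p\<in>Q. ((if p = q then a else 0) + c p) *\<^sub>R f p)"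
      using q assms(1) by simp
    then show ?case by (rule exI[of _ "\<lambda>p. (if p = q then a else 0) + c p"])
  qed
  then obtain c where "u = (\<Sum>q\<in>Q. c q *\<^sub>R f q)" ..
  then have "y - (\<Sum>q\<in>Q. c q *\<^sub>R f q) \<in> J" using uv by simp
  then show ?thesis by (rule exI[of _ c])
qed

text \<open>Abstract boxes: for each index \<open>i\<close> a top element and a box with sides \<open>m i k\<close>, of which the total length makes the box symmetric about degree \<open>N / 2\<close>. Neither spanning nor independence is demanded.\<close>

locale string_basis =
  fixes J :: "'a::{comm_ring_1,real_algebra_1} set"
    and x :: "'k::finite \<Rightarrow> 'a" and W :: "'k \<Rightarrow> nat"
    and K :: "'i set" and \<sigma> :: "'i \<Rightarrow> 'a" and m :: "'i \<Rightarrow> 'k \<Rightarrow> nat"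
    and deg0 wt0 :: "'i \<Rightarrow> nat" and N :: nat
  assumes J_subspace: "subspace J" and J_mult: "j \<in> J \<Longrightarrow> f * j \<in> J"
    and finite_K: "finite K"
    and centre: "i \<in> K \<Longrightarrow> 2 * deg0 i + sum (m i) UNIV = N + CARD('k)"
begin

definition elt :: "'i \<times> ('k \<Rightarrow> nat) \<Rightarrow> 'a" where
  "elt = (\<lambda>(i, p). \<sigma> i * (\<Prod>k\<in>UNIV. x k ^ p k))"

definition deg :: "'i \<times> ('k \<Rightarrow> nat) \<Rightarrow> nat" where
  "deg = (\<lambda>(i, p). deg0 i + sum p UNIV)"

definition wt :: "'i \<times> ('k \<Rightarrow> nat) \<Rightarrow> nat" where
  "wt = (\<lambda>(i, p). wt0 i + (\<Sum>k\<in>UNIV. W k * p k))"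

definition idx :: "nat \<Rightarrow> ('i \<times> ('k \<Rightarrow> nat)) set" where
  "idx n = {(i, p). i \<in> K \<and> (\<forall>k. p k < m i k) \<and> deg (i, p) = n}"

definition lin :: "real \<Rightarrow> 'a" where
  "lin t = (\<Sum>k\<in>UNIV. t ^ W k *\<^sub>R x k)"

lemma finite_idx: "finite (idx n)"
proof -
  have "idx n \<subseteq> (SIGMA i:K. {p. \<forall>k. p k < m i k})" by (auto simp: idx_def)
  then show ?thesis by (rule finite_subset) (use finite_K finite_box in auto)
qed

lemma elt_upd: "elt (i, p(k := Suc (p k))) = x k * elt (i, p)"
proof -
  have "(\<Prod>j\<in>UNIV. x j ^ (p(k := Suc (p k))) j) = x k ^ Suc (p k) * (\<Prod>j\<in>UNIV-{k}. x j ^ p j)"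
    by (subst prod.remove[of _ k]) (auto intro!: prod.cong)
  moreover have "(\<Prod>j\<in>UNIV. x j ^ p j) = x k ^ p k * (\<Prod>j\<in>UNIV-{k}. x j ^ p j)"
    by (subst prod.remove[of _ k]) auto
  ultimately show ?thesis by (simp add: elt_def mult_ac)
qed

lemma deg_upd: "deg (i, p(k := Suc (p k))) = Suc (deg (i, p))"
  using sum_fun_upd[of p k "Suc (p k)"] by (simp add: deg_def)

lemma wt_upd: "wt (i, p(k := Suc (p k))) = wt (i, p) + W k"
proof -
  have "(\<Sum>j\<in>UNIV. W j * (p(k := Suc (p k))) j) = W k * Suc (p k) + (\<Sum>j\<in>UNIV-{k}. W j * p j)"
    by (subst sum.remove[of _ k]) (auto intro!: sum.cong)
  moreover have "(\<Sum>j\<in>UNIV. W j * p j) = W k * p k + (\<Sum>j\<in>UNIV-{k}. W j * p j)"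
    by (subst sum.remove[of _ k]) auto
  ultimately show ?thesis by (simp add: wt_def)
qed

end

text \<open>Leaving a box costs weight: the product is a combination of elements whose weight is strictly less than the naive one.\<close>

locale straightened_string_basis = string_basis +
  assumes straight: "\<lbrakk>i \<in> K; \<forall>j. p j < m i j; Suc (p k) = m i k\<rbrakk> \<Longrightarrow>
    x k * elt (i, p) \<in> span (elt ` {q \<in> idx (Suc (deg (i, p))). wt q < wt (i, p) + W k} \<union> J)"
begin


definition sc :: "'c \<times> ('b \<Rightarrow> nat) \<Rightarrow> 'b \<Rightarrow> 'c \<times> ('b \<Rightarrow> nat) \<Rightarrow> real" where
  "sc ip k = (SOME c. x k * elt ip - (\<Sum>q\<in>{q \<in> idx (Suc (deg ip)). wt q < wt ip + W k}. c q *\<^sub>R elt q) \<in> J)"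

lemma sc:
  assumes "i \<in> K" "\<forall>j. p j < m i j" "Suc (p k) = m i k"
  shows "x k * elt (i, p) -
    (\<Sum>q\<in>{q \<in> idx (Suc (deg (i, p))). wt q < wt (i, p) + W k}. sc (i, p) k q *\<^sub>R elt q) \<in> J"
proof -
  have "\<exists>c. x k * elt (i, p) -
    (\<Sum>q\<in>{q \<in> idx (Suc (deg (i, p))). wt q < wt (i, p) + W k}. c q *\<^sub>R elt q) \<in> J"
    by (rule span_finite_Un_subspace[OF _ J_subspace straight[OF assms]]) (simp add: finite_idx)
  from someI_ex[OF this] show ?thesis unfolding sc_def .
qed

definition sc_bound :: real where
  "sc_bound = (\<Sum>ip\<in>(\<Union>n\<le>N. idx n). \<Sum>k\<in>UNIV. \<Sum>q\<in>idx (Suc (deg ip)). \<bar>sc ip k q\<bar>)"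

lemma deg_le:
  assumes "q \<in> idx n" shows "n \<le> N"
proof -
  obtain i p where q: "q = (i, p)" "i \<in> K" "\<forall>k. p k < m i k" "deg0 i + sum p UNIV = n"
    using assms by (auto simp: idx_def deg_def)
  have "sum (\<lambda>k. Suc (p k)) UNIV \<le> sum (m i) UNIV" using q(3) by (intro sum_mono) (simp add: Suc_leI)
  then have "sum p UNIV + CARD('b) \<le> sum (m i) UNIV" by (simp add: sum_Suc)
  then show ?thesis using centre[OF q(2)] q(4) by simp
qed

definition coef :: "('a \<Rightarrow> real) \<Rightarrow> real \<Rightarrow> nat \<Rightarrow> nat \<Rightarrow> 'c \<Rightarrow> ('b \<Rightarrow> nat) \<Rightarrow> real" where
  "coef \<phi> t n s i p = (if (i, p) \<in> idx (n - s) then \<phi> (lin t ^ s * t ^ wt (i, p) *\<^sub>R elt (i, p)) else 0)"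

lemma coef_step:
  assumes \<phi>: "linear \<phi>" "\<And>j. j \<in> J \<Longrightarrow> \<phi> j = 0" and t: "0 < t" "t \<le> 1"
    and s: "Suc s \<le> n" and B: "\<And>i p. \<bar>coef \<phi> t n s i p\<bar> \<le> B"
  shows "\<bar>coef \<phi> t n (Suc s) i p - shift (coef \<phi> t n s i) p\<bar> \<le> t * sc_bound * B"
proof (cases "(i, p) \<in> idx (n - Suc s)")
  case False
  have B0: "B \<ge> 0" using B[of undefined undefined] by linarith
  have "sc_bound \<ge> 0" unfolding sc_bound_def by (intro sum_nonneg) auto
  moreover have "coef \<phi> t n s i (p(k := Suc (p k))) = 0" for k
  proof (rule ccontr)
    assume "coef \<phi> t n s i (p(k := Suc (p k))) \<noteq> 0"
    then have a: "(i, p(k := Suc (p k))) \<in> idx (n - s)" by (auto simp: coef_def split: if_splits)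
    then have "\<forall>j. (p(k := Suc (p k))) j < m i j" by (auto simp: idx_def)
    then have "p j < m i j" for j by (cases "j = k") (auto dest: spec[of _ j])
    moreover have "Suc (deg (i, p)) = n - s" "i \<in> K" using a deg_upd by (auto simp: idx_def)
    ultimately show False using False s by (auto simp: idx_def)
  qed
  ultimately show ?thesis using False B0 t by (simp add: coef_def[of \<phi> t n "Suc s"] shift_def)
next
  case True
  then have ip: "i \<in> K" "\<forall>j. p j < m i j" "deg (i, p) = n - Suc s" by (auto simp: idx_def)
  then have sd: "Suc (deg (i, p)) = n - s" using s by simp
  have "n - Suc s \<le> N" using deg_le[OF True] .
  define L where "L k = {q \<in> idx (Suc (deg (i, p))). wt q < wt (i, p) + W k}" for k
  define T where "T k = \<phi> (lin t ^ s * (t ^ (W k + wt (i, p)) *\<^sub>R (x k * elt (i, p))))" for k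
  note lin_simps = linear_add[OF \<phi>(1)] linear_scale[OF \<phi>(1)] linear_sum[OF \<phi>(1)] linear_diff[OF \<phi>(1)]
  have "lin t ^ Suc s * t ^ wt (i, p) *\<^sub>R elt (i, p) =
      (\<Sum>k\<in>UNIV. lin t ^ s * (t ^ (W k + wt (i, p)) *\<^sub>R (x k * elt (i, p))))"
  proof -
    have "lin t ^ Suc s * t ^ wt (i, p) *\<^sub>R elt (i, p) = lin t ^ s * (lin t * t ^ wt (i, p) *\<^sub>R elt (i, p))"
      by (simp add: mult_ac power_Suc2 del: power_Suc)
    also have "lin t * t ^ wt (i, p) *\<^sub>R elt (i, p) = (\<Sum>k\<in>UNIV. t ^ (W k + wt (i, p)) *\<^sub>R (x k * elt (i, p)))"
      unfolding lin_def sum_distrib_right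
      by (intro sum.cong refl) (simp add: power_add mult.commute)
    finally show ?thesis by (simp add: sum_distrib_left)
  qed
  then have c1: "coef \<phi> t n (Suc s) i p = (\<Sum>k\<in>UNIV. T k)"
    using True by (simp add: coef_def T_def lin_simps)
  have inb: "T k = coef \<phi> t n s i (p(k := Suc (p k)))" if "Suc (p k) < m i k" for k
  proof -
    have "(i, p(k := Suc (p k))) \<in> idx (n - s)"
      using ip that sd deg_upd[of i p k] by (auto simp: idx_def)
    then show ?thesis by (simp add: coef_def T_def elt_upd wt_upd add.commute)
  qed
  have out: "\<bar>T k - coef \<phi> t n s i (p(k := Suc (p k)))\<bar> \<le> t * B * (\<Sum>q\<in>idx (Suc (deg (i, p))). \<bar>sc (i, p) k q\<bar>)" for k
  proof (cases "Suc (p k) < m i k")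
    case True
    have "B \<ge> 0" using B[of undefined undefined] by linarith
    then show ?thesis using inb[OF True] t by (simp add: sum_nonneg)
  next
    case False
    then have k: "Suc (p k) = m i k" using ip(2)[rule_format, of k] by simp
    have c0: "coef \<phi> t n s i (p(k := Suc (p k))) = 0"
      using k by (auto simp: coef_def idx_def dest: spec[of _ k])
    define j where "j = x k * elt (i, p) - (\<Sum>q\<in>L k. sc (i, p) k q *\<^sub>R elt q)"
    have jJ: "j \<in> J" using sc[OF ip(1,2) k] by (simp add: j_def L_def)
    have xk: "x k * elt (i, p) = j + (\<Sum>q\<in>L k. sc (i, p) k q *\<^sub>R elt q)" by (simp add: j_def)
    have "\<phi> (lin t ^ s * (t ^ (W k + wt (i, p)) *\<^sub>R j)) = 0"
      using \<phi>(2)[OF J_mult[OF subspace_scale[OF J_subspace jJ]]] .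
    then have "T k = (\<Sum>q\<in>L k. \<phi> (lin t ^ s * (t ^ (W k + wt (i, p)) *\<^sub>R (sc (i, p) k q *\<^sub>R elt q))))"
      unfolding T_def xk by (simp add: lin_simps scaleR_add_right distrib_left scaleR_sum_right sum_distrib_left)
    also have "\<dots> = (\<Sum>q\<in>L k. sc (i, p) k q * t ^ (W k + wt (i, p) - wt q) * coef \<phi> t n s (fst q) (snd q))"
    proof (intro sum.cong refl)
      fix q assume q: "q \<in> L k"
      then have w: "t ^ (W k + wt (i, p)) = t ^ (W k + wt (i, p) - wt q) * t ^ wt q"
        by (simp add: L_def power_add[symmetric])
      have "\<phi> (lin t ^ s * (t ^ (W k + wt (i, p)) *\<^sub>R (sc (i, p) k q *\<^sub>R elt q))) =
          t ^ (W k + wt (i, p)) * (sc (i, p) k q * \<phi> (lin t ^ s * elt q))"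
        by (simp only: mult_scaleR_right linear_scale[OF \<phi>(1)] real_scaleR_def)
      moreover have "coef \<phi> t n s (fst q) (snd q) = t ^ wt q * \<phi> (lin t ^ s * elt q)"
        using q sd by (simp add: coef_def L_def linear_scale[OF \<phi>(1)])
      ultimately show "\<phi> (lin t ^ s * (t ^ (W k + wt (i, p)) *\<^sub>R (sc (i, p) k q *\<^sub>R elt q))) =
          sc (i, p) k q * t ^ (W k + wt (i, p) - wt q) * coef \<phi> t n s (fst q) (snd q)"
        by (simp only: w mult_ac)
    qed
    finally have "\<bar>T k\<bar> \<le> (\<Sum>q\<in>L k. \<bar>sc (i, p) k q\<bar> * (t * B))"
    proof -
      assume "T k = (\<Sum>q\<in>L k. sc (i, p) k q * t ^ (W k + wt (i, p) - wt q) * coef \<phi> t n s (fst q) (snd q))"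
      then have "\<bar>T k\<bar> \<le> (\<Sum>q\<in>L k. \<bar>sc (i, p) k q * t ^ (W k + wt (i, p) - wt q) * coef \<phi> t n s (fst q) (snd q)\<bar>)"
        by (simp only: sum_abs)
      also have "\<dots> \<le> (\<Sum>q\<in>L k. \<bar>sc (i, p) k q\<bar> * (t * B))"
      proof (rule sum_mono)
        fix q assume q: "q \<in> L k"
        then have "wt q < wt (i, p) + W k" by (simp add: L_def)
        then have "W k + wt (i, p) - wt q \<ge> 1" by linarith
        then have "t ^ (W k + wt (i, p) - wt q) \<le> t ^ 1" using t by (intro power_decreasing) auto
        then have "t ^ (W k + wt (i, p) - wt q) * \<bar>coef \<phi> t n s (fst q) (snd q)\<bar> \<le> t * B"
          using t B by (intro mult_mono) auto
        then show "\<bar>sc (i, p) k q * t ^ (W k + wt (i, p) - wt q) * coef \<phi> t n s (fst q) (snd q)\<bar> \<le> \<bar>sc (i, p) k q\<bar> * (t * B)"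
          using t by (simp add: abs_mult mult.assoc mult_left_mono)
      qed
      finally show ?thesis .
    qed
    also have "\<dots> \<le> (\<Sum>q\<in>idx (Suc (deg (i, p))). \<bar>sc (i, p) k q\<bar> * (t * B))"
    proof (rule sum_mono2)
      show "finite (idx (Suc (deg (i, p))))" by (rule finite_idx)
      have "B \<ge> 0" using B[of undefined undefined] by linarith
      then show "0 \<le> \<bar>sc (i, p) k b\<bar> * (t * B)" for b using t by simp
    qed (auto simp: L_def)
    finally show ?thesis using c0 by (simp add: sum_distrib_left mult_ac)
  qed
  have B0: "B \<ge> 0" using B[of undefined undefined] by linarith
  have "\<bar>coef \<phi> t n (Suc s) i p - shift (coef \<phi> t n s i) p\<bar> = \<bar>\<Sum>k\<in>UNIV. T k - coef \<phi> t n s i (p(k := Suc (p k)))\<bar>"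
    by (simp add: c1 shift_def sum_subtractf)
  also have "\<dots> \<le> (\<Sum>k\<in>UNIV. \<bar>T k - coef \<phi> t n s i (p(k := Suc (p k)))\<bar>)" by (rule sum_abs)
  also have "\<dots> \<le> (\<Sum>k\<in>UNIV. t * B * (\<Sum>q\<in>idx (Suc (deg (i, p))). \<bar>sc (i, p) k q\<bar>))"
    by (rule sum_mono) (rule out)
  also have "\<dots> = t * B * (\<Sum>k\<in>UNIV. \<Sum>q\<in>idx (Suc (deg (i, p))). \<bar>sc (i, p) k q\<bar>)"
    by (simp add: sum_distrib_left)
  also have "\<dots> \<le> t * B * sc_bound"
  proof (rule mult_left_mono)
    show "(\<Sum>k\<in>UNIV. \<Sum>q\<in>idx (Suc (deg (i, p))). \<bar>sc (i, p) k q\<bar>) \<le> sc_bound"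
      unfolding sc_bound_def
      using True \<open>n - Suc s \<le> N\<close>
      by (intro member_le_sum[where f = "\<lambda>ip. \<Sum>k\<in>UNIV. \<Sum>q\<in>idx (Suc (deg ip)). \<bar>sc ip k q\<bar>"])
        (auto simp: finite_idx sum_nonneg)
  qed (use t B0 in auto)
  finally show ?thesis by (simp add: mult_ac)
qed

lemma shift_bounded:
  assumes "\<And>p. \<bar>f p\<bar> \<le> b" shows "\<bar>shift f (p :: 'k::finite \<Rightarrow> nat)\<bar> \<le> real CARD('k) * b"
proof -
  have "\<bar>shift f p\<bar> \<le> (\<Sum>k\<in>(UNIV::'k set). \<bar>f (p(k := Suc (p k)))\<bar>)" unfolding shift_def by (rule sum_abs)
  also have "\<dots> \<le> (\<Sum>k\<in>(UNIV::'k set). b)" by (rule sum_mono) (rule assms)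
  finally show ?thesis by simp
qed

text \<open>After \<open>s\<close> multiplications by the linear form, the rescaled values of a functional differ from those of the pure shift by a multiple of \<open>t\<close>, with constants that depend neither on the functional nor on \<open>t\<close>.\<close>

lemma coef_approx:
  "\<exists>C D. \<forall>\<phi> t B. linear \<phi> \<longrightarrow> (\<forall>j\<in>J. \<phi> j = 0) \<longrightarrow> 0 < t \<longrightarrow> t \<le> 1 \<longrightarrow>
     (\<forall>i p. \<bar>coef \<phi> t n 0 i p\<bar> \<le> B) \<longrightarrow>
     (\<forall>i p. \<bar>coef \<phi> t n s i p - (shift ^^ s) (coef \<phi> t n 0 i) p\<bar> \<le> t * (C * B) \<and> \<bar>coef \<phi> t n s i p\<bar> \<le> D * B)"
  if "s \<le> n"
  using that
proof (induction s)
  case 0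
  show ?case by (rule exI[of _ 0], rule exI[of _ 1]) auto
next
  case (Suc s)
  then obtain C D where CD: "\<And>\<phi> t B i p. linear \<phi> \<Longrightarrow> \<forall>j\<in>J. \<phi> j = 0 \<Longrightarrow> 0 < t \<Longrightarrow> t \<le> 1 \<Longrightarrow>
     \<forall>i p. \<bar>coef \<phi> t n 0 i p\<bar> \<le> B \<Longrightarrow>
     \<bar>coef \<phi> t n s i p - (shift ^^ s) (coef \<phi> t n 0 i) p\<bar> \<le> t * (C * B) \<and> \<bar>coef \<phi> t n s i p\<bar> \<le> D * B"
    by (metis Suc_leD)
  define c where "c = real CARD('b)"
  show ?case
  proof (rule exI[of _ "sc_bound * D + c * C"], rule exI[of _ "sc_bound * D + c * D"], intro allI impI)
    fix \<phi> t B i and p :: "'b \<Rightarrow> nat"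
    assume h: "linear \<phi>" "\<forall>j\<in>J. \<phi> j = 0" "0 < t" "t \<le> 1" "\<forall>i p. \<bar>coef \<phi> t n 0 i p\<bar> \<le> B"
    note CD' = CD[OF h]
    have st: "\<bar>coef \<phi> t n (Suc s) i p - shift (coef \<phi> t n s i) p\<bar> \<le> t * sc_bound * (D * B)"
      using h CD' Suc.prems by (intro coef_step) auto
    have "shift (coef \<phi> t n s i) p - (shift ^^ Suc s) (coef \<phi> t n 0 i) p =
        shift (\<lambda>p. coef \<phi> t n s i p - (shift ^^ s) (coef \<phi> t n 0 i) p) p"
      by (simp add: shift_def sum_subtractf)
    then have s1: "\<bar>shift (coef \<phi> t n s i) p - (shift ^^ Suc s) (coef \<phi> t n 0 i) p\<bar> \<le> c * (t * (C * B))"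
      unfolding c_def using CD' by (simp only:) (intro shift_bounded, auto)
    have s2: "\<bar>shift (coef \<phi> t n s i) p\<bar> \<le> c * (D * B)"
      unfolding c_def using CD' by (intro shift_bounded) auto
    have DB: "D * B \<ge> 0" using CD' abs_ge_zero order_trans by meson
    have sb: "sc_bound \<ge> 0" unfolding sc_bound_def by (intro sum_nonneg) auto
    have "t * sc_bound * (D * B) \<le> 1 * sc_bound * (D * B)"
      using h DB sb by (intro mult_right_mono) auto
    then show "\<bar>coef \<phi> t n (Suc s) i p - (shift ^^ Suc s) (coef \<phi> t n 0 i) p\<bar> \<le> t * ((sc_bound * D + c * C) * B) \<and>
      \<bar>coef \<phi> t n (Suc s) i p\<bar> \<le> (sc_bound * D + c * D) * B"
      using st s1 s2 by (simp add: algebra_simps) linarith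
  qed
qed

lemma coef_box_supported:
  assumes "i \<in> K" "deg0 i \<le> j" "2 * j \<le> N"
  shows "box_supported (m i) (N - 2 * deg0 i - (j - deg0 i)) (coef \<phi> t (N - j) 0 i)"
  using assms by (auto simp: box_supported_def coef_def idx_def deg_def split: if_splits)

text \<open>If the image were too small, some functional would vanish on it but not on the target. Its rescaled values would be bounded by \<open>t\<close> times a constant times themselves, by the lower bound for the shift, and hence vanish for small \<open>t\<close>.\<close>

theorem eventually_surjective:
  assumes "2 * j \<le> N"
  shows "\<exists>t0>0. \<forall>t. 0 < t \<longrightarrow> t \<le> t0 \<longrightarrow>
    elt ` idx (N - j) \<subseteq> span ((*) (lin t ^ (N - 2 * j)) ` elt ` idx j \<union> J)"
proof -
  define n where "n = N - 2 * j"
  have nj: "n \<le> N - j" "N - j - n = j" using assms by (auto simp: n_def)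
  obtain C D where CD: "\<And>\<phi> t B i p. linear \<phi> \<Longrightarrow> \<forall>j\<in>J. \<phi> j = 0 \<Longrightarrow> 0 < t \<Longrightarrow> t \<le> 1 \<Longrightarrow>
     \<forall>i p. \<bar>coef \<phi> t (N - j) 0 i p\<bar> \<le> B \<Longrightarrow>
     \<bar>coef \<phi> t (N - j) n i p - (shift ^^ n) (coef \<phi> t (N - j) 0 i) p\<bar> \<le> t * (C * B) \<and>
     \<bar>coef \<phi> t (N - j) n i p\<bar> \<le> D * B"
    using coef_approx[OF nj(1)] by metis
  have "\<exists>E. \<forall>\<phi> b. box_supported (m i) (N - 2 * deg0 i - (j - deg0 i)) \<phi> \<longrightarrow>
      (\<forall>p. \<bar>(shift ^^ n) \<phi> p\<bar> \<le> b) \<longrightarrow> (\<forall>p. \<bar>\<phi> p\<bar> \<le> E * b)" if "i \<in> K" "deg0 i \<le> j" for i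
  proof -
    have "(\<Sum>k\<in>UNIV. m i k) = (N - 2 * deg0 i) + CARD('b)" "2 * (j - deg0 i) \<le> N - 2 * deg0 i"
      "N - 2 * deg0 i - 2 * (j - deg0 i) = n"
      using centre[OF that(1)] that(2) assms by (auto simp: n_def)
    then show ?thesis using shift_pow_bounded_below[of "m i" "N - 2 * deg0 i" "j - deg0 i"] by metis
  qed
  then obtain E where E: "\<And>i \<phi> b p. i \<in> K \<Longrightarrow> deg0 i \<le> j \<Longrightarrow>
      box_supported (m i) (N - 2 * deg0 i - (j - deg0 i)) \<phi> \<Longrightarrow>
      (\<forall>p. \<bar>(shift ^^ n) \<phi> p\<bar> \<le> b) \<Longrightarrow> \<bar>\<phi> p\<bar> \<le> E i * b" by metis
  define E' where "E' = (\<Sum>i\<in>K. \<bar>E i\<bar>)"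
  have E': "E i \<le> E'" if "i \<in> K" for i
    using member_le_sum[OF that, of "\<lambda>i. \<bar>E i\<bar>"] finite_K by (auto simp: E'_def)
  have E'0: "E' \<ge> 0" by (simp add: E'_def sum_nonneg)
  define t0 where "t0 = 1 / (1 + 2 * E' * \<bar>C\<bar>)"
  have t0: "t0 > 0" "t0 \<le> 1" using E'0 by (auto simp: t0_def add_pos_nonneg)
  have "elt ` idx (N - j) \<subseteq> span ((*) (lin t ^ n) ` elt ` idx j \<union> J)" if t: "0 < t" "t \<le> t0" for t
  proof (rule ccontr)
    assume "\<not> elt ` idx (N - j) \<subseteq> span ((*) (lin t ^ n) ` elt ` idx j \<union> J)"
    then obtain q where q: "q \<in> idx (N - j)" "elt q \<notin> span ((*) (lin t ^ n) ` elt ` idx j \<union> J)" by blast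
    obtain \<phi> :: "'a \<Rightarrow> real" where \<phi>: "linear \<phi>" "\<And>u. u \<in> span ((*) (lin t ^ n) ` elt ` idx j \<union> J) \<Longrightarrow> \<phi> u = 0"
        "\<phi> (elt q) \<noteq> 0" using separating_functional[OF subspace_span q(2)] by metis
    have \<phi>J: "\<forall>j\<in>J. \<phi> j = 0" using \<phi>(2) by (auto intro: span_base)
    define B where "B = Max (insert 0 ((\<lambda>(i, p). \<bar>coef \<phi> t (N - j) 0 i p\<bar>) ` idx (N - j)))"
    have B: "\<bar>coef \<phi> t (N - j) 0 i p\<bar> \<le> B" for i p
    proof (cases "(i, p) \<in> idx (N - j)")
      case True
      then show ?thesis unfolding B_def by (intro Max_ge) (auto simp: finite_idx intro!: imageI image_eqI[of _ _ "(i, p)"])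
    next
      case False
      then show ?thesis unfolding B_def by (simp add: coef_def finite_idx)
    qed
    have "coef \<phi> t (N - j) n i p = 0" for i p
    proof (cases "(i, p) \<in> idx j")
      case True
      have "lin t ^ n * t ^ wt (i, p) *\<^sub>R elt (i, p) = t ^ wt (i, p) *\<^sub>R (lin t ^ n * elt (i, p))" by simp
      moreover have "lin t ^ n * elt (i, p) \<in> span ((*) (lin t ^ n) ` elt ` idx j \<union> J)"
        using True by (intro span_base) auto
      ultimately show ?thesis using \<phi>(2) span_scale unfolding coef_def by (metis (no_types))
    next
      case False
      then show ?thesis by (simp only: coef_def nj(2) if_False)
    qed
    then have sh: "\<bar>(shift ^^ n) (coef \<phi> t (N - j) 0 i) p\<bar> \<le> t * (C * B)" for i p
      using CD[OF \<phi>(1) \<phi>J, of t B i p] t t0 B by auto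
    have B0: "B \<ge> 0" using B abs_ge_zero order_trans by blast
    have half: "\<bar>coef \<phi> t (N - j) 0 i p\<bar> \<le> B / 2" for i p
    proof (cases "i \<in> K \<and> deg0 i \<le> j")
      case True
      have "\<bar>coef \<phi> t (N - j) 0 i p\<bar> \<le> E i * (t * (C * B))"
        using sh True coef_box_supported assms by (intro E) auto
      also have "\<dots> \<le> E' * (t * (C * B))"
        using E' True sh[of i p] by (intro mult_right_mono) auto
      also have "\<dots> \<le> E' * (t * (\<bar>C\<bar> * B))"
        using E'0 t B0 by (intro mult_left_mono mult_right_mono) auto
      also have "\<dots> = (t * (E' * \<bar>C\<bar>)) * B" by simp
      also have "\<dots> \<le> (t0 * (E' * \<bar>C\<bar>)) * B" using t E'0 B0 by (intro mult_right_mono) auto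
      also have "t0 * (E' * \<bar>C\<bar>) \<le> 1 / 2"
        using E'0 by (simp add: t0_def field_simps add_pos_nonneg)
      finally show ?thesis using B0 by (simp add: mult_right_mono)
    next
      case False
      have "(i, p) \<notin> idx (N - j)"
      proof
        assume a: "(i, p) \<in> idx (N - j)"
        then have i: "i \<in> K" "\<forall>k. p k < m i k" "deg0 i + sum p UNIV = N - j" by (auto simp: idx_def deg_def)
        have "sum (\<lambda>k. Suc (p k)) UNIV \<le> sum (m i) UNIV" using i(2) by (intro sum_mono) (simp add: Suc_leI)
        then have "sum p UNIV + CARD('b) \<le> sum (m i) UNIV" by (simp add: sum_Suc)
        then show False using centre[OF i(1)] i False assms by auto
      qed
      then show ?thesis using B0 by (simp add: coef_def)
    qed
    have "B \<le> B / 2"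
      unfolding B_def[of] by (subst Max_le_iff) (use half B0 in \<open>auto simp: finite_idx B_def[symmetric]\<close>)
    then have "B = 0" using B0 by simp
    then have "coef \<phi> t (N - j) 0 (fst q) (snd q) = 0" using B[of "fst q" "snd q"] by simp
    then have "\<phi> (t ^ wt q *\<^sub>R elt q) = 0" using q(1) by (simp add: coef_def)
    then show False using \<phi>(1,3) t by (simp add: linear_scale)
  qed
  then show ?thesis using t0 unfolding n_def by blast
qed

text \<open>Only finitely many \<open>j\<close> matter, hence one \<open>t\<close> serves all of them.\<close>

theorem strong_lefschetz_surjective:
  obtains t where "t > 0"
    "\<And>j. 2 * j \<le> N \<Longrightarrow> elt ` idx (N - j) \<subseteq> span ((*) (lin t ^ (N - 2 * j)) ` elt ` idx j \<union> J)"
proof -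
  obtain t0 where t0: "\<And>j. 2 * j \<le> N \<Longrightarrow> t0 j > 0 \<and> (\<forall>t. 0 < t \<longrightarrow> t \<le> t0 j \<longrightarrow>
      elt ` idx (N - j) \<subseteq> span ((*) (lin t ^ (N - 2 * j)) ` elt ` idx j \<union> J))"
    using eventually_surjective by metis
  define t where "t = Min (t0 ` {j. 2 * j \<le> N})"
  have fin: "finite {j. 2 * j \<le> N}" by (rule finite_subset[of _ "{..N}"]) auto
  have "t0 ` {j. 2 * j \<le> N} \<noteq> {}" by (auto intro: exI[of _ 0])
  then have "t > 0" "\<And>j. 2 * j \<le> N \<Longrightarrow> t \<le> t0 j"
    unfolding t_def using t0 fin by auto
  then show ?thesis using that t0 by blast
qed

end


section \<open>Graded real polynomials in four variables\<close>

instantiation poly_mapping :: (comm_monoid_add, "{comm_ring_1,real_algebra_1}") real_algebra_1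
begin

definition scaleR_poly_mapping :: "real \<Rightarrow> ('a \<Rightarrow>\<^sub>0 'b) \<Rightarrow> ('a \<Rightarrow>\<^sub>0 'b)" where
  "scaleR_poly_mapping r p = Poly_Mapping.single 0 (of_real r) * p"

instance
proof
  fix a b :: real and x y :: "'a \<Rightarrow>\<^sub>0 'b"
  show "a *\<^sub>R (x + y) = a *\<^sub>R x + a *\<^sub>R y" by (simp add: scaleR_poly_mapping_def distrib_left)
  show "(a + b) *\<^sub>R x = a *\<^sub>R x + b *\<^sub>R x" by (simp add: scaleR_poly_mapping_def single_add distrib_right)
  show "a *\<^sub>R b *\<^sub>R x = (a * b) *\<^sub>R x" by (simp add: scaleR_poly_mapping_def mult.assoc[symmetric] mult_single)
  show "1 *\<^sub>R x = x" by (simp add: scaleR_poly_mapping_def)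
  show "a *\<^sub>R x * y = a *\<^sub>R (x * y)" by (simp add: scaleR_poly_mapping_def mult.assoc)
  show "x * a *\<^sub>R y = a *\<^sub>R (x * y)" by (simp add: scaleR_poly_mapping_def mult.left_commute)
qed

end

lemma scaleR_mpoly4: "c *\<^sub>R (p :: mpoly4) = Const c * p"
  by (simp add: scaleR_poly_mapping_def Const_def)

lemma of_real_mpoly4: "of_real c = Const c"
  by (simp add: of_real_def scaleR_mpoly4)

lemma lookup_scaleR: "Poly_Mapping.lookup (c *\<^sub>R (p :: mpoly4)) m = c * Poly_Mapping.lookup p m"
proof -
  have "Poly_Mapping.lookup (Poly_Mapping.single 0 c * p) m = c * Poly_Mapping.lookup p m"
    by (simp add: lookup_mult lookup_single when_mult Sum_any_when_equal[of _ "0::4 \<Rightarrow>\<^sub>0 nat"] mult_when)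
  then show ?thesis by (simp add: scaleR_mpoly4 Const_def)
qed

subsection \<open>Homogeneous components\<close>

definition mdeg :: "(4 \<Rightarrow>\<^sub>0 nat) \<Rightarrow> nat" where
  "mdeg m = (\<Sum>i\<in>UNIV. Poly_Mapping.lookup m i)"

lemma mdeg_add: "mdeg (m + n) = mdeg m + mdeg n"
  by (simp add: mdeg_def lookup_add sum.distrib)

lemma mdeg_0 [simp]: "mdeg 0 = 0" by (simp add: mdeg_def)

lemma homogeneous_iff: "homogeneous n p \<longleftrightarrow> (\<forall>m. Poly_Mapping.lookup p m \<noteq> 0 \<longrightarrow> mdeg m = n)"
  by (auto simp: homogeneous_def mdeg_def in_keys_iff)

lemma homogeneous_0 [simp]: "homogeneous n 0" by (simp add: homogeneous_iff)

lemma homogeneous_add: "homogeneous n p \<Longrightarrow> homogeneous n q \<Longrightarrow> homogeneous n (p + q)"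
  unfolding homogeneous_iff by (metis add.right_neutral lookup_add)

lemma homogeneous_scaleR: "homogeneous n p \<Longrightarrow> homogeneous n (c *\<^sub>R p)"
  by (auto simp: homogeneous_iff lookup_scaleR)

lemma homogeneous_sum: "(\<And>i. i \<in> A \<Longrightarrow> homogeneous n (f i)) \<Longrightarrow> homogeneous n (sum f A)"
  by (induction A rule: infinite_finite_induct) (auto intro: homogeneous_add)

lemma homogeneous_uminus: "homogeneous n p \<Longrightarrow> homogeneous n (- p)"
  by (auto simp: homogeneous_iff)

lemma homogeneous_diff: "homogeneous n p \<Longrightarrow> homogeneous n q \<Longrightarrow> homogeneous n (p - q)"
  using homogeneous_add[of n p "- q"] homogeneous_uminus by simp

lemma homogeneous_mult:
  assumes "homogeneous m p" "homogeneous n q" shows "homogeneous (m + n) (p * q)"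
  unfolding homogeneous_def
proof
  fix k assume "k \<in> Poly_Mapping.keys (p * q)"
  then obtain a b where "k = a + b" "a \<in> Poly_Mapping.keys p" "b \<in> Poly_Mapping.keys q"
    using keys_mult[of p q] by blast
  then show "(\<Sum>i\<in>UNIV. Poly_Mapping.lookup k i) = m + n"
    using assms mdeg_add[of a b] by (auto simp: homogeneous_def mdeg_def)
qed

lemma homogeneous_1 [simp]: "homogeneous 0 1"
  by (auto simp: homogeneous_iff lookup_one when_def)

lemma homogeneous_Const [simp]: "homogeneous 0 (Const c)"
  by (auto simp: homogeneous_iff Const_def lookup_single when_def)

lemma homogeneous_pow: "homogeneous d p \<Longrightarrow> homogeneous (d * n) (p ^ n)"
  by (induction n) (auto intro: homogeneous_mult)

lemma mdeg_single: "mdeg (Poly_Mapping.single i n) = n"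
  by (simp add: mdeg_def lookup_single when_def)

lemma homogeneous_Var [simp]: "homogeneous 1 (Var i)"
  by (auto simp: homogeneous_iff Var_def lookup_single when_def mdeg_single)

lemma homogeneous_prod:
  "(\<And>i. i \<in> A \<Longrightarrow> homogeneous (d i) (f i)) \<Longrightarrow> homogeneous (sum d A) (prod f A)"
  by (induction A rule: infinite_finite_induct) (auto intro: homogeneous_mult)

lift_definition hcomp :: "nat \<Rightarrow> mpoly4 \<Rightarrow> mpoly4" is
  "\<lambda>n f m. if mdeg m = n then f m else 0"
  by (rule finite_subset) auto

lemma lookup_hcomp: "Poly_Mapping.lookup (hcomp n f) m = (if mdeg m = n then Poly_Mapping.lookup f m else 0)"
  by transfer simp

lemma homogeneous_hcomp [simp]: "homogeneous n (hcomp n f)"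
  by (auto simp: homogeneous_iff lookup_hcomp)

lemma hcomp_add: "hcomp n (f + g) = hcomp n f + hcomp n g"
  by (rule poly_mapping_eqI) (simp add: lookup_hcomp lookup_add)

lemma hcomp_0 [simp]: "hcomp n 0 = 0"
  by (rule poly_mapping_eqI) (simp add: lookup_hcomp)

lemma hcomp_sum: "hcomp n (sum f A) = (\<Sum>i\<in>A. hcomp n (f i))"
  by (induction A rule: infinite_finite_induct) (auto simp: hcomp_add)

lemma hcomp_homogeneous: "homogeneous d f \<Longrightarrow> hcomp n f = (if n = d then f else 0)"
  by (rule poly_mapping_eqI) (auto simp: lookup_hcomp homogeneous_iff)

definition degrees :: "mpoly4 \<Rightarrow> nat set" where
  "degrees f = mdeg ` Poly_Mapping.keys f"

lemma finite_degrees [simp]: "finite (degrees f)"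
  by (simp add: degrees_def)

lemma hcomp_eq_0: "n \<notin> degrees f \<Longrightarrow> hcomp n f = 0"
  by (rule poly_mapping_eqI) (auto simp: lookup_hcomp degrees_def in_keys_iff)

lemma sum_hcomp:
  assumes "finite A" "degrees f \<subseteq> A" shows "(\<Sum>n\<in>A. hcomp n f) = f"
proof (rule poly_mapping_eqI)
  fix m
  have "Poly_Mapping.lookup (\<Sum>n\<in>A. hcomp n f) m = (\<Sum>n\<in>A. if mdeg m = n then Poly_Mapping.lookup f m else 0)"
    by (simp add: lookup_sum lookup_hcomp)
  also have "\<dots> = Poly_Mapping.lookup f m"
    using assms by (auto simp: degrees_def in_keys_iff image_subset_iff)
  finally show "Poly_Mapping.lookup (\<Sum>n\<in>A. hcomp n f) m = Poly_Mapping.lookup f m" .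
qed

lemma hcomp_mult_homogeneous:
  assumes "homogeneous d g"
  shows "hcomp n (f * g) = (if d \<le> n then hcomp (n - d) f * g else 0)"
proof -
  have "f * g = (\<Sum>i\<in>degrees f. hcomp i f * g)"
    using sum_hcomp[of "degrees f" f] by (simp flip: sum_distrib_right)
  then have "hcomp n (f * g) = (\<Sum>i\<in>degrees f. hcomp n (hcomp i f * g))" by (simp add: hcomp_sum)
  also have "\<dots> = (\<Sum>i\<in>degrees f. if n = i + d then hcomp i f * g else 0)"
    by (intro sum.cong refl hcomp_homogeneous homogeneous_mult assms homogeneous_hcomp)
  also have "\<dots> = (\<Sum>i\<in>degrees f. if i = n - d then (if d \<le> n then hcomp i f * g else 0) else 0)"
    by (intro sum.cong) auto
  also have "\<dots> = (if d \<le> n then hcomp (n - d) f * g else 0)"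
    using hcomp_eq_0[of "n - d" f] by simp
  finally show ?thesis .
qed

subsection \<open>Ideals generated by homogeneous polynomials\<close>

definition gen_ideal :: "('k::finite \<Rightarrow> mpoly4) \<Rightarrow> mpoly4 set" where
  "gen_ideal g = {\<Sum>k\<in>UNIV. q k * g k | q. True}"

lemma gen_ideal_add: "a \<in> gen_ideal g \<Longrightarrow> b \<in> gen_ideal g \<Longrightarrow> a + b \<in> gen_ideal g"
  unfolding gen_ideal_def
  by (auto simp: sum.distrib[symmetric] distrib_right[symmetric])

lemma gen_ideal_mult: "a \<in> gen_ideal g \<Longrightarrow> f * a \<in> gen_ideal g"
  unfolding gen_ideal_def by (auto simp: sum_distrib_left mult.assoc[symmetric])

lemma gen_ideal_0: "0 \<in> gen_ideal g"
  unfolding gen_ideal_def by (auto intro!: exI[of _ "\<lambda>_. 0"])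

lemma gen_ideal_generator: "g k \<in> gen_ideal g"
proof -
  have "(\<Sum>j\<in>UNIV. (if j = k then 1 else 0) * g j) = (\<Sum>j\<in>UNIV. if j = k then g j else 0)"
    by (intro sum.cong) auto
  then have "g k = (\<Sum>j\<in>UNIV. (if j = k then 1 else 0) * g j)" by simp
  then show ?thesis unfolding gen_ideal_def
    by (intro CollectI exI[of _ "\<lambda>j. if j = k then 1 else 0"]) simp
qed

lemma subspace_gen_ideal: "subspace (gen_ideal g)"
  by (auto simp: subspace_def gen_ideal_0 gen_ideal_add gen_ideal_mult scaleR_mpoly4)

lemma gen_ideal_uminus: "a \<in> gen_ideal g \<Longrightarrow> - a \<in> gen_ideal g"
  using gen_ideal_mult[of a g "- 1"] by simp

lemma gen_ideal_diff: "a \<in> gen_ideal g \<Longrightarrow> b \<in> gen_ideal g \<Longrightarrow> a - b \<in> gen_ideal g"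
  using gen_ideal_add[of a g "- b"] gen_ideal_uminus[of b g] by simp

lemma gen_ideal_hcomp_explicit:
  assumes "\<And>k. homogeneous (d k) (g k)" "a = (\<Sum>k\<in>UNIV. q k * g k)"
  shows "hcomp n a = (\<Sum>k\<in>UNIV. (if d k \<le> n then hcomp (n - d k) (q k) else 0) * g k)"
  unfolding assms(2) hcomp_sum
  by (intro sum.cong refl) (simp add: hcomp_mult_homogeneous[OF assms(1)])

lemma gen_ideal_hcomp:
  assumes "\<And>k. homogeneous (d k) (g k)" "a \<in> gen_ideal g"
  shows "hcomp n a \<in> gen_ideal g"
proof -
  obtain q where "a = (\<Sum>k\<in>UNIV. q k * g k)" using assms(2) by (auto simp: gen_ideal_def)
  from gen_ideal_hcomp_explicit[where d = d, OF assms(1) this, of n] show ?thesis unfolding gen_ideal_def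
    by (intro CollectI exI[of _ "\<lambda>k. if d k \<le> n then hcomp (n - d k) (q k) else 0"]) simp
qed

subsection \<open>Monomials\<close>

definition mono4 :: "(4 \<Rightarrow>\<^sub>0 nat) \<Rightarrow> mpoly4" where
  "mono4 m = Poly_Mapping.single m 1"

lemma mpoly4_eq_sum: "p = (\<Sum>m\<in>Poly_Mapping.keys p. Poly_Mapping.lookup p m *\<^sub>R mono4 m)"
proof (rule poly_mapping_eqI)
  fix k
  have "Poly_Mapping.lookup (\<Sum>m\<in>Poly_Mapping.keys p. Poly_Mapping.lookup p m *\<^sub>R mono4 m) k =
     (\<Sum>m\<in>Poly_Mapping.keys p. if m = k then Poly_Mapping.lookup p k else 0)"
    unfolding lookup_sum by (intro sum.cong refl) (simp add: lookup_scaleR mono4_def lookup_single when_def)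
  also have "\<dots> = Poly_Mapping.lookup p k" by (simp add: in_keys_iff)
  finally show "Poly_Mapping.lookup p k =
    Poly_Mapping.lookup (\<Sum>m\<in>Poly_Mapping.keys p. Poly_Mapping.lookup p m *\<^sub>R mono4 m) k" by simp
qed

lemma homogeneous_mono4: "homogeneous (mdeg m) (mono4 m)"
  by (auto simp: homogeneous_iff mono4_def lookup_single when_def)

lemma inj_mono4: "inj mono4"
  unfolding mono4_def by (rule injI) (metis lookup_single_eq lookup_single_not_eq zero_neq_one)

lemma homogeneous_in_span:
  assumes "homogeneous n p" shows "p \<in> span (mono4 ` {m. mdeg m = n})"
proof -
  have "(\<Sum>m\<in>Poly_Mapping.keys p. Poly_Mapping.lookup p m *\<^sub>R mono4 m) \<in> span (mono4 ` {m. mdeg m = n})"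
    using assms by (intro span_sum span_scale span_base) (auto simp: homogeneous_def mdeg_def)
  then show ?thesis by (subst mpoly4_eq_sum)
qed

lemma independent_mono4: "independent (mono4 ` A)"
  unfolding independent_explicit_finite_subsets
proof (intro allI impI ballI)
  fix S u v assume S: "S \<subseteq> mono4 ` A" "finite S" "(\<Sum>v\<in>S. u v *\<^sub>R v) = 0" "v \<in> S"
  then obtain m where m: "v = mono4 m" by blast
  have "Poly_Mapping.lookup (\<Sum>v\<in>S. u v *\<^sub>R v) m = (\<Sum>w\<in>S. if w = v then u v else 0)"
    unfolding lookup_sum
  proof (intro sum.cong refl)
    fix w assume "w \<in> S"
    then obtain k where k: "w = mono4 k" using S(1) by blast
    have "w = v \<longleftrightarrow> k = m" using inj_mono4 by (simp add: k m inj_eq)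
    then show "Poly_Mapping.lookup (u w *\<^sub>R w) m = (if w = v then u v else 0)"
      by (auto simp: lookup_scaleR k m) (auto simp: mono4_def lookup_single when_def)
  qed
  then show "u v = 0" using S by simp
qed

lemma mono4_add: "mono4 (m + n) = mono4 m * mono4 n"
  by (simp add: mono4_def mult_single)

lemma mono4_induct:
  assumes "P 0 1" "\<And>i n p. P n p \<Longrightarrow> P (Suc n) (Var i * p)" shows "P (mdeg m) (mono4 m)"
proof (induction "mdeg m" arbitrary: m)
  case 0
  then have "Poly_Mapping.lookup m i = 0" for i by (simp add: mdeg_def)
  then have "m = 0" by (intro poly_mapping_eqI) simp
  then show ?case using assms(1) by (simp add: mono4_def)
next
  case (Suc n)
  have "\<exists>i. Poly_Mapping.lookup m i \<noteq> 0"
  proof (rule ccontr)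
    assume "\<not> (\<exists>i. Poly_Mapping.lookup m i \<noteq> 0)"
    then have "mdeg m = 0" by (simp add: mdeg_def)
    then show False using Suc.hyps by simp
  qed
  then obtain i where i: "Poly_Mapping.lookup m i \<noteq> 0" by blast
  define m' where "m' = m - Poly_Mapping.single i 1"
  have m: "m = Poly_Mapping.single i 1 + m'"
    using i by (intro poly_mapping_eqI) (auto simp: m'_def lookup_add lookup_minus lookup_single when_def)
  have "mdeg m = Suc (mdeg m')" by (simp add: m mdeg_add mdeg_single)
  moreover have "mono4 m = Var i * mono4 m'" by (simp add: m mono4_add) (simp add: mono4_def Var_def)
  moreover have "P (mdeg m') (mono4 m')"
  proof (rule Suc.hyps(1))
    show "n = mdeg m'" using Suc.hyps(2) \<open>mdeg m = Suc (mdeg m')\<close> by simp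
  qed
  ultimately show ?case using assms(2) by simp
qed

lemma finite_mdeg: "finite {m. mdeg m = n}"
proof -
  have "finite (PiE (UNIV :: 4 set) (\<lambda>_. {..n}))" by (intro finite_PiE) auto
  moreover have "Poly_Mapping.lookup ` {m. mdeg m = n} \<subseteq> PiE UNIV (\<lambda>_. {..n})"
  proof -
    have "Poly_Mapping.lookup m i \<le> mdeg m" for m i unfolding mdeg_def by (rule member_le_sum) auto
    then show ?thesis by auto
  qed
  ultimately have "finite (Poly_Mapping.lookup ` {m. mdeg m = n})" by (rule rev_finite_subset)
  then show ?thesis by (rule finite_imageD) (simp add: inj_on_def poly_mapping.lookup_inject)
qed

subsection \<open>Independence modulo the ideal by counting\<close>

locale homogeneous_generators =
  fixes g :: "'k::finite \<Rightarrow> mpoly4" and d :: "'k \<Rightarrow> nat"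
  assumes homogeneous_g: "homogeneous (d k) (g k)" and d_pos: "d k > 0"
begin

definition gprod :: "('k \<Rightarrow> nat) \<Rightarrow> mpoly4" where
  "gprod e = (\<Prod>k\<in>UNIV. g k ^ e k)"

definition gdeg :: "('k \<Rightarrow> nat) \<Rightarrow> nat" where
  "gdeg e = (\<Sum>k\<in>UNIV. d k * e k)"

lemma gprod_upd: "gprod (e(k := Suc (e k))) = g k * gprod e"
proof -
  have "(\<Prod>j\<in>UNIV. g j ^ (e(k := Suc (e k))) j) = g k ^ Suc (e k) * (\<Prod>j\<in>UNIV-{k}. g j ^ e j)"
    by (subst prod.remove[of _ k]) (auto intro!: prod.cong)
  moreover have "(\<Prod>j\<in>UNIV. g j ^ e j) = g k ^ e k * (\<Prod>j\<in>UNIV-{k}. g j ^ e j)"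
    by (subst prod.remove[of _ k]) auto
  ultimately show ?thesis by (simp add: gprod_def mult_ac)
qed

lemma gdeg_upd: "gdeg (e(k := Suc (e k))) = d k + gdeg e"
proof -
  have "(\<Sum>j\<in>UNIV. d j * (e(k := Suc (e k))) j) = d k * Suc (e k) + (\<Sum>j\<in>UNIV-{k}. d j * e j)"
    by (subst sum.remove[of _ k]) (auto intro!: sum.cong)
  moreover have "(\<Sum>j\<in>UNIV. d j * e j) = d k * e k + (\<Sum>j\<in>UNIV-{k}. d j * e j)"
    by (subst sum.remove[of _ k]) auto
  ultimately show ?thesis by (simp add: gdeg_def)
qed

lemma finite_gdeg: "finite {e. gdeg e = n}"
proof (rule finite_subset)
  show "{e. gdeg e = n} \<subseteq> PiE UNIV (\<lambda>_. {..n})"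
  proof (auto)
    fix e k
    have "e k \<le> d k * e k" using d_pos[of k] by simp
    also have "\<dots> \<le> gdeg e" unfolding gdeg_def by (rule member_le_sum) auto
    finally show "e k \<le> gdeg e" .
  qed
  show "finite (PiE UNIV (\<lambda>_::'k. {..n}))" by (intro finite_PiE) auto
qed


context
  fixes B :: "'i set" and b :: "'i \<Rightarrow> mpoly4" and deg :: "'i \<Rightarrow> nat"
  assumes finite_B: "finite B" and homogeneous_b: "i \<in> B \<Longrightarrow> homogeneous (deg i) (b i)"
    and spanning: "\<And>n f. homogeneous n f \<Longrightarrow> f \<in> span (b ` {i \<in> B. deg i = n} \<union> gen_ideal g)"
begin

definition gpairs :: "nat \<Rightarrow> ('i \<times> ('k \<Rightarrow> nat)) set" where
  "gpairs n = {(i, e). i \<in> B \<and> deg i + gdeg e = n}"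

definition gelt :: "'i \<times> ('k \<Rightarrow> nat) \<Rightarrow> mpoly4" where
  "gelt = (\<lambda>(i, e). b i * gprod e)"

lemma finite_gpairs: "finite (gpairs n)"
proof (rule finite_subset)
  show "gpairs n \<subseteq> B \<times> (\<Union>k\<le>n. {e. gdeg e = k})" by (auto simp: gpairs_def)
qed (use finite_B finite_gdeg in auto)

lemma hcomp_span_ideal:
  assumes "homogeneous n f" "f \<in> span (b ` {i \<in> B. deg i = n} \<union> gen_ideal g)"
  obtains u v q where "f = u + v" "u \<in> span (b ` {i \<in> B. deg i = n})" "v = (\<Sum>k\<in>UNIV. q k * g k)"
    "\<And>k. (if d k \<le> n then homogeneous (n - d k) (q k) else q k = 0)"
proof -
  obtain u v where uv: "f = u + v" "u \<in> span (b ` {i \<in> B. deg i = n})" "v \<in> gen_ideal g"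
    using assms(2) span_eq_iff[THEN iffD2, OF subspace_gen_ideal[of g]] by (auto simp: span_Un)
  have "homogeneous n u" using uv(2)
  proof (induction rule: span_induct_alt)
    case (step c x y) then show ?case using homogeneous_b by (auto intro!: homogeneous_add homogeneous_scaleR)
  qed simp
  then have hv: "hcomp n v = v" using assms(1) uv(1) hcomp_homogeneous[of n v n] homogeneous_diff[of n f u] by simp
  obtain q where "v = (\<Sum>k\<in>UNIV. q k * g k)" using uv(3) by (auto simp: gen_ideal_def)
  from gen_ideal_hcomp_explicit[where d = d, OF homogeneous_g this, of n] hv
  have "v = (\<Sum>k\<in>UNIV. (if d k \<le> n then hcomp (n - d k) (q k) else 0) * g k)" by simp
  then show ?thesis using that[OF uv(1,2)] by simp
qed

lemma mult_g_gelt: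
  assumes "x \<in> span (gelt ` gpairs n)"
  shows "x * g k \<in> span (gelt ` {(i, e). (i, e) \<in> gpairs (n + d k) \<and> e \<noteq> (\<lambda>_. 0)})"
  using assms
proof (induction rule: span_induct_alt)
  case base then show ?case by (simp add: span_zero)
next
  case (step c x y)
  then obtain i e where ie: "x = gelt (i, e)" "(i, e) \<in> gpairs n" by auto
  have "x * g k = gelt (i, e(k := Suc (e k)))" by (simp add: ie gelt_def gprod_upd mult_ac)
  moreover have "(i, e(k := Suc (e k))) \<in> gpairs (n + d k)" "e(k := Suc (e k)) \<noteq> (\<lambda>_. 0)"
    using ie gdeg_upd[of e k] by (auto simp: gpairs_def fun_eq_iff intro!: exI[of _ k])
  ultimately have "x * g k \<in> span (gelt ` {(i, e). (i, e) \<in> gpairs (n + d k) \<and> e \<noteq> (\<lambda>_. 0)})"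
    by (intro span_base) blast
  then show ?case using step(2) by (simp add: distrib_right span_add span_scale)
qed

text \<open>Homogeneous elements that span modulo the ideal generate the whole ring over the polynomials in the generators of the ideal, by induction on the degree.\<close>

lemma homogeneous_in_span_gelt: "homogeneous n f \<Longrightarrow> f \<in> span (gelt ` gpairs n)"
proof (induction n arbitrary: f rule: less_induct)
  case (less n)
  obtain u v q where
    uv: "f = u + v" "u \<in> span (b ` {i \<in> B. deg i = n})" "v = (\<Sum>k\<in>UNIV. q k * g k)"
    "\<And>k. (if d k \<le> n then homogeneous (n - d k) (q k) else q k = 0)"
    using hcomp_span_ideal[OF less.prems spanning[OF less.prems]] by blast
  have "b ` {i \<in> B. deg i = n} \<subseteq> gelt ` gpairs n"
  proof
    fix y assume "y \<in> b ` {i \<in> B. deg i = n}"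
    then obtain i where "y = b i" "i \<in> B" "deg i = n" by auto
    then have "y = gelt (i, \<lambda>_. 0)" "(i, \<lambda>_. 0) \<in> gpairs n" by (auto simp: gelt_def gprod_def gpairs_def gdeg_def)
    then show "y \<in> gelt ` gpairs n" by blast
  qed
  then have "u \<in> span (gelt ` gpairs n)" using uv(2) span_mono by blast
  moreover have "q k * g k \<in> span (gelt ` gpairs n)" for k
  proof (cases "d k \<le> n")
    case True
    then have "q k \<in> span (gelt ` gpairs (n - d k))" using uv(4)[of k] less.IH d_pos[of k] by auto
    then have "q k * g k \<in> span (gelt ` {(i, e). (i, e) \<in> gpairs (n - d k + d k) \<and> e \<noteq> (\<lambda>_. 0)})"
      by (rule mult_g_gelt)
    then show ?thesis
      by (rule subsetD[OF span_mono[OF image_mono], rotated]) (use True in auto)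
  next
    case False
    then show ?thesis using uv(4)[of k] by (simp add: span_zero)
  qed
  ultimately show ?case unfolding uv(1,3) by (intro span_add span_sum)
qed

text \<open>A relation modulo the ideal would make one of the spanning products superfluous, so that fewer products than monomials would span the homogeneous polynomials of some degree.\<close>

lemma independent_mod_ideal:
  assumes count: "\<And>n. card {(i, e). i \<in> B \<and> deg i + gdeg e = n} = card {m. mdeg m = n}"
    and rel: "(\<Sum>i\<in>{i \<in> B. deg i = n}. c i *\<^sub>R b i) \<in> gen_ideal g" and i0: "i0 \<in> B" "deg i0 = n"
  shows "c i0 = 0"
proof (rule ccontr)
  assume nz: "c i0 \<noteq> 0"
  define y where "y = (\<Sum>i\<in>{i \<in> B. deg i = n}. c i *\<^sub>R b i)"
  define X where "X = gpairs n - {(i0, \<lambda>_. 0)}"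
  have hy: "homogeneous n y" unfolding y_def using homogeneous_b by (intro homogeneous_sum homogeneous_scaleR) auto
  obtain q where "y = (\<Sum>k\<in>UNIV. q k * g k)" using rel by (auto simp: gen_ideal_def y_def)
  from gen_ideal_hcomp_explicit[where d = d, OF homogeneous_g this, of n] hy
  have y: "y = (\<Sum>k\<in>UNIV. (if d k \<le> n then hcomp (n - d k) (q k) else 0) * g k)"
    by (simp add: hcomp_homogeneous)
  have "(if d k \<le> n then hcomp (n - d k) (q k) else 0) * g k \<in> span (gelt ` X)" for k
  proof (cases "d k \<le> n")
    case True
    have "hcomp (n - d k) (q k) * g k \<in> span (gelt ` {(i, e). (i, e) \<in> gpairs (n - d k + d k) \<and> e \<noteq> (\<lambda>_. 0)})"
      by (intro mult_g_gelt homogeneous_in_span_gelt homogeneous_hcomp)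
    then have "hcomp (n - d k) (q k) * g k \<in> span (gelt ` X)"
      by (rule subsetD[OF span_mono[OF image_mono], rotated]) (use True in \<open>auto simp: X_def\<close>)
    then show ?thesis using True by simp
  qed (simp add: span_zero)
  then have yX: "y \<in> span (gelt ` X)" unfolding y by (intro span_sum)
  have fin: "finite {i \<in> B. deg i = n}" using finite_B by simp
  have bX: "b i \<in> span (gelt ` X)" if "i \<in> {i \<in> B. deg i = n} - {i0}" for i
  proof (rule span_base)
    have "b i = gelt (i, \<lambda>_. 0)" "(i, \<lambda>_. 0) \<in> X" using that by (auto simp: gelt_def gprod_def gpairs_def gdeg_def X_def)
    then show "b i \<in> gelt ` X" by blast
  qed
  have "y = c i0 *\<^sub>R b i0 + (\<Sum>i\<in>{i \<in> B. deg i = n} - {i0}. c i *\<^sub>R b i)"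
    unfolding y_def by (rule sum.remove[OF fin]) (use i0 in auto)
  then have "c i0 *\<^sub>R b i0 = y - (\<Sum>i\<in>{i \<in> B. deg i = n} - {i0}. c i *\<^sub>R b i)" by simp
  also have "\<dots> \<in> span (gelt ` X)" by (intro span_diff yX span_sum span_scale bX)
  finally have "(1 / c i0) *\<^sub>R (c i0 *\<^sub>R b i0) \<in> span (gelt ` X)" by (rule span_scale)
  then have b0: "b i0 \<in> span (gelt ` X)" using nz by simp
  have "gelt ` gpairs n \<subseteq> span (gelt ` X)"
  proof
    fix z assume "z \<in> gelt ` gpairs n"
    then obtain p where p: "z = gelt p" "p \<in> gpairs n" by blast
    show "z \<in> span (gelt ` X)"
    proof (cases "p = (i0, \<lambda>_. 0)")
      case True then show ?thesis using b0 p by (simp add: gelt_def gprod_def)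
    next
      case False then show ?thesis using p by (intro span_base) (auto simp: X_def)
    qed
  qed
  then have "span (gelt ` gpairs n) \<subseteq> span (gelt ` X)" by (simp add: span_minimal)
  moreover have "mono4 ` {m. mdeg m = n} \<subseteq> span (gelt ` gpairs n)"
    using homogeneous_in_span_gelt homogeneous_mono4 by auto
  ultimately have sub: "mono4 ` {m. mdeg m = n} \<subseteq> span (gelt ` X)" by blast
  have finX: "finite X" unfolding X_def using finite_gpairs by simp
  have "card {m. mdeg m = n} = card (mono4 ` {m. mdeg m = n})"
    using inj_mono4 by (intro card_image[symmetric]) (auto intro: inj_on_subset)
  also have "\<dots> \<le> card (gelt ` X)" using independent_span_bound[OF _ independent_mono4 sub] finX by simp
  also have "\<dots> \<le> card X" by (rule card_image_le[OF finX])
  also have "\<dots> < card (gpairs n)"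
    unfolding X_def using finite_gpairs i0 by (intro card_Diff1_less) (auto simp: gpairs_def gdeg_def)
  finally show False using count[of n] by (simp add: gpairs_def)
qed

end

end


section \<open>Generating functions of finite fibres\<close>

unbundle fps_syntax

text \<open>Counts the elements of each weight; for infinite fibres the coefficient is meaningless, hence the predicate \<open>finite_fibres\<close>.\<close>

definition gf :: "'x set \<Rightarrow> ('x \<Rightarrow> nat) \<Rightarrow> int fps" where
  "gf S w = Abs_fps (\<lambda>n. int (card {x \<in> S. w x = n}))"

definition finite_fibres :: "'x set \<Rightarrow> ('x \<Rightarrow> nat) \<Rightarrow> bool" where
  "finite_fibres S w \<longleftrightarrow> (\<forall>n. finite {x \<in> S. w x = n})"

lemma gf_nth [simp]: "gf S w $ n = int (card {x \<in> S. w x = n})"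
  by (simp add: gf_def)

lemma
  assumes "bij_betw f S T" "\<And>x. x \<in> S \<Longrightarrow> v (f x) = w x"
  shows gf_bij: "gf T v = gf S w" and finite_fibres_bij: "finite_fibres S w \<Longrightarrow> finite_fibres T v"
proof -
  have b: "bij_betw f {x \<in> S. w x = n} {y \<in> T. v y = n}" for n
  proof -
    have "f ` {x \<in> S. w x = n} = {y \<in> T. v y = n}"
    proof (intro equalityI subsetI)
      fix y assume "y \<in> {y \<in> T. v y = n}"
      then obtain x where "x \<in> S" "y = f x" "v y = n" using assms(1) by (auto simp: bij_betw_def)
      then show "y \<in> f ` {x \<in> S. w x = n}" using assms(2) by auto
    qed (use assms in \<open>auto simp: bij_betw_def\<close>)
    moreover have "inj_on f {x \<in> S. w x = n}" using assms(1) by (auto simp: bij_betw_def intro: inj_on_subset)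
    ultimately show ?thesis by (simp add: bij_betw_def)
  qed
  show "gf T v = gf S w" by (rule fps_ext) (simp add: bij_betw_same_card[OF b])
  show "finite_fibres T v" if "finite_fibres S w"
    using that bij_betw_finite[OF b] by (simp add: finite_fibres_def)
qed

lemma
  assumes "finite_fibres S w" "finite_fibres T v"
  shows gf_Times: "gf (S \<times> T) (\<lambda>(x, y). w x + v y) = gf S w * gf T v"
    and finite_fibres_Times: "finite_fibres (S \<times> T) (\<lambda>(x, y). w x + v y)"
proof -
  have eq: "{z \<in> S \<times> T. (case z of (x, y) \<Rightarrow> w x + v y) = n} =
      (\<Union>k\<in>{0..n}. {x \<in> S. w x = k} \<times> {y \<in> T. v y = n - k})" for n
    by auto
  have fin: "finite ({x \<in> S. w x = k} \<times> {y \<in> T. v y = n - k})" for k n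
    using assms by (auto simp: finite_fibres_def)
  show "finite_fibres (S \<times> T) (\<lambda>(x, y). w x + v y)"
    unfolding finite_fibres_def eq using fin by auto
  show "gf (S \<times> T) (\<lambda>(x, y). w x + v y) = gf S w * gf T v"
  proof (rule fps_ext)
    fix n
    have "card {z \<in> S \<times> T. (case z of (x, y) \<Rightarrow> w x + v y) = n} =
        (\<Sum>k\<in>{0..n}. card ({x \<in> S. w x = k} \<times> {y \<in> T. v y = n - k}))"
      unfolding eq by (rule card_UN_disjoint) (use fin in auto)
    then show "gf (S \<times> T) (\<lambda>(x, y). w x + v y) $ n = (gf S w * gf T v) $ n"
      by (simp add: fps_mult_nth card_cartesian_product)
  qed
qed

lemma gf_shift: "gf S (\<lambda>x. k + w x) = fps_X ^ k * gf S w"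
proof (rule fps_ext)
  fix n
  have "{x \<in> S. k + w x = n} = (if k \<le> n then {x \<in> S. w x = n - k} else {})" by auto
  then show "gf S (\<lambda>x. k + w x) $ n = (fps_X ^ k * gf S w) $ n"
    by (simp add: fps_X_power_mult_nth)
qed

lemma gf_Sigma:
  assumes "finite K" "\<And>i. i \<in> K \<Longrightarrow> finite_fibres (S i) (w i)"
  shows "gf (SIGMA i:K. S i) (\<lambda>(i, x). w i x) = (\<Sum>i\<in>K. gf (S i) (w i))"
proof (rule fps_ext)
  fix n
  have "{z \<in> (SIGMA i:K. S i). (case z of (i, x) \<Rightarrow> w i x) = n} = (SIGMA i:K. {x \<in> S i. w i x = n})" by auto
  then show "gf (SIGMA i:K. S i) (\<lambda>(i, x). w i x) $ n = (\<Sum>i\<in>K. gf (S i) (w i)) $ n"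
    using assms by (simp add: fps_sum_nth card_SigmaI finite_fibres_def)
qed

lemma gf_Pi_aux:
  fixes S :: "'k \<Rightarrow> nat set"
  assumes "finite A" "\<And>k. finite_fibres (S k) (v k)"
  shows "gf {p. (\<forall>k\<in>A. p k \<in> S k) \<and> (\<forall>k. k \<notin> A \<longrightarrow> p k = 0)} (\<lambda>p. \<Sum>k\<in>A. v k (p k)) = (\<Prod>k\<in>A. gf (S k) (v k)) \<and>
    finite_fibres {p. (\<forall>k\<in>A. p k \<in> S k) \<and> (\<forall>k. k \<notin> A \<longrightarrow> p k = 0)} (\<lambda>p. \<Sum>k\<in>A. v k (p k))"
  using assms(1)
proof (induction A)
  case empty
  have "{p :: 'k \<Rightarrow> nat. \<forall>k. p k = 0} = {\<lambda>_. 0}" by auto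
  then have "{x :: 'k \<Rightarrow> nat. (\<forall>k. x k = 0) \<and> n = 0} = (if n = 0 then {\<lambda>_. 0} else {})" for n :: nat by auto
  then show ?case by (auto simp: finite_fibres_def fps_eq_iff)
next
  case (insert a A)
  define P where "P A = {p. (\<forall>k\<in>A. p k \<in> S k) \<and> (\<forall>k. k \<notin> A \<longrightarrow> p k = 0)}" for A
  have b: "bij_betw (\<lambda>(n, p). p(a := n)) (S a \<times> P A) (P (insert a A))"
  proof (rule bij_betwI[where g = "\<lambda>p. (p a, p(a := 0))"])
    show "(\<lambda>(n, p). p(a := n)) \<in> S a \<times> P A \<rightarrow> P (insert a A)" using insert.hyps by (auto simp: P_def)
    show "(\<lambda>p. (p a, p(a := 0))) \<in> P (insert a A) \<rightarrow> S a \<times> P A" using insert.hyps by (auto simp: P_def)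
    show "(\<lambda>p. (p a, p(a := 0))) ((\<lambda>(n, p). p(a := n)) x) = x" if "x \<in> S a \<times> P A" for x
      using that insert.hyps by (auto simp: P_def fun_eq_iff)
    show "(\<lambda>(n, p). p(a := n)) ((\<lambda>p. (p a, p(a := 0))) y) = y" for y by auto
  qed
  have w: "(\<Sum>k\<in>insert a A. v k ((case x of (n, p) \<Rightarrow> p(a := n)) k)) = (case x of (n, p) \<Rightarrow> v a n + (\<Sum>k\<in>A. v k (p k)))" for x
  proof (cases x)
    case (Pair n p)
    have "(\<Sum>k\<in>A. v k ((p(a := n)) k)) = (\<Sum>k\<in>A. v k (p k))" using insert.hyps by (intro sum.cong) auto
    then show ?thesis using insert.hyps Pair by simp
  qed
  have IH: "gf (P A) (\<lambda>p. \<Sum>k\<in>A. v k (p k)) = (\<Prod>k\<in>A. gf (S k) (v k))" "finite_fibres (P A) (\<lambda>p. \<Sum>k\<in>A. v k (p k))"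
    using insert.IH by (auto simp: P_def)
  have "gf (P (insert a A)) (\<lambda>p. \<Sum>k\<in>insert a A. v k (p k)) = gf (S a) (v a) * (\<Prod>k\<in>A. gf (S k) (v k))"
    using gf_bij[OF b, of "\<lambda>p. \<Sum>k\<in>insert a A. v k (p k)", OF w] gf_Times[OF assms(2)[of a] IH(2)] IH(1) by simp
  moreover have "finite_fibres (P (insert a A)) (\<lambda>p. \<Sum>k\<in>insert a A. v k (p k))"
    using finite_fibres_bij[OF b, of "\<lambda>p. \<Sum>k\<in>insert a A. v k (p k)", OF w]
      finite_fibres_Times[OF assms(2)[of a] IH(2)] by simp
  ultimately show ?case using insert.hyps by (simp add: P_def)
qed

lemma
  fixes S :: "'k::finite \<Rightarrow> nat set"
  assumes "\<And>k. finite_fibres (S k) (v k)"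
  shows gf_Pi: "gf {p. \<forall>k. p k \<in> S k} (\<lambda>p. \<Sum>k\<in>UNIV. v k (p k)) = (\<Prod>k\<in>UNIV. gf (S k) (v k))"
    and finite_fibres_Pi: "finite_fibres {p. \<forall>k. p k \<in> S k} (\<lambda>p. \<Sum>k\<in>UNIV. v k (p k))"
  using gf_Pi_aux[of "UNIV :: 'k set" S v] assms by auto

lemma finite_fibres_mult: "d > 0 \<Longrightarrow> finite_fibres S (\<lambda>n. d * n)"
  unfolding finite_fibres_def
proof
  fix n assume "d > 0"
  then have "{x \<in> S. d * x = n} \<subseteq> {..n}" by auto
  then show "finite {x \<in> S. d * x = n}" by (rule finite_subset) simp
qed

lemma finite_fibres_id: "finite_fibres S (\<lambda>n. n)"
  using finite_fibres_mult[of 1 S] by simp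

lemma gf_multiples:
  assumes "d > 0" shows "gf UNIV (\<lambda>n. d * n) * (1 - fps_X ^ d) = 1"
proof (rule fps_ext)
  fix n
  have c: "card {x. d * x = n} = (if d dvd n then 1 else 0)" for n
  proof (cases "d dvd n")
    case True
    then obtain k where "n = d * k" ..
    then have "{x. d * x = n} = {k}" using assms by auto
    then show ?thesis using True by simp
  next
    case False
    then have "{x. d * x = n} = {}" by auto
    then show ?thesis using False by simp
  qed
  have "gf UNIV (\<lambda>n. d * n) * (1 - fps_X ^ d) = gf UNIV (\<lambda>n. d * n) - fps_X ^ d * gf UNIV (\<lambda>n. d * n)"
    by (simp add: algebra_simps)
  then have "(gf UNIV (\<lambda>n. d * n) * (1 - fps_X ^ d)) $ n = int (card {x. d * x = n}) - (if n < d then 0 else int (card {x. d * x = n - d}))"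
    by (simp add: fps_X_power_mult_nth)
  also have "\<dots> = (if n = 0 then 1 else 0)"
    using assms unfolding c by (auto simp: dvd_minus_self dest: dvd_imp_le)
  finally show "(gf UNIV (\<lambda>n. d * n) * (1 - fps_X ^ d)) $ n = 1 $ n" by simp
qed

lemma gf_lessThan: "gf {..<m} (\<lambda>n. n) * (1 - fps_X) = 1 - fps_X ^ m"
proof -
  have "gf {..<m} (\<lambda>n. n) = (\<Sum>k<m. fps_X ^ k)"
  proof (rule fps_ext)
    fix n
    have "{x \<in> {..<m}. x = n} = (if n < m then {n} else {})" by auto
    then show "gf {..<m} (\<lambda>n. n) $ n = (\<Sum>k<m. fps_X ^ k :: int fps) $ n"
      by (simp add: fps_sum_nth fps_X_power_iff)
  qed
  then show ?thesis by (simp add: one_diff_power_eq mult.commute)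
qed


section \<open>From spanning to bijectivity by counting\<close>

lemma finite_fibres_shift: "finite_fibres S w \<Longrightarrow> finite_fibres S (\<lambda>x. k + w x)"
  unfolding finite_fibres_def
proof
  fix n assume "\<forall>n. finite {x \<in> S. w x = n}"
  moreover have "{x \<in> S. k + w x = n} \<subseteq> {x \<in> S. w x = n - k}" by auto
  ultimately show "finite {x \<in> S. k + w x = n}" by (meson finite_subset)
qed

text \<open>The assumption \<open>hilbert\<close> says that the boxes have together the Hilbert series of the quotient by a regular sequence of the degrees \<open>d k\<close>, multiplied by a common denominator.\<close>

locale graded_string_basis =
  straightened_string_basis "gen_ideal g" x W K \<sigma> m deg0 wt0 N + homogeneous_generators g d
  for g :: "'n::finite \<Rightarrow> mpoly4" and d :: "'n \<Rightarrow> nat"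
    and x :: "4 \<Rightarrow> mpoly4" and W :: "4 \<Rightarrow> nat" and K :: "'i set" and \<sigma> :: "'i \<Rightarrow> mpoly4"
    and m :: "'i \<Rightarrow> 4 \<Rightarrow> nat" and deg0 wt0 :: "'i \<Rightarrow> nat" and N :: nat +
  assumes homogeneous_x: "homogeneous 1 (x k)"
    and homogeneous_\<sigma>: "i \<in> K \<Longrightarrow> homogeneous (deg0 i) (\<sigma> i)"
    and spanning: "homogeneous n f \<Longrightarrow> f \<in> span (elt ` idx n \<union> gen_ideal g)"
    and hilbert: "(\<Sum>i\<in>K. fps_X ^ deg0 i * (\<Prod>k\<in>UNIV. 1 - fps_X ^ m i k)) = (\<Prod>k\<in>UNIV. 1 - fps_X ^ d k :: int fps)"
begin

lemma homogeneous_elt: "q \<in> idx n \<Longrightarrow> homogeneous n (elt q)"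
proof -
  assume q: "q \<in> idx n"
  obtain i p where ip: "q = (i, p)" by (cases q)
  have "homogeneous (\<Sum>k\<in>UNIV. 1 * p k) (\<Prod>k\<in>UNIV. x k ^ p k)"
    by (intro homogeneous_prod homogeneous_pow homogeneous_x)
  then have "homogeneous (deg0 i + (\<Sum>k\<in>UNIV. 1 * p k)) (\<sigma> i * (\<Prod>k\<in>UNIV. x k ^ p k))"
    using q ip by (intro homogeneous_mult homogeneous_\<sigma>) (auto simp: idx_def)
  then show ?thesis using q ip by (simp add: elt_def idx_def deg_def)
qed

lemma homogeneous_lin: "homogeneous 1 (lin t)"
  unfolding lin_def by (intro homogeneous_sum homogeneous_scaleR homogeneous_x)

lemma homogeneous_lin_pow: "homogeneous n (lin t ^ n)"
  using homogeneous_pow[OF homogeneous_lin[of t], of n] by simp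

definition box :: "('i \<times> (4 \<Rightarrow> nat)) set" where
  "box = (SIGMA i:K. {p. \<forall>k. p k \<in> {..<m i k}})"

lemma idx_eq: "idx n = {q \<in> box. deg q = n}"
  by (auto simp: idx_def box_def)

lemma finite_box': "finite box"
  unfolding box_def using finite_K finite_box by (intro finite_SigmaI) auto

definition dual :: "'i \<times> (4 \<Rightarrow> nat) \<Rightarrow> 'i \<times> (4 \<Rightarrow> nat)" where
  "dual = (\<lambda>(i, p). (i, \<lambda>k. m i k - Suc (p k)))"

lemma dual_dual: "q \<in> box \<Longrightarrow> dual (dual q) = q"
proof -
  assume "q \<in> box"
  then obtain i p where q: "q = (i, p)" "\<And>k. p k < m i k" by (auto simp: box_def)
  have "m i k - Suc (m i k - Suc (p k)) = p k" for k using q(2)[of k] by simp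
  then show ?thesis by (simp add: q(1) dual_def)
qed

lemma deg_dual:
  assumes "q \<in> box" shows "deg (dual q) + deg q = N"
proof -
  obtain i p where q: "q = (i, p)" "i \<in> K" "\<forall>k. p k < m i k" using assms by (auto simp: box_def)
  have "(\<Sum>k\<in>UNIV. m i k - Suc (p k)) + (\<Sum>k\<in>UNIV. Suc (p k)) = (\<Sum>k\<in>UNIV. m i k)"
    unfolding sum.distrib[symmetric] using q(3) by (intro sum.cong refl le_add_diff_inverse2) (auto simp: Suc_leI)
  then have "(\<Sum>k\<in>UNIV. m i k - Suc (p k)) + (sum p UNIV + CARD(4)) = (\<Sum>k\<in>UNIV. m i k)"
    by (simp add: sum_Suc del: card_num0)
  then show ?thesis using centre[OF q(2)] by (simp add: q(1) dual_def deg_def)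
qed

lemma dual_box: "q \<in> box \<Longrightarrow> dual q \<in> box"
proof -
  assume "q \<in> box"
  then obtain i p where q: "q = (i, p)" "i \<in> K" "\<And>k. p k < m i k" by (auto simp: box_def)
  have "m i k - Suc (p k) < m i k" for k using q(3)[of k] by simp
  then show ?thesis using q(2) by (simp add: q(1) dual_def box_def)
qed

text \<open>A second family, symmetric by construction: the box elements up to the middle degree, and the multiples of those strictly below it that lie in the opposite degrees. It has the same numbers of elements in each degree as the boxes.\<close>

definition sym_box :: "(('i \<times> (4 \<Rightarrow> nat)) \<times> bool) set" where
  "sym_box = {(q, upper). q \<in> box \<and> (if upper then 2 * deg q < N else 2 * deg q \<le> N)}"

definition sym_deg :: "('i \<times> (4 \<Rightarrow> nat)) \<times> bool \<Rightarrow> nat" where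
  "sym_deg = (\<lambda>(q, upper). if upper then N - deg q else deg q)"

definition sym_elt :: "real \<Rightarrow> ('i \<times> (4 \<Rightarrow> nat)) \<times> bool \<Rightarrow> mpoly4" where
  "sym_elt t = (\<lambda>(q, upper). if upper then lin t ^ (N - 2 * deg q) * elt q else elt q)"

lemma bij_sym_box:
  "bij_betw (\<lambda>(q, upper). if upper then dual q else q) sym_box box"
proof (rule bij_betwI[where g = "\<lambda>q. if 2 * deg q \<le> N then (q, False) else (dual q, True)"])
  show "(\<lambda>(q, upper). if upper then dual q else q) \<in> sym_box \<rightarrow> box"
    using dual_box by (auto simp: sym_box_def)
  show "(\<lambda>q. if 2 * deg q \<le> N then (q, False) else (dual q, True)) \<in> box \<rightarrow> sym_box"
  proof
    fix q assume q: "q \<in> box"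
    have "deg (dual q) + deg q = N" using deg_dual[OF q] .
    then show "(if 2 * deg q \<le> N then (q, False) else (dual q, True)) \<in> sym_box"
      using q dual_box[OF q] by (auto simp: sym_box_def)
  qed
  show "(\<lambda>q. if 2 * deg q \<le> N then (q, False) else (dual q, True)) ((\<lambda>(q, upper). if upper then dual q else q) y) = y"
    if "y \<in> sym_box" for y
  proof -
    obtain q u where y: "y = (q, u)" by (cases y)
    with that have y: "y = (q, u)" "q \<in> box" by (simp_all add: sym_box_def)
    have "deg (dual q) + deg q = N" using deg_dual[OF y(2)] .
    then show ?thesis using that y dual_dual[OF y(2)] by (auto simp: sym_box_def)
  qed
  show "(\<lambda>(q, upper). if upper then dual q else q) ((\<lambda>q. if 2 * deg q \<le> N then (q, False) else (dual q, True)) q) = q"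
    if "q \<in> box" for q using dual_dual[OF that] by simp
qed

lemma deg_sym_box: "y \<in> sym_box \<Longrightarrow> deg ((\<lambda>(q, upper). if upper then dual q else q) y) = sym_deg y"
  using deg_dual by (force simp: sym_box_def sym_deg_def)

lemma gf_box: "gf box deg * (1 - fps_X) ^ 4 = (\<Prod>k\<in>UNIV. 1 - fps_X ^ d k)"
proof -
  have fib: "finite_fibres {p. \<forall>k. p k \<in> {..<m i k}} (\<lambda>p :: 4 \<Rightarrow> nat. sum p UNIV)" for i
    using finite_fibres_Pi[of "\<lambda>k. {..<m i k}" "\<lambda>k n. n"] finite_fibres_id by simp
  have "gf box (\<lambda>(i, p). deg0 i + sum p UNIV) = (\<Sum>i\<in>K. gf {p. \<forall>k. p k \<in> {..<m i k}} (\<lambda>p. deg0 i + sum p UNIV))"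
    unfolding box_def by (rule gf_Sigma[OF finite_K finite_fibres_shift[OF fib]])
  also have "\<dots> = (\<Sum>i\<in>K. fps_X ^ deg0 i * (\<Prod>k\<in>UNIV. gf {..<m i k} (\<lambda>n. n)))"
    using gf_Pi[of "\<lambda>k. {..<m _ k}" "\<lambda>k n. n"] finite_fibres_id by (simp add: gf_shift)
  finally have "gf box deg = (\<Sum>i\<in>K. fps_X ^ deg0 i * (\<Prod>k\<in>UNIV. gf {..<m i k} (\<lambda>n. n)))"
    by (simp add: deg_def)
  then have "gf box deg * (1 - fps_X) ^ 4 =
      (\<Sum>i\<in>K. fps_X ^ deg0 i * ((\<Prod>k\<in>UNIV. gf {..<m i k} (\<lambda>n. n)) * (\<Prod>k\<in>(UNIV::4 set). 1 - fps_X)))"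
    by (simp add: sum_distrib_right mult.assoc)
  also have "\<dots> = (\<Sum>i\<in>K. fps_X ^ deg0 i * (\<Prod>k\<in>UNIV. 1 - fps_X ^ m i k))"
    unfolding prod.distrib[symmetric] gf_lessThan ..
  finally show ?thesis using hilbert by simp
qed

text \<open>Both sides have the Hilbert series of the polynomial ring: multiplying that of the boxes by that of the polynomials in the generators cancels the factors \<open>1 - X ^ d k\<close>.\<close>

lemma count_sym:
  "card {(y, e). y \<in> sym_box \<and> sym_deg y + gdeg e = n} = card {\<mu>. mdeg \<mu> = n}"
proof -
  have fb: "finite_fibres box deg" using finite_box' by (simp add: finite_fibres_def)
  have fs: "finite_fibres sym_box sym_deg"
    using bij_betw_finite[OF bij_sym_box] finite_box' by (simp add: finite_fibres_def)
  have gs: "gf box deg = gf sym_box sym_deg" by (rule gf_bij[of _ sym_box box deg sym_deg, OF bij_sym_box deg_sym_box])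
  define G where "G = gf (UNIV :: ('n \<Rightarrow> nat) set) gdeg"
  have fd: "finite_fibres UNIV (\<lambda>n. d k * n)" for k using d_pos by (rule finite_fibres_mult)
  have G: "G = (\<Prod>k\<in>UNIV. gf UNIV (\<lambda>n. d k * n))" and fg: "finite_fibres (UNIV :: ('n \<Rightarrow> nat) set) gdeg"
    using gf_Pi[of "\<lambda>k::'n. UNIV" "\<lambda>k n. d k * n"] finite_fibres_Pi[of "\<lambda>k::'n. UNIV" "\<lambda>k n. d k * n"] fd
    unfolding G_def gdeg_def[abs_def] by auto
  have G1: "G * (\<Prod>k\<in>UNIV. 1 - fps_X ^ d k) = 1"
    unfolding G prod.distrib[symmetric] using gf_multiples[OF d_pos] by simp
  define M where "M = gf UNIV mdeg"
  have b: "bij_betw (\<lambda>p. Poly_Mapping.Abs_poly_mapping p) (UNIV :: (4 \<Rightarrow> nat) set) UNIV"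
    by (rule bij_betwI[where g = Poly_Mapping.lookup]) auto
  have "M = gf {p :: 4 \<Rightarrow> nat. \<forall>k. p k \<in> UNIV} (\<lambda>p. \<Sum>k\<in>UNIV. p k)"
    unfolding M_def using gf_bij[OF b, of mdeg "\<lambda>p. \<Sum>k\<in>UNIV. p k"] by (simp add: mdeg_def)
  also have "\<dots> = (\<Prod>k\<in>(UNIV::4 set). gf UNIV (\<lambda>n. n))"
    by (rule gf_Pi[where v = "\<lambda>k n. n"]) (rule finite_fibres_id)
  finally have M: "M = gf UNIV (\<lambda>n. n) ^ 4" by simp
  have "gf UNIV (\<lambda>n. n) * (1 - fps_X) = 1" using gf_multiples[of 1] by simp
  then have M1: "M * (1 - fps_X) ^ 4 = 1"
    unfolding M power_mult_distrib[symmetric] by simp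
  have T: "gf (sym_box \<times> UNIV) (\<lambda>(y, e). sym_deg y + gdeg e) = gf sym_box sym_deg * G"
    unfolding G_def by (rule gf_Times[OF fs fg])
  also have "\<dots> = gf box deg * G * (M * (1 - fps_X) ^ 4)" by (simp add: M1 gs)
  also have "\<dots> = (gf box deg * (1 - fps_X) ^ 4) * G * M" by (simp add: mult_ac)
  also have "\<dots> = M" unfolding gf_box using G1 by (simp add: mult.commute)
  finally have "gf (sym_box \<times> UNIV) (\<lambda>(y, e). sym_deg y + gdeg e) $ n = M $ n" by simp
  moreover have "{z \<in> sym_box \<times> UNIV. (case z of (y, e) \<Rightarrow> sym_deg y + gdeg e) = n} =
      {(y, e). y \<in> sym_box \<and> sym_deg y + gdeg e = n}" by auto
  ultimately show ?thesis by (simp add: M_def)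
qed

lemma homogeneous_spanE:
  assumes "homogeneous j h"
  obtains c where "h - (\<Sum>q\<in>idx j. c q *\<^sub>R elt q) \<in> gen_ideal g"
  using span_finite_Un_subspace[OF finite_idx J_subspace spanning[OF assms]] by blast

theorem lefschetz:
  obtains l where "homogeneous 1 l"
    "\<And>j f. 2 * j \<le> N \<Longrightarrow> homogeneous (N - j) f \<Longrightarrow> \<exists>h. homogeneous j h \<and> f - l ^ (N - 2 * j) * h \<in> gen_ideal g"
    "\<And>j h. 2 * j \<le> N \<Longrightarrow> homogeneous j h \<Longrightarrow> l ^ (N - 2 * j) * h \<in> gen_ideal g \<Longrightarrow> h \<in> gen_ideal g"
    "\<And>n f. N < n \<Longrightarrow> homogeneous n f \<Longrightarrow> f \<in> gen_ideal g"
proof -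
  obtain t where t: "t > 0"
    "\<And>j. 2 * j \<le> N \<Longrightarrow> elt ` idx (N - j) \<subseteq> span ((*) (lin t ^ (N - 2 * j)) ` elt ` idx j \<union> gen_ideal g)"
    using strong_lefschetz_surjective by blast
  have sp: "f \<in> span ((*) (lin t ^ (N - 2 * j)) ` elt ` idx j \<union> gen_ideal g)"
    if "2 * j \<le> N" "homogeneous (N - j) f" for j f
  proof -
    have "elt ` idx (N - j) \<union> gen_ideal g \<subseteq> span ((*) (lin t ^ (N - 2 * j)) ` elt ` idx j \<union> gen_ideal g)"
      using t(2)[OF that(1)] by (auto intro: span_base)
    then have "span (elt ` idx (N - j) \<union> gen_ideal g) \<subseteq> span ((*) (lin t ^ (N - 2 * j)) ` elt ` idx j \<union> gen_ideal g)"
      by (simp add: span_minimal)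
    then show ?thesis using spanning[OF that(2)] by blast
  qed
  show ?thesis
  proof (rule that[of "lin t"])
    show "homogeneous 1 (lin t)" by (rule homogeneous_lin)
  next
    fix j f assume jf: "2 * j \<le> N" "homogeneous (N - j) f"
    have "f \<in> span ((\<lambda>q. lin t ^ (N - 2 * j) * elt q) ` idx j \<union> gen_ideal g)"
      using sp[OF jf] by (simp add: image_image)
    from span_finite_Un_subspace[OF finite_idx J_subspace this] obtain c where
      c: "f - (\<Sum>q\<in>idx j. c q *\<^sub>R (lin t ^ (N - 2 * j) * elt q)) \<in> gen_ideal g" by blast
    have "homogeneous j (\<Sum>q\<in>idx j. c q *\<^sub>R elt q)"
      by (intro homogeneous_sum homogeneous_scaleR homogeneous_elt)
    moreover have "lin t ^ (N - 2 * j) * (\<Sum>q\<in>idx j. c q *\<^sub>R elt q) = (\<Sum>q\<in>idx j. c q *\<^sub>R (lin t ^ (N - 2 * j) * elt q))"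
      by (simp add: sum_distrib_left)
    ultimately show "\<exists>h. homogeneous j h \<and> f - lin t ^ (N - 2 * j) * h \<in> gen_ideal g"
      using c by (intro exI[of _ "\<Sum>q\<in>idx j. c q *\<^sub>R elt q"]) simp
  next
    fix n f assume "N < n" "homogeneous n f"
    moreover have "idx n = {}" using deg_le[of _ n] \<open>N < n\<close> by fastforce
    ultimately show "f \<in> gen_ideal g"
      using spanning[of n f] span_eq_iff[THEN iffD2, OF J_subspace] by simp
  next
    fix j h assume j: "2 * j \<le> N" and h: "homogeneous j h" and lh: "lin t ^ (N - 2 * j) * h \<in> gen_ideal g"
    show "h \<in> gen_ideal g"
    proof (cases "2 * j = N")
      case True then show ?thesis using lh by simp
    next
      case False
      define n where "n = N - j"
      obtain c where c: "h - (\<Sum>q\<in>idx j. c q *\<^sub>R elt q) \<in> gen_ideal g" using homogeneous_spanE[OF h] .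
      have "lin t ^ (N - 2 * j) * h - lin t ^ (N - 2 * j) * (h - (\<Sum>q\<in>idx j. c q *\<^sub>R elt q)) \<in> gen_ideal g"
        by (intro gen_ideal_diff lh gen_ideal_mult c)
      then have r: "(\<Sum>q\<in>idx j. c q *\<^sub>R (lin t ^ (N - 2 * j) * elt q)) \<in> gen_ideal g"
        by (simp add: right_diff_distrib sum_distrib_left)
      have set: "{y \<in> sym_box. sym_deg y = n} = (\<lambda>q. (q, True)) ` idx j"
        using j False by (auto simp: sym_box_def sym_deg_def n_def idx_eq split: if_splits)
      have "(\<Sum>y\<in>{y \<in> sym_box. sym_deg y = n}. (c \<circ> fst) y *\<^sub>R sym_elt t y) =
          (\<Sum>q\<in>idx j. c q *\<^sub>R (lin t ^ (N - 2 * j) * elt q))"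
        unfolding set by (subst sum.reindex) (auto simp: inj_on_def sym_elt_def idx_eq intro!: sum.cong)
      then have r': "(\<Sum>y\<in>{y \<in> sym_box. sym_deg y = n}. (c \<circ> fst) y *\<^sub>R sym_elt t y) \<in> gen_ideal g" using r by simp
      have fin: "finite sym_box" using bij_betw_finite[OF bij_sym_box] finite_box' by simp
      have hom: "homogeneous (sym_deg y) (sym_elt t y)" if "y \<in> sym_box" for y
      proof -
        obtain q u where "y = (q, u)" by (cases y)
        with that have y: "y = (q, u)" "q \<in> idx (deg q)" "2 * deg q \<le> N"
          by (simp_all add: sym_box_def idx_eq split: if_splits)
        have "homogeneous (N - 2 * deg q + deg q) (lin t ^ (N - 2 * deg q) * elt q)"
          by (intro homogeneous_mult homogeneous_lin_pow homogeneous_elt y(2))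
        moreover have "N - 2 * deg q + deg q = N - deg q" using y(3) by simp
        ultimately show ?thesis using homogeneous_elt[OF y(2)] by (simp add: y(1) sym_deg_def sym_elt_def)
      qed
      have span: "f \<in> span (sym_elt t ` {y \<in> sym_box. sym_deg y = k} \<union> gen_ideal g)" if f: "homogeneous k f" for k f
      proof (cases "2 * k \<le> N")
        case True
        have "elt ` idx k \<subseteq> sym_elt t ` {y \<in> sym_box. sym_deg y = k}"
        proof
          fix z assume "z \<in> elt ` idx k"
          then obtain q where q: "z = elt q" "q \<in> idx k" by blast
          then have "z = sym_elt t (q, False)" "(q, False) \<in> {y \<in> sym_box. sym_deg y = k}"
            using True by (auto simp: sym_elt_def sym_box_def sym_deg_def idx_eq)
          then show "z \<in> sym_elt t ` {y \<in> sym_box. sym_deg y = k}" by blast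
        qed
        then have "elt ` idx k \<union> gen_ideal g \<subseteq> sym_elt t ` {y \<in> sym_box. sym_deg y = k} \<union> gen_ideal g" by blast
        from span_mono[OF this] spanning[OF f] show ?thesis by blast
      next
        case False
        show ?thesis
        proof (cases "k \<le> N")
          case True
          define i where "i = N - k"
          have i: "2 * i < N" "k = N - i" using True False by (auto simp: i_def)
          have "(*) (lin t ^ (N - 2 * i)) ` elt ` idx i \<subseteq> sym_elt t ` {y \<in> sym_box. sym_deg y = k}"
          proof
            fix z assume "z \<in> (*) (lin t ^ (N - 2 * i)) ` elt ` idx i"
            then obtain q where q: "z = lin t ^ (N - 2 * i) * elt q" "q \<in> idx i" by blast
            then have "z = sym_elt t (q, True)" "(q, True) \<in> {y \<in> sym_box. sym_deg y = k}"
              using i by (auto simp: sym_elt_def sym_box_def sym_deg_def idx_eq)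
            then show "z \<in> sym_elt t ` {y \<in> sym_box. sym_deg y = k}" by blast
          qed
          then have sub: "(*) (lin t ^ (N - 2 * i)) ` elt ` idx i \<union> gen_ideal g \<subseteq>
            sym_elt t ` {y \<in> sym_box. sym_deg y = k} \<union> gen_ideal g" by blast
          have "f \<in> span ((*) (lin t ^ (N - 2 * i)) ` elt ` idx i \<union> gen_ideal g)"
            using sp[of i f] i f by simp
          then show ?thesis using span_mono[OF sub] by blast
        next
          case False
          then have "idx k = {}" using deg_le[of _ k] by fastforce
          then show ?thesis using spanning[OF f] span_mono[of "gen_ideal g"] by (simp add: subset_iff)
        qed
      qed
      have "(c \<circ> fst) (q, True) = 0" if "q \<in> idx j" for q
        by (rule independent_mod_ideal[OF fin hom span count_sym r']) (use set that in auto)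
      then have "(\<Sum>q\<in>idx j. c q *\<^sub>R elt q) = 0" by (intro sum.neutral) auto
      then show ?thesis using c by simp
    qed
  qed
qed

end


section \<open>The quotient ring\<close>

lemma poly_ring4_simps [simp]:
  "carrier poly_ring4 = UNIV" "monoid.mult poly_ring4 = (*)" "one poly_ring4 = 1"
  "ring.zero poly_ring4 = 0" "ring.add poly_ring4 = (+)"
  by (simp_all add: poly_ring4_def)

lemma cring_poly_ring4: "cring poly_ring4"
proof (rule cringI)
  show "abelian_group poly_ring4"
  proof (rule abelian_groupI)
    show "\<exists>y\<in>carrier poly_ring4. y \<oplus>\<^bsub>poly_ring4\<^esub> x = \<zero>\<^bsub>poly_ring4\<^esub>" for x
      by (auto intro!: exI[of _ "- x"])
  qed (auto simp: add_ac)
  show "comm_monoid poly_ring4" by (rule comm_monoidI) (auto simp: mult_ac)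
qed (auto simp: distrib_right)

interpretation poly_ring4: cring poly_ring4 by (rule cring_poly_ring4)

lemma ideal_gen_ideal: "ideal (gen_ideal g) poly_ring4"
proof (rule idealI)
  show "ring poly_ring4" by (rule poly_ring4.ring_axioms)
  show "subgroup (gen_ideal g) (add_monoid poly_ring4)"
  proof (rule poly_ring4.add.subgroupI)
    show "gen_ideal g \<noteq> {}" using gen_ideal_0 by blast
    show "\<ominus>\<^bsub>poly_ring4\<^esub> a \<in> gen_ideal g" if "a \<in> gen_ideal g" for a
    proof -
      have "\<ominus>\<^bsub>poly_ring4\<^esub> a = - a" by (rule poly_ring4.minus_equality) auto
      then show ?thesis using gen_ideal_uminus[OF that] by simp
    qed
  qed (auto intro: gen_ideal_add)
  show "x \<otimes>\<^bsub>poly_ring4\<^esub> a \<in> gen_ideal g" "a \<otimes>\<^bsub>poly_ring4\<^esub> x \<in> gen_ideal g" if "a \<in> gen_ideal g" for a x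
    using gen_ideal_mult[OF that, of x] by (auto simp: mult.commute)
qed

lemma genideal_range: "Idl\<^bsub>poly_ring4\<^esub> (range g) = gen_ideal g"
proof
  show "Idl\<^bsub>poly_ring4\<^esub> (range g) \<subseteq> gen_ideal g"
    by (rule poly_ring4.genideal_minimal[OF ideal_gen_ideal]) (auto intro: gen_ideal_generator)
  interpret I: ideal "Idl\<^bsub>poly_ring4\<^esub> (range g)" poly_ring4 by (rule poly_ring4.genideal_ideal) simp
  have gI: "g k \<in> Idl\<^bsub>poly_ring4\<^esub> (range g)" for k using poly_ring4.genideal_self[of "range g"] by auto
  show "gen_ideal g \<subseteq> Idl\<^bsub>poly_ring4\<^esub> (range g)"
  proof
    fix a assume "a \<in> gen_ideal g"
    then obtain q where a: "a = (\<Sum>k\<in>UNIV. q k * g k)" by (auto simp: gen_ideal_def)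
    have "(\<Sum>k\<in>A. q k * g k) \<in> Idl\<^bsub>poly_ring4\<^esub> (range g)" if "finite A" for A
      using that
    proof (induction A)
      case empty then show ?case using I.zero_closed by simp
    next
      case (insert k A)
      then show ?case using I.I_l_closed[OF gI[of k], of "q k"] I.a_closed by simp
    qed
    then show "a \<in> Idl\<^bsub>poly_ring4\<^esub> (range g)" unfolding a by simp
  qed
qed

context homogeneous_generators
begin

abbreviation J :: "mpoly4 set" where "J \<equiv> gen_ideal g"
abbreviation Q :: "mpoly4 set ring" where "Q \<equiv> poly_ring4 Quot J"
abbreviation cls :: "mpoly4 \<Rightarrow> mpoly4 set" where "cls f \<equiv> J +>\<^bsub>poly_ring4\<^esub> f"
abbreviation scalars :: "mpoly4 set set" where "scalars \<equiv> {cls (Const c) | c. True}"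
abbreviation grade :: "nat \<Rightarrow> mpoly4 set set" where "grade i \<equiv> {cls f | f. homogeneous i f}"

interpretation J: ideal J poly_ring4 by (rule ideal_gen_ideal)
interpretation Q: cring Q by (rule J.quotient_is_cring[OF cring_poly_ring4])
interpretation cls: ring_hom_cring poly_ring4 Q "(+>\<^bsub>poly_ring4\<^esub>) J"
  by (rule J.rcos_ring_hom_cring[OF cring_poly_ring4])

lemma cls_eq_iff: "cls f = cls h \<longleftrightarrow> f - h \<in> J"
proof -
  have c: "cls f = (\<lambda>j. j + f) ` J" for f by (auto simp: a_r_coset_def')
  show ?thesis
  proof
    assume "cls f = cls h"
    moreover have "f \<in> cls f" unfolding c using gen_ideal_0 by force
    ultimately obtain j where "j \<in> J" "f = j + h" unfolding c by blast
    then show "f - h \<in> J" by simp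
  next
    assume "f - h \<in> J"
    then have s: "h - f \<in> J" using gen_ideal_uminus[of "f - h"] by simp
    show "cls f = cls h" unfolding c
    proof (intro equalityI subsetI)
      fix y assume "y \<in> (\<lambda>j. j + f) ` J"
      then obtain j where "j \<in> J" "y = j + f" by blast
      then have "y = (j + (f - h)) + h" "j + (f - h) \<in> J" using \<open>f - h \<in> J\<close> by (auto intro: gen_ideal_add)
      then show "y \<in> (\<lambda>j. j + h) ` J" by blast
    next
      fix y assume "y \<in> (\<lambda>j. j + h) ` J"
      then obtain j where "j \<in> J" "y = j + h" by blast
      then have "y = (j + (h - f)) + f" "j + (h - f) \<in> J" using s by (auto intro: gen_ideal_add)
      then show "y \<in> (\<lambda>j. j + f) ` J" by blast
    qed
  qed
qed

lemma cls_add: "cls f \<oplus>\<^bsub>Q\<^esub> cls h = cls (f + h)" using cls.hom_add[of f h] by simp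
lemma cls_mult: "cls f \<otimes>\<^bsub>Q\<^esub> cls h = cls (f * h)" using cls.hom_mult[of f h] by simp
lemma cls_0: "\<zero>\<^bsub>Q\<^esub> = cls 0" using cls.hom_zero by simp
lemma cls_1: "\<one>\<^bsub>Q\<^esub> = cls 1" using cls.hom_one by simp
lemma cls_closed: "cls f \<in> carrier Q" using cls.hom_closed by simp
lemma carrier_Q: "carrier Q = range (\<lambda>f. cls f)"
  by (auto simp: FactRing_def A_RCOSETS_def')
lemma cls_uminus: "\<ominus>\<^bsub>Q\<^esub> cls f = cls (- f)"
  by (rule Q.minus_equality) (simp_all add: cls_add cls_0 cls_closed)
lemma cls_pow: "cls f [^]\<^bsub>Q\<^esub> (n :: nat) = cls (f ^ n)"
  by (induction n) (simp_all add: cls_1 cls_mult mult.commute)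
lemma cls_finsum: "finite A \<Longrightarrow> (\<Oplus>\<^bsub>Q\<^esub>i\<in>A. cls (f i)) = cls (\<Sum>i\<in>A. f i)"
  by (induction A rule: finite_induct) (auto simp: cls_0 cls_add cls_closed)

lemma J_no_constants: "Const c \<in> J \<Longrightarrow> c = 0"
proof -
  assume "Const c \<in> J"
  then obtain q where "Const c = (\<Sum>k\<in>UNIV. q k * g k)" by (auto simp: gen_ideal_def)
  from gen_ideal_hcomp_explicit[where d = d, OF homogeneous_g this, of 0]
  have "Const c = (\<Sum>k\<in>UNIV. (if d k \<le> 0 then hcomp (0 - d k) (q k) else 0) * g k)"
    by (simp only: hcomp_homogeneous[OF homogeneous_Const] if_True simp_thms)
  also have "\<dots> = 0"
  proof (rule sum.neutral, rule ballI)
    fix k show "(if d k \<le> 0 then hcomp (0 - d k) (q k) else 0) * g k = 0" using d_pos[of k] by simp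
  qed
  finally have "Poly_Mapping.lookup (Const c) 0 = 0" by simp
  then show "c = 0" by (simp add: Const_def)
qed

lemma Const_arith: "Const a + Const b = Const (a + b)" "Const a * Const b = Const (a * b)"
  "- Const a = Const (- a)" "Const 0 = 0" "Const 1 = 1"
  by (simp_all add: Const_def single_add mult_single single_uminus)

lemma subfield_scalars: "subfield scalars Q"
proof (rule Q.subfieldI)
  show "subcring scalars Q"
  proof (rule Q.subcringI')
    show "subring scalars Q"
    proof (rule Q.subringI)
      show "scalars \<subseteq> carrier Q" using cls_closed by auto
      have "\<one>\<^bsub>Q\<^esub> = cls (Const 1)" by (simp only: cls_1 Const_arith)
      then show "\<one>\<^bsub>Q\<^esub> \<in> scalars" by blast
      fix h1 assume "h1 \<in> scalars"
      then obtain a where a: "h1 = cls (Const a)" by blast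
      have "\<ominus>\<^bsub>Q\<^esub> h1 = cls (Const (- a))" by (simp only: a cls_uminus Const_arith)
      then show "\<ominus>\<^bsub>Q\<^esub> h1 \<in> scalars" by blast
      fix h2 assume "h2 \<in> scalars"
      then obtain b where b: "h2 = cls (Const b)" by blast
      have "h1 \<otimes>\<^bsub>Q\<^esub> h2 = cls (Const (a * b))" by (simp only: a b cls_mult Const_arith)
      then show "h1 \<otimes>\<^bsub>Q\<^esub> h2 \<in> scalars" by blast
      have "h1 \<oplus>\<^bsub>Q\<^esub> h2 = cls (Const (a + b))" by (simp only: a b cls_add Const_arith)
      then show "h1 \<oplus>\<^bsub>Q\<^esub> h2 \<in> scalars" by blast
    qed
  qed
  show "Units (Q\<lparr>carrier := scalars\<rparr>) = scalars - {\<zero>\<^bsub>Q\<^esub>}"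
  proof (intro equalityI subsetI)
    fix x assume "x \<in> Units (Q\<lparr>carrier := scalars\<rparr>)"
    then obtain y where xy: "x \<in> scalars" "y \<in> scalars" "x \<otimes>\<^bsub>Q\<^esub> y = \<one>\<^bsub>Q\<^esub>"
      by (auto simp: Units_def)
    have "x \<noteq> \<zero>\<^bsub>Q\<^esub>"
    proof
      assume "x = \<zero>\<^bsub>Q\<^esub>"
      moreover obtain c where "y = cls (Const c)" using xy(2) by blast
      ultimately have "cls 0 = cls 1" using xy(3) by (simp only: cls_0 cls_1 cls_mult mult_zero_left)
      then have "0 - 1 \<in> J" unfolding cls_eq_iff .
      moreover have "0 - 1 = Const (- 1)" by (simp only: Const_arith(3,5)[symmetric]) simp
      ultimately have "- 1 = (0 :: real)" by (intro J_no_constants) (simp only:)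
      then show False by simp
    qed
    then show "x \<in> scalars - {\<zero>\<^bsub>Q\<^esub>}" using xy by blast
  next
    fix x assume x: "x \<in> scalars - {\<zero>\<^bsub>Q\<^esub>}"
    then obtain c where c: "x = cls (Const c)" by blast
    have "c \<noteq> 0"
    proof
      assume "c = 0"
      then have "x = \<zero>\<^bsub>Q\<^esub>" by (simp only: c cls_0 Const_arith)
      then show False using x by blast
    qed
    then have e: "1 / c * c = 1" "c * (1 / c) = 1" by simp_all
    have "cls (Const (1 / c)) \<otimes>\<^bsub>Q\<^esub> x = \<one>\<^bsub>Q\<^esub>" "x \<otimes>\<^bsub>Q\<^esub> cls (Const (1 / c)) = \<one>\<^bsub>Q\<^esub>"
      by (simp_all only: c cls_mult Const_arith cls_1 e)
    moreover have "cls (Const (1 / c)) \<in> scalars" by blast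
    ultimately show "x \<in> Units (Q\<lparr>carrier := scalars\<rparr>)"
      using x unfolding Units_def by (intro CollectI conjI bexI[of _ "cls (Const (1 / c))"]) simp_all
  qed
qed

lemma subalgebra_grade: "subalgebra scalars (grade i) Q"
proof (rule subalgebra.intro)
  show "subgroup (grade i) (add_monoid Q)"
  proof (rule Q.add.subgroupI)
    show "grade i \<subseteq> carrier Q" using cls_closed by auto
    show "grade i \<noteq> {}" by (auto intro: exI[of _ 0])
    show "\<ominus>\<^bsub>Q\<^esub> a \<in> grade i" if "a \<in> grade i" for a
      using that by (auto simp: cls_uminus intro: homogeneous_uminus)
    show "a \<oplus>\<^bsub>Q\<^esub> b \<in> grade i" if "a \<in> grade i" "b \<in> grade i" for a b
      using that by (auto simp: cls_add intro: homogeneous_add)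
  qed
  show "subalgebra_axioms scalars (grade i) Q"
  proof
    fix k v assume "k \<in> scalars" "v \<in> grade i"
    then obtain c f where "k = cls (Const c)" "v = cls f" "homogeneous i f" by blast
    then show "k \<otimes>\<^bsub>Q\<^esub> v \<in> grade i"
      using homogeneous_mult[OF homogeneous_Const, of i f c] by (auto simp: cls_mult)
  qed
qed

lemma finite_dimension_grade: "Q.finite_dimension scalars (grade i)"
proof -
  obtain ms where ms: "set ms = {m. mdeg m = i}" using finite_list[OF finite_mdeg] by blast
  define Us where "Us = map (\<lambda>m. cls (mono4 m)) ms"
  have Us: "set Us \<subseteq> grade i" using homogeneous_mono4 by (auto simp: Us_def ms)
  have "grade i = Q.Span scalars Us"
  proof (rule Q.Span_subalgebraI[OF subfield_scalars subalgebra_grade Us])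
    fix V assume V: "subalgebra scalars V Q" "set Us \<subseteq> V"
    interpret V: subalgebra scalars V Q by (rule V(1))
    show "grade i \<subseteq> V"
    proof
      fix v assume "v \<in> grade i"
      then obtain f where f: "v = cls f" "homogeneous i f" by blast
      have "cls (\<Sum>m\<in>A. Poly_Mapping.lookup f m *\<^sub>R mono4 m) \<in> V" if "finite A" "A \<subseteq> Poly_Mapping.keys f" for A
        using that
      proof (induction A)
        case empty
        have "\<zero>\<^bsub>Q\<^esub> \<in> V" using V.one_closed by simp
        then show ?case by (simp only: cls_0 sum.empty)
      next
        case (insert m A)
        have "mdeg m = i" using insert.prems f(2) by (auto simp: homogeneous_def mdeg_def)
        then have "cls (mono4 m) \<in> V" using V(2) ms by (auto simp: Us_def)
        then have "cls (Const (Poly_Mapping.lookup f m)) \<otimes>\<^bsub>Q\<^esub> cls (mono4 m) \<in> V" by (intro V.smult_closed) auto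
        then have "cls (Poly_Mapping.lookup f m *\<^sub>R mono4 m) \<in> V" by (simp add: cls_mult scaleR_mpoly4)
        then have "cls (Poly_Mapping.lookup f m *\<^sub>R mono4 m) \<oplus>\<^bsub>Q\<^esub> cls (\<Sum>m\<in>A. Poly_Mapping.lookup f m *\<^sub>R mono4 m) \<in> V"
          using insert by (intro V.m_closed[simplified]) auto
        then show ?case using insert.hyps by (simp add: cls_add)
      qed
      from this[of "Poly_Mapping.keys f"] have "cls (\<Sum>m\<in>Poly_Mapping.keys f. Poly_Mapping.lookup f m *\<^sub>R mono4 m) \<in> V"
        by simp
      then show "v \<in> V" unfolding f(1) by (subst mpoly4_eq_sum)
    qed
  qed
  moreover have "Q.finite_dimension scalars (Q.Span scalars Us)"
    by (rule Q.Span_finite_dimension[OF subfield_scalars]) (use Us cls_closed in auto)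
  ultimately show ?thesis by simp
qed

lemma graded_algebra_quotient: "graded_algebra Q scalars grade"
proof (intro graded_algebra.intro graded_algebra_axioms.intro)
  show "cring Q" by (rule Q.is_cring)
  show "subfield scalars Q" by (rule subfield_scalars)
  show "subalgebra scalars (grade i) Q" for i by (rule subalgebra_grade)
  show "ring.finite_dimension Q scalars (grade i)" for i by (rule finite_dimension_grade)
  show "x \<otimes>\<^bsub>Q\<^esub> y \<in> grade (i + j)" if "x \<in> grade i" "y \<in> grade j" for x y i j
  proof -
    note xy = that
    obtain f where "x = cls f" "homogeneous i f" using xy(1) by blast
    moreover obtain h where "y = cls h" "homogeneous j h" using xy(2) by blast
    ultimately have "x \<otimes>\<^bsub>Q\<^esub> y = cls (f * h)" "homogeneous (i + j) (f * h)"
      by (simp_all only: cls_mult homogeneous_mult)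
    then show ?thesis by blast
  qed
  fix x assume "x \<in> carrier Q"
  then obtain f where f: "x = cls f" by (auto simp: carrier_Q)
  define c where "c i = cls (hcomp i f)" for i
  have sub: "{i. c i \<noteq> \<zero>\<^bsub>Q\<^esub>} \<subseteq> degrees f"
  proof
    fix i assume i: "i \<in> {i. c i \<noteq> \<zero>\<^bsub>Q\<^esub>}"
    show "i \<in> degrees f"
    proof (rule ccontr)
      assume "i \<notin> degrees f"
      then have "c i = \<zero>\<^bsub>Q\<^esub>" by (simp only: c_def cls_0 hcomp_eq_0[OF \<open>i \<notin> degrees f\<close>])
      then show False using i by blast
    qed
  qed
  have sum_mod: "(\<Oplus>\<^bsub>Q\<^esub>i\<in>{i. cls (p i) \<noteq> \<zero>\<^bsub>Q\<^esub>}. cls (p i)) = cls (\<Sum>i\<in>A. p i)"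
    if "finite A" "{i. cls (p i) \<noteq> \<zero>\<^bsub>Q\<^esub>} \<subseteq> A" for A and p :: "nat \<Rightarrow> mpoly4"
  proof -
    have "(\<Oplus>\<^bsub>Q\<^esub>i\<in>{i. cls (p i) \<noteq> \<zero>\<^bsub>Q\<^esub>}. cls (p i)) = (\<Oplus>\<^bsub>Q\<^esub>i\<in>A. cls (p i))"
      using that cls_closed by (intro Q.add.finprod_mono_neutral_cong_left) auto
    then show ?thesis using cls_finsum[OF that(1), of p] by simp
  qed
  show "\<exists>!c. (\<forall>i. c i \<in> grade i) \<and> finite {i. c i \<noteq> \<zero>\<^bsub>Q\<^esub>} \<and> x = (\<Oplus>\<^bsub>Q\<^esub>i\<in>{i. c i \<noteq> \<zero>\<^bsub>Q\<^esub>}. c i)"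
  proof (rule ex1I[of _ c])
    have "x = (\<Oplus>\<^bsub>Q\<^esub>i\<in>{i. c i \<noteq> \<zero>\<^bsub>Q\<^esub>}. c i)"
      unfolding c_def sum_mod[OF finite_degrees sub[unfolded c_def]] sum_hcomp[OF finite_degrees order_refl] f ..
    moreover have "\<forall>i. c i \<in> grade i" unfolding c_def using homogeneous_hcomp by blast
    moreover have "finite {i. c i \<noteq> \<zero>\<^bsub>Q\<^esub>}" using finite_subset[OF sub] by simp
    ultimately show "(\<forall>i. c i \<in> grade i) \<and> finite {i. c i \<noteq> \<zero>\<^bsub>Q\<^esub>} \<and> x = (\<Oplus>\<^bsub>Q\<^esub>i\<in>{i. c i \<noteq> \<zero>\<^bsub>Q\<^esub>}. c i)"
      by blast
  next
    fix c' assume c': "(\<forall>i. c' i \<in> grade i) \<and> finite {i. c' i \<noteq> \<zero>\<^bsub>Q\<^esub>} \<and> x = (\<Oplus>\<^bsub>Q\<^esub>i\<in>{i. c' i \<noteq> \<zero>\<^bsub>Q\<^esub>}. c' i)"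
    then have "\<forall>i. \<exists>p. c' i = cls p \<and> homogeneous i p" by blast
    from choice[OF this] obtain p where "\<forall>i. c' i = cls (p i) \<and> homogeneous i (p i)" ..
    then have p: "\<And>i. c' i = cls (p i)" "\<And>i. homogeneous i (p i)" by blast+
    have c'eq: "c' = (\<lambda>i. cls (p i))" by (rule ext) (rule p(1))
    define A where "A = {i. c' i \<noteq> \<zero>\<^bsub>Q\<^esub>}"
    have fin: "finite A" using c' unfolding A_def by blast
    have A': "{i. cls (p i) \<noteq> \<zero>\<^bsub>Q\<^esub>} = A" by (simp only: A_def p(1))
    have "x = (\<Oplus>\<^bsub>Q\<^esub>i\<in>{i. cls (p i) \<noteq> \<zero>\<^bsub>Q\<^esub>}. cls (p i))" using c' unfolding c'eq by blast
    also have "\<dots> = cls (\<Sum>i\<in>A. p i)" by (rule sum_mod[OF fin]) (simp only: A' order_refl)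
    finally have A: "finite A" "x = cls (\<Sum>i\<in>A. p i)" using fin by blast+
    show "c' = c"
    proof
      fix n
      have "f - (\<Sum>i\<in>A. p i) \<in> J" using A(2) unfolding f cls_eq_iff .
      then have "hcomp n (f - (\<Sum>i\<in>A. p i)) \<in> J" by (rule gen_ideal_hcomp[where d = d, OF homogeneous_g])
      moreover have "hcomp n (f - (\<Sum>i\<in>A. p i)) = hcomp n f - hcomp n (\<Sum>i\<in>A. p i)"
        using hcomp_add[of n "f - (\<Sum>i\<in>A. p i)" "\<Sum>i\<in>A. p i"] by simp
      moreover have "hcomp n (\<Sum>i\<in>A. p i) = (\<Sum>i\<in>A. if i = n then p i else 0)"
        unfolding hcomp_sum by (intro sum.cong refl) (auto simp: hcomp_homogeneous[OF p(2)])
      ultimately have *: "hcomp n f - (if n \<in> A then p n else 0) \<in> J" using A(1) by simp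
      show "c' n = c n"
      proof (cases "n \<in> A")
        case True
        then have "cls (hcomp n f) = cls (p n)" using * unfolding cls_eq_iff by simp
        then show ?thesis by (simp only: c_def p(1))
      next
        case False
        then have "cls (hcomp n f) = cls 0" using * unfolding cls_eq_iff by simp
        then show ?thesis using False unfolding c_def A_def cls_0 by simp
      qed
    qed
  qed
qed

text \<open>Injectivity below and surjectivity above the middle degree follow by composing with a further power of the Lefschetz element, because the maps between opposite degrees are bijective.\<close>

lemma strong_lefschetz_quotient:
  assumes l: "homogeneous 1 l"
    and surj: "\<And>j f. 2 * j \<le> N \<Longrightarrow> homogeneous (N - j) f \<Longrightarrow> \<exists>h. homogeneous j h \<and> f - l ^ (N - 2 * j) * h \<in> J"
    and inj: "\<And>j h. 2 * j \<le> N \<Longrightarrow> homogeneous j h \<Longrightarrow> l ^ (N - 2 * j) * h \<in> J \<Longrightarrow> h \<in> J"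
    and top: "\<And>n f. N < n \<Longrightarrow> homogeneous n f \<Longrightarrow> f \<in> J"
  shows "strong_lefschetz_element Q grade (cls l)"
  unfolding strong_lefschetz_element_def
proof (intro conjI allI impI)
  show "cls l \<in> grade 1" using l by auto
  fix i s :: nat assume "s > 0"
  have hp: "homogeneous n (l ^ n)" for n using homogeneous_pow[OF l, of n] by simp
  show "inj_on (\<lambda>f. cls l [^]\<^bsub>Q\<^esub> s \<otimes>\<^bsub>Q\<^esub> f) (grade i) \<or> (\<lambda>f. cls l [^]\<^bsub>Q\<^esub> s \<otimes>\<^bsub>Q\<^esub> f) ` grade i = grade (i + s)"
  proof (cases "2 * i + s \<le> N")
    case True
    have "f - h \<in> J" if "homogeneous i f" "homogeneous i h" "l ^ s * f - l ^ s * h \<in> J" for f h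
    proof (rule inj[of i])
      show "2 * i \<le> N" using True by simp
      show "homogeneous i (f - h)" using that by (intro homogeneous_diff)
      have e: "N - 2 * i = (N - 2 * i - s) + s" using True by simp
      have "l ^ (N - 2 * i) * (f - h) = l ^ (N - 2 * i - s) * (l ^ s * f - l ^ s * h)"
        by (subst e) (simp only: power_add mult.assoc right_diff_distrib)
      then show "l ^ (N - 2 * i) * (f - h) \<in> J" using gen_ideal_mult[OF that(3)] by simp
    qed
    note mono = this
    have "inj_on (\<lambda>f. cls l [^]\<^bsub>Q\<^esub> s \<otimes>\<^bsub>Q\<^esub> f) (grade i)"
    proof (rule inj_onI)
      fix x y assume "x \<in> grade i" "y \<in> grade i"
        and eq: "cls l [^]\<^bsub>Q\<^esub> s \<otimes>\<^bsub>Q\<^esub> x = cls l [^]\<^bsub>Q\<^esub> s \<otimes>\<^bsub>Q\<^esub> y"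
      then obtain f h where fh: "x = cls f" "homogeneous i f" "y = cls h" "homogeneous i h" by blast
      have "l ^ s * f - l ^ s * h \<in> J" using eq unfolding fh cls_pow cls_mult cls_eq_iff .
      then show "x = y" unfolding fh cls_eq_iff by (rule mono[OF fh(2,4)])
    qed
    then show ?thesis ..
  next
    case False
    have "\<exists>h. homogeneous i h \<and> f - l ^ s * h \<in> J" if f: "homogeneous (i + s) f" for f
    proof (cases "N < i + s")
      case True
      then show ?thesis using top[OF True f] by (intro exI[of _ 0]) simp
    next
      case le: False
      define j where "j = N - (i + s)"
      have j: "2 * j \<le> N" "i + s = N - j" "j \<le> i" "N - 2 * j = s + (i - j)"
        using False le by (auto simp: j_def)
      obtain h where h: "homogeneous j h" "f - l ^ (N - 2 * j) * h \<in> J"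
        using surj[OF j(1)] f j(2) by auto
      have "homogeneous (i - j + j) (l ^ (i - j) * h)" by (intro homogeneous_mult hp h)
      then have "homogeneous i (l ^ (i - j) * h)" using j(3) by simp
      moreover have "f - l ^ s * (l ^ (i - j) * h) \<in> J" using h(2) by (simp add: j(4) power_add mult.assoc)
      ultimately show ?thesis by blast
    qed
    then have surj': "\<exists>h. homogeneous i h \<and> cls f = cls (l ^ s * h)" if "homogeneous (i + s) f" for f
      using that unfolding cls_eq_iff by blast
    have "(\<lambda>f. cls l [^]\<^bsub>Q\<^esub> s \<otimes>\<^bsub>Q\<^esub> f) ` grade i = grade (i + s)"
    proof (intro equalityI subsetI)
      fix y assume "y \<in> (\<lambda>f. cls l [^]\<^bsub>Q\<^esub> s \<otimes>\<^bsub>Q\<^esub> f) ` grade i"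
      then obtain f where f: "homogeneous i f" "y = cls l [^]\<^bsub>Q\<^esub> s \<otimes>\<^bsub>Q\<^esub> cls f" by blast
      have "y = cls (l ^ s * f)" by (simp only: f(2) cls_pow cls_mult)
      moreover have "homogeneous (i + s) (l ^ s * f)"
        using homogeneous_mult[OF hp[of s] f(1)] by (simp only: add.commute)
      ultimately show "y \<in> grade (i + s)" by blast
    next
      fix y assume "y \<in> grade (i + s)"
      then obtain f where f: "y = cls f" "homogeneous (i + s) f" by blast
      obtain h where h: "homogeneous i h" "cls f = cls (l ^ s * h)" using surj'[OF f(2)] by blast
      show "y \<in> (\<lambda>f. cls l [^]\<^bsub>Q\<^esub> s \<otimes>\<^bsub>Q\<^esub> f) ` grade i"
      proof (rule image_eqI[of _ _ "cls h"])
        show "y = cls l [^]\<^bsub>Q\<^esub> s \<otimes>\<^bsub>Q\<^esub> cls h" by (simp only: cls_pow cls_mult f(1) h(2))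
        show "cls h \<in> grade i" using h(1) by blast
      qed
    qed
    then show ?thesis ..
  qed
qed

end


section \<open>Computation with polynomials over the integers with the golden ratio\<close>

text \<open>Polynomials in several variables with coefficients \<open>u + v * \<tau>\<close>, in sparse Horner form: \<open>PX p q\<close> stands for \<open>p + x * q\<close>, where \<open>x\<close> is the first variable and does not occur in \<open>p\<close>. Large identities are decided by rewriting in this representation and are then interpreted in any commutative ring.\<close>

datatype zpol = Cst int int | PX zpol zpol

text \<open>Omits a zero tail, without which sums and products of sparse polynomials would grow quickly.\<close>

fun zPX :: "zpol \<Rightarrow> zpol \<Rightarrow> zpol" where
  "zPX (Cst a b) (Cst c d) = (if c = 0 \<and> d = 0 then Cst a b else PX (Cst a b) (Cst c d))"
| "zPX p q = PX p q"

fun zadd :: "zpol \<Rightarrow> zpol \<Rightarrow> zpol" where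
  "zadd (Cst a b) (Cst c d) = Cst (a + c) (b + d)"
| "zadd (Cst a b) (PX p q) = zPX (zadd (Cst a b) p) q"
| "zadd (PX p q) (Cst a b) = zPX (zadd p (Cst a b)) q"
| "zadd (PX p q) (PX p' q') = zPX (zadd p p') (zadd q q')"

fun zscale :: "int \<Rightarrow> int \<Rightarrow> zpol \<Rightarrow> zpol" where
  "zscale a b (Cst c d) = Cst (a * c + b * d) (a * d + b * c + b * d)"
| "zscale a b (PX p q) = PX (zscale a b p) (zscale a b q)"

function zmul :: "zpol \<Rightarrow> zpol \<Rightarrow> zpol" where
  "zmul (Cst a b) r = (if a = 0 \<and> b = 0 then Cst 0 0 else zscale a b r)"
| "zmul (PX p q) (Cst a b) = (if a = 0 \<and> b = 0 then Cst 0 0 else zscale a b (PX p q))"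
| "zmul (PX p q) (PX p' q') =
    zPX (zmul p p') (zadd (zmul (PX p (Cst 0 0)) q') (zmul q (PX p' q')))"
  by pat_completeness auto
termination
  by (relation "measure (\<lambda>(p, q). size p + size q)") auto

fun zpow :: "zpol \<Rightarrow> nat \<Rightarrow> zpol" where
  "zpow p 0 = Cst 1 0"
| "zpow p (Suc n) = zmul p (zpow p n)"

fun zzero :: "zpol \<Rightarrow> bool" where
  "zzero (Cst a b) \<longleftrightarrow> a = 0 \<and> b = 0"
| "zzero (PX p q) \<longleftrightarrow> zzero p \<and> zzero q"

text \<open>The interpretation; \<open>T\<close> is the value of \<open>\<tau>\<close>, and missing values of variables count as zero.\<close>

fun zev :: "'a::comm_ring_1 \<Rightarrow> 'a list \<Rightarrow> zpol \<Rightarrow> 'a" where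
  "zev T xs (Cst a b) = of_int a + of_int b * T"
| "zev T [] (PX p q) = zev T [] p"
| "zev T (x # xs) (PX p q) = zev T xs p + x * zev T (x # xs) q"

lemma zev_zPX: "zev T xs (zPX p q) = zev T xs (PX p q)"
  by (cases "(p, q)" rule: zPX.cases; cases xs) auto

lemma zev_zadd: "zev T xs (zadd p q) = zev T xs p + zev T xs q"
proof (induction p q arbitrary: xs rule: zadd.induct)
  case (2 a b p q) then show ?case by (cases xs) (auto simp: zev_zPX algebra_simps)
next
  case (3 p q a b) then show ?case by (cases xs) (auto simp: zev_zPX algebra_simps)
next
  case (4 p q p' q') then show ?case by (cases xs) (auto simp: zev_zPX algebra_simps)
qed (auto simp: algebra_simps)

lemma zev_zscale:
  assumes "T * T = T + 1"
  shows "zev T xs (zscale a b p) = (of_int a + of_int b * T) * zev T xs p"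
proof (induction p arbitrary: xs)
  case (Cst c d)
  have "of_int b * (of_int d * (T * T)) = of_int b * (of_int d * T) + of_int b * of_int d"
    by (simp add: assms algebra_simps)
  then show ?case by (simp add: algebra_simps)
next
  case (PX p q) then show ?case by (cases xs) (auto simp: algebra_simps)
qed

lemma zev_zmul:
  assumes "T * T = T + 1"
  shows "zev T xs (zmul p q) = zev T xs p * zev T xs q"
proof (induction p q arbitrary: xs rule: zmul.induct)
  case (3 p q p' q')
  then show ?case by (cases xs) (auto simp: algebra_simps zev_zadd zev_zPX)
next
  case (2 p q a b)
  have "zev T xs (zmul (PX p q) (Cst a b)) = (of_int a + of_int b * T) * zev T xs (PX p q)"
    using zev_zscale[OF assms, of xs a b "PX p q"] by (simp split: if_splits)
  then show ?case by (simp add: mult.commute)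
qed (auto simp: zev_zscale[OF assms] algebra_simps)

lemma zev_zpow:
  assumes "T * T = T + 1"
  shows "zev T xs (zpow p n) = zev T xs p ^ n"
  by (induction n) (auto simp: zev_zmul[OF assms])

lemma zev_zzero: "zzero p \<Longrightarrow> zev T xs p = 0"
  by (induction T xs p rule: zev.induct) auto


definition zdiff :: "zpol \<Rightarrow> zpol \<Rightarrow> zpol" where
  "zdiff p q = zadd p (zscale (- 1) 0 q)"

definition zeq :: "zpol \<Rightarrow> zpol \<Rightarrow> bool" where
  "zeq p q \<longleftrightarrow> zzero (zdiff p q)"

lemma zev_zeq:
  assumes "T * T = T + 1" "zeq p q" shows "zev T xs p = zev T xs q"
  using zev_zzero[of "zdiff p q" T xs] assms
  by (simp add: zeq_def zdiff_def zev_zadd zev_zscale[OF assms(1)])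

fun zsubst :: "zpol list \<Rightarrow> zpol \<Rightarrow> zpol" where
  "zsubst ps (Cst a b) = Cst a b"
| "zsubst [] (PX q r) = zsubst [] q"
| "zsubst (p # ps) (PX q r) = zadd (zsubst ps q) (zmul p (zsubst (p # ps) r))"

lemma zev_zsubst:
  assumes "T * T = T + 1"
  shows "zev T xs (zsubst ps q) = zev T (map (zev T xs) ps) q"
  by (induction ps q rule: zsubst.induct) (auto simp: zev_zadd zev_zmul[OF assms])

fun zmono :: "int \<Rightarrow> int \<Rightarrow> nat list \<Rightarrow> zpol" where
  "zmono a b [] = Cst a b"
| "zmono a b (e # es) = ((PX (Cst 0 0)) ^^ e) (PX (zmono a b es) (Cst 0 0))"

definition zpoly :: "(int \<times> int \<times> nat list) list \<Rightarrow> zpol" where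
  "zpoly ts = foldr (\<lambda>(a, b, es). zadd (zmono a b es)) ts (Cst 0 0)"

lemma zev_shift: "zev T (x # xs) ((PX (Cst 0 0) ^^ e) p) = x ^ e * zev T (x # xs) p"
  by (induction e) (auto simp: mult.assoc)

lemma zev_zmono:
  "length es = length xs \<Longrightarrow>
    zev T xs (zmono a b es) = (of_int a + of_int b * T) * prod_list (map2 (^) xs es)"
  by (induction xs es rule: list_induct2') (auto simp: zev_shift mult_ac)

lemma zev_zpoly:
  "\<forall>(a, b, es)\<in>set ts. length es = length xs \<Longrightarrow>
    zev T xs (zpoly ts) = (\<Sum>(a, b, es)\<leftarrow>ts. (of_int a + of_int b * T) * prod_list (map2 (^) xs es))"
  by (induction ts) (auto simp: zpoly_def zev_zadd zev_zmono)


section \<open>Two pentagons\<close>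

text \<open>A regular pentagon of linear forms in the variables \<open>[x, y]\<close>, equipped with the quadratic form \<open>quad\<close>, and below (\<open>pent'\<close>) the five roots of the second pentagon. The elementary symmetric functions of \<open>pent\<close> are polynomials in \<open>quad\<close> and \<open>quint\<close>, the basic invariants of \<open>H\<^sub>2\<close>.\<close>

definition pent :: "zpol list" where
  "pent = [zpoly [(2, 0, [0, 1])],
     zpoly [(0, 1, [1, 0]), (-1, 1, [0, 1])], zpoly [(0, -1, [1, 0]), (-1, 1, [0, 1])],
     zpoly [(1, 0, [1, 0]), (0, -1, [0, 1])], zpoly [(-1, 0, [1, 0]), (0, -1, [0, 1])]]"

definition pent' :: "zpol list" where
  "pent' = [zpoly [(2, 0, [1, 0])],
     zpoly [(-1, 1, [1, 0]), (-1, 2, [0, 1])], zpoly [(-1, 1, [1, 0]), (1, -2, [0, 1])],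
     zpoly [(0, 1, [1, 0]), (3, -1, [0, 1])], zpoly [(0, 1, [1, 0]), (-3, 1, [0, 1])]]"

definition quad :: zpol where "quad = zpoly [(0, 1, [2, 0]), (-1, 2, [0, 2])]"

definition quint :: zpol where
  "quint = zadd (zpoly [(32, 0, [0, 5])])
     (zadd (zmul (zpoly [(8, -16, [0, 3])]) quad) (zmul (zpoly [(2, 0, [0, 1])]) (zpow quad 2)))"

text \<open>The five forms are the roots of one quintic whose coefficients are invariants; this gives a linear recurrence for their power sums.\<close>

lemma quintic_pent: "list_all (\<lambda>z. zeq (zpow z 5)
    (zadd (zmul (zscale (-1) 2 quad) (zpow z 3)) (zadd (zscale (-1) 0 (zmul (zpow quad 2) z)) quint))) pent"
  by code_simp

text \<open>For the second pentagon only squares occur, and \<open>\<tau> * z\<^sup>2\<close> has a simpler minimal polynomial than \<open>z\<^sup>2\<close>.\<close>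

definition ysq :: "zpol \<Rightarrow> zpol" where "ysq z = zscale 0 1 (zpow z 2)"

definition omega :: "zpol" where
  "omega = zadd (zscale 4 0 (zpow quad 5)) (zscale 25 (-50) (zpow quint 2))"

lemma quintic_pent': "list_all (\<lambda>z. zeq (zpow (ysq z) 5)
    (zadd (zscale 10 0 (zmul quad (zpow (ysq z) 4))) (zadd (zscale (-35) 0 (zmul (zpow quad 2) (zpow (ysq z) 3)))
    (zadd (zscale 50 0 (zmul (zpow quad 3) (zpow (ysq z) 2))) (zadd (zscale (-25) 0 (zmul (zpow quad 4) (ysq z))) omega))))) pent'"
  by code_simp

definition zsum :: "zpol list \<Rightarrow> zpol" where "zsum ps = foldr zadd ps (Cst 0 0)"

lemma p01: "zeq (zsum pent) (Cst 0 0)" by code_simp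
lemma p02: "zeq (zsum (map (\<lambda>z. zpow z 2) pent)) (zscale (-2) 4 quad)" by code_simp
lemma p03: "zeq (zsum (map (\<lambda>z. zpow z 3) pent)) (Cst 0 0)" by code_simp
lemma p04: "zeq (zsum (map (\<lambda>z. zpow z 4) pent)) (zscale 6 0 (zpow quad 2))" by code_simp
lemma q01: "zeq (zsum (map ysq pent')) (zscale 10 0 quad)" by code_simp
lemma q02: "zeq (zsum (map (\<lambda>z. zpow (ysq z) 2) pent')) (zscale 30 0 (zpow quad 2))" by code_simp
lemma q03: "zeq (zsum (map (\<lambda>z. zpow (ysq z) 3) pent')) (zscale 100 0 (zpow quad 3))" by code_simp
lemma q04: "zeq (zsum (map (\<lambda>z. zpow (ysq z) 4) pent')) (zscale 350 0 (zpow quad 4))" by code_simp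


section \<open>Power sums over the roots\<close>

fun zdot :: "zpol list \<Rightarrow> zpol list \<Rightarrow> zpol" where
  "zdot (p # ps) (q # qs) = zadd (zmul p q) (zdot ps qs)"
| "zdot _ _ = Cst 0 0"

text \<open>The first \<open>n\<close> terms of the linear recurrence with coefficients \<open>cs\<close> and window \<open>ws\<close>.\<close>

fun recseq :: "zpol list \<Rightarrow> nat \<Rightarrow> zpol list \<Rightarrow> zpol list" where
  "recseq cs 0 ws = []"
| "recseq cs (Suc n) ws = hd ws # recseq cs n (tl ws @ [zdot cs ws])"

lemma length_recseq [simp]: "length (recseq cs n ws) = n"
  by (induction cs n ws rule: recseq.induct) auto

lemma zev_zdot:
  assumes "T * T = T + 1"
  shows "zev T xs (zdot ps qs) = (\<Sum>(p, q)\<leftarrow>zip ps qs. zev T xs p * zev T xs q)"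
  by (induction ps qs rule: zdot.induct) (auto simp: zev_zadd zev_zmul[OF assms])

lemma zev_zdot_nth:
  assumes "T * T = T + 1" "length ps = l" "length qs = l"
  shows "zev T xs (zdot ps qs) = (\<Sum>i<l. zev T xs (ps ! i) * zev T xs (qs ! i))"
  using assms by (simp add: zev_zdot sum_list_sum_nth atLeast0LessThan)

lemma zev_recseq:
  assumes T: "T * T = T + 1" and l: "length cs = l" "l > 0"
    and rec: "\<And>m. v (m + l) = (\<Sum>i<l. zev T xs (cs ! i) * v (m + i))"
    and ws: "length ws = l" "\<And>i. i < l \<Longrightarrow> zev T xs (ws ! i) = v (m + i)" and i: "i < n"
  shows "zev T xs (recseq cs n ws ! i) = v (m + i)"
  using ws i
proof (induction n arbitrary: ws m i)
  case (Suc n ws m i)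
  have ne: "ws \<noteq> []" using Suc.prems l by auto
  show ?case
  proof (cases i)
    case 0
    then show ?thesis using Suc.prems(2)[of 0] l ne by (simp add: hd_conv_nth)
  next
    case (Suc j)
    have d: "zev T xs (zdot cs ws) = v (m + l)"
      using Suc.prems(2) by (simp add: zev_zdot_nth[OF T l(1) Suc.prems(1)] rec)
    have "zev T xs (recseq cs n (tl ws @ [zdot cs ws]) ! j) = v (Suc m + j)"
    proof (rule Suc.IH)
      show "length (tl ws @ [zdot cs ws]) = l" using Suc.prems(1) l by simp
      show "j < n" using Suc.prems(3) Suc by simp
      fix k assume k: "k < l"
      show "zev T xs ((tl ws @ [zdot cs ws]) ! k) = v (Suc m + k)"
      proof (cases "Suc k = l")
        case True then show ?thesis using Suc.prems(1) d by (auto simp: nth_append)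
      next
        case False
        then have "k < length (tl ws)" using Suc.prems(1) k by simp
        then have "(tl ws @ [zdot cs ws]) ! k = ws ! Suc k" by (simp add: nth_append nth_tl)
        then show ?thesis using Suc.prems(2)[of "Suc k"] k False by simp
      qed
    qed
    then show ?thesis using Suc by simp
  qed
qed simp

text \<open>Every root satisfies the recurrence, hence so do the sums.\<close>

lemma power_sum_recurrence:
  fixes c :: "nat \<Rightarrow> 'a::comm_ring_1"
  assumes "\<And>z. z \<in> set Z \<Longrightarrow> z ^ l = (\<Sum>i<l. c i * z ^ i)"
  shows "(\<Sum>z\<leftarrow>Z. z ^ (m + l)) = (\<Sum>i<l. c i * (\<Sum>z\<leftarrow>Z. z ^ (m + i)))"
  using assms
proof (induction Z)
  case (Cons z Z)
  have "z ^ (m + l) = (\<Sum>i<l. c i * z ^ (m + i))"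
    using Cons.prems[of z] by (simp add: power_add sum_distrib_left mult_ac)
  then show ?case using Cons by (simp add: distrib_left sum.distrib)
qed simp

text \<open>Power sums of the pentagon, as polynomials in \<open>[k, S]\<close>, and of the squares of the second one.\<close>

definition pent_sums :: "nat \<Rightarrow> zpol list" where
  "pent_sums n = recseq [zpoly [(1, 0, [1, 0])], zpoly [(-1, 0, [0, 2])], Cst 0 0, zpoly [(-1, 2, [0, 1])], Cst 0 0] n
     [Cst 5 0, Cst 0 0, zpoly [(-2, 4, [0, 1])], Cst 0 0, zpoly [(6, 0, [0, 2])]]"

definition pent'_sums :: "nat \<Rightarrow> zpol list" where
  "pent'_sums n = recseq [zpoly [(4, 0, [0, 5]), (25, -50, [2, 0])], zpoly [(-25, 0, [0, 4])], zpoly [(50, 0, [0, 3])],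
       zpoly [(-35, 0, [0, 2])], zpoly [(10, 0, [0, 1])]] n
     [Cst 5 0, zpoly [(10, 0, [0, 1])], zpoly [(30, 0, [0, 2])], zpoly [(100, 0, [0, 3])], zpoly [(350, 0, [0, 4])]]"

context
  fixes T :: "'a::comm_ring_1"
  assumes T: "T * T = T + 1"
begin

lemmas zev_simps = zev_zadd zev_zmul[OF T] zev_zpow[OF T] zev_zscale[OF T]

lemma zev_zsum: "zev T xs (zsum ps) = (\<Sum>p\<leftarrow>ps. zev T xs p)"
  by (induction ps) (auto simp: zsum_def zev_zadd)

lemma lessThan_5: "{..<5::nat} = {0, 1, 2, 3, 4}" by auto

lemma pent_sums:
  assumes "i < n"
  shows "(\<Sum>z\<leftarrow>map (zev T [x, y]) pent. z ^ i) = zev T [zev T [x, y] quint, zev T [x, y] quad] (pent_sums n ! i)"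
proof -
  define K where "K = zev T [x, y] quint"
  define S where "S = zev T [x, y] quad"
  define v where "v i = (\<Sum>z\<leftarrow>map (zev T [x, y]) pent. z ^ i)" for i
  define cs where "cs = [zpoly [(1, 0, [1, 0])], zpoly [(-1, 0, [0, 2])], Cst 0 0, zpoly [(-1, 2, [0, 1])], Cst 0 0]"
  define ws where "ws = [Cst 5 0, Cst 0 0, zpoly [(-2, 4, [0, 1])], Cst 0 0, zpoly [(6, 0, [0, 2])]]"
  have q: "z ^ 5 = (\<Sum>i<5. zev T [K, S] (cs ! i) * z ^ i)" if z: "z \<in> set (map (zev T [x, y]) pent)" for z
  proof -
    obtain p where p: "p \<in> set pent" "z = zev T [x, y] p" using z by auto
    then have "zeq (zpow p 5) (zadd (zmul (zscale (-1) 2 quad) (zpow p 3)) (zadd (zscale (-1) 0 (zmul (zpow quad 2) p)) quint))"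
      using quintic_pent by (simp only: list_all_iff)
    from zev_zeq[OF T this, of "[x, y]"]
    have "z ^ 5 = (2 * T - 1) * S * z ^ 3 - S ^ 2 * z + K"
      by (simp add: zev_simps p(2) S_def K_def algebra_simps)
    then show ?thesis by (simp add: lessThan_5 cs_def zev_zpoly algebra_simps)
  qed
  have rec: "v (m + 5) = (\<Sum>i<5. zev T [K, S] (cs ! i) * v (m + i))" for m
    unfolding v_def by (rule power_sum_recurrence[OF q])
  have l4: "i < 5 \<longleftrightarrow> i = 0 \<or> i = 1 \<or> i = 2 \<or> i = 3 \<or> i = 4" for i :: nat by auto
  have p1: "v 1 = 0" using zev_zeq[OF T p01, of "[x, y]"] by (simp add: zev_zsum v_def pent_def zsum_def zev_zadd)
  have p2: "v 2 = (4 * T - 2) * S" using zev_zeq[OF T p02, of "[x, y]"]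
    by (simp add: zev_zsum v_def zev_simps S_def pent_def algebra_simps)
  have p3: "v 3 = 0" using zev_zeq[OF T p03, of "[x, y]"] by (simp add: zev_zsum v_def zev_simps pent_def)
  have p4: "v 4 = 6 * S ^ 2" using zev_zeq[OF T p04, of "[x, y]"] by (simp add: zev_zsum v_def zev_simps pent_def S_def)
  have init: "zev T [K, S] (ws ! i) = v (0 + i)" if "i < 5" for i
    using that p1 p2 p3 p4 unfolding l4
    by (auto simp: ws_def zev_zpoly v_def pent_def algebra_simps)
  have "zev T [K, S] (recseq cs n ws ! i) = v (0 + i)"
    by (rule zev_recseq[OF T _ _ rec _ init assms]) (simp_all add: cs_def ws_def)
  then show ?thesis by (simp add: v_def pent_sums_def cs_def ws_def K_def S_def)
qed

lemma pent'_sums: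
  assumes "i < n"
  shows "T ^ i * (\<Sum>z\<leftarrow>map (zev T [x, y]) pent'. z ^ (2 * i)) = zev T [zev T [x, y] quint, zev T [x, y] quad] (pent'_sums n ! i)"
proof -
  define K where "K = zev T [x, y] quint"
  define S where "S = zev T [x, y] quad"
  define Y where "Y = map (\<lambda>p. zev T [x, y] (ysq p)) pent'"
  define v where "v i = (\<Sum>z\<leftarrow>Y. z ^ i)" for i
  define cs where "cs = [zpoly [(4, 0, [0, 5]), (25, -50, [2, 0])], zpoly [(-25, 0, [0, 4])], zpoly [(50, 0, [0, 3])],
       zpoly [(-35, 0, [0, 2])], zpoly [(10, 0, [0, 1])]]"
  define ws where "ws = [Cst 5 0, zpoly [(10, 0, [0, 1])], zpoly [(30, 0, [0, 2])], zpoly [(100, 0, [0, 3])], zpoly [(350, 0, [0, 4])]]"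
  have q: "z ^ 5 = (\<Sum>i<5. zev T [K, S] (cs ! i) * z ^ i)" if z: "z \<in> set Y" for z
  proof -
    obtain p where p: "p \<in> set pent'" "z = zev T [x, y] (ysq p)" using z by (auto simp: Y_def)
    then have "zeq (zpow (ysq p) 5)
    (zadd (zscale 10 0 (zmul quad (zpow (ysq p) 4))) (zadd (zscale (-35) 0 (zmul (zpow quad 2) (zpow (ysq p) 3)))
    (zadd (zscale 50 0 (zmul (zpow quad 3) (zpow (ysq p) 2))) (zadd (zscale (-25) 0 (zmul (zpow quad 4) (ysq p))) omega))))"
      using quintic_pent' by (simp only: list_all_iff)
    from zev_zeq[OF T this, of "[x, y]"]
    have "z ^ 5 = 10 * S * z ^ 4 - 35 * S ^ 2 * z ^ 3 + 50 * S ^ 3 * z ^ 2 - 25 * S ^ 4 * z + (4 * S ^ 5 + (25 - 50 * T) * K ^ 2)"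
      by (simp add: zev_simps p(2) S_def K_def omega_def algebra_simps)
    then show ?thesis by (simp add: lessThan_5 cs_def zev_zpoly algebra_simps)
  qed
  have rec: "v (m + 5) = (\<Sum>i<5. zev T [K, S] (cs ! i) * v (m + i))" for m
    unfolding v_def by (rule power_sum_recurrence[OF q])
  have l4: "i < 5 \<longleftrightarrow> i = 0 \<or> i = 1 \<or> i = 2 \<or> i = 3 \<or> i = 4" for i :: nat by auto
  have p1: "v 1 = 10 * S" using zev_zeq[OF T q01, of "[x, y]"] by (simp add: zev_zsum v_def Y_def o_def zev_simps S_def)
  have p2: "v 2 = 30 * S ^ 2" using zev_zeq[OF T q02, of "[x, y]"] by (simp add: zev_zsum v_def Y_def o_def zev_simps S_def)
  have p3: "v 3 = 100 * S ^ 3" using zev_zeq[OF T q03, of "[x, y]"] by (simp add: zev_zsum v_def Y_def o_def zev_simps S_def)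
  have p4: "v 4 = 350 * S ^ 4" using zev_zeq[OF T q04, of "[x, y]"] by (simp add: zev_zsum v_def Y_def o_def zev_simps S_def)
  have p0: "v 0 = 5" by (simp add: v_def Y_def pent'_def)
  have init: "zev T [K, S] (ws ! i) = v (0 + i)" if "i < 5" for i
    using that p0 p1 p2 p3 p4 unfolding l4
    by (auto simp: ws_def zev_zpoly)
  have "zev T [K, S] (recseq cs n ws ! i) = v (0 + i)"
    by (rule zev_recseq[OF T _ _ rec _ init assms]) (simp_all add: cs_def ws_def)
  moreover have "v i = T ^ i * (\<Sum>z\<leftarrow>map (zev T [x, y]) pent'. z ^ (2 * i))"
    by (simp add: v_def Y_def o_def ysq_def zev_simps power_mult_distrib power_mult sum_list_const_mult)
  ultimately show ?thesis by (simp add: pent'_sums_def cs_def ws_def K_def S_def)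
qed

end

text \<open>The invariants modulo \<open>I\<^sub>2\<close>, as polynomials in \<open>[g, k, S]\<close>.\<close>

definition pascal_step :: "int list \<Rightarrow> int list" where
  "pascal_step xs = map2 (+) (0 # xs) (xs @ [0])"

fun pascal :: "nat \<Rightarrow> int list" where
  "pascal 0 = [1]"
| "pascal (Suc n) = pascal_step (pascal n)"

lemma length_pascal [simp]: "length (pascal n) = Suc n"
  by (induction n) (auto simp: pascal_step_def)

lemma pascal_nth: "m \<le> n \<Longrightarrow> pascal n ! m = int (n choose m)"
proof (induction n arbitrary: m)
  case (Suc n)
  have "pascal (Suc n) ! m = (0 # pascal n) ! m + (pascal n @ [0]) ! m"
    using Suc.prems by (simp add: pascal_step_def)
  then show ?case
  proof (cases m)
    case (Suc j)
    then have "(0 # pascal n) ! m = int (n choose j)" using Suc.prems Suc.IH[of j] by simp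
    moreover have "(pascal n @ [0]) ! m = int (n choose m)"
      using Suc.prems Suc.IH[of m] by (cases "m = Suc n") (auto simp: nth_append)
    ultimately show ?thesis using \<open>pascal (Suc n) ! m = _\<close> Suc by simp
  qed (use Suc.IH[of 0] in \<open>simp add: pascal_step_def nth_append\<close>)
qed simp

fun zconv :: "int list \<Rightarrow> zpol list \<Rightarrow> zpol list \<Rightarrow> zpol" where
  "zconv (c # cs) (p # ps) (q # qs) = zadd (zscale c 0 (zmul p q)) (zconv cs ps qs)"
| "zconv _ _ _ = Cst 0 0"

fun zgeo :: "zpol \<Rightarrow> zpol \<Rightarrow> zpol list \<Rightarrow> zpol list" where
  "zgeo q r [] = []"
| "zgeo q r (p # ps) = zmul r p # zgeo q (zmul q r) ps"

definition zbinom :: "int list \<Rightarrow> zpol list \<Rightarrow> zpol list \<Rightarrow> zpol" where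
  "zbinom cs V U = zadd (zconv cs V (rev (zgeo (Cst (-1) 1) (Cst 1 0) U)))
     (zconv cs (zgeo (Cst 1 (-1)) (Cst 1 0) V) (rev U))"

text \<open>The power sum of degree \<open>2 * h\<close> as a polynomial in \<open>[g, k, S]\<close>: the products of the two pentagons by the binomial theorem, and the two remaining pentagons by their own recurrence.\<close>

definition inv_pol :: "nat \<Rightarrow> zpol" where
  "inv_pol h = zadd
     (zbinom (pascal (h + h))
       (map (zsubst [zpoly [(1, 0, [0, 1, 0])], zpoly [(1, 0, [0, 0, 1])]]) (pent_sums (Suc (h + h))))
       (map (zsubst [zpoly [(1, 0, [1, 0, 0])], zpoly [(-1, 0, [0, 0, 1])]]) (pent_sums (Suc (h + h)))))
     (zmul (zpow (Cst (-1) 1) h)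
       (zadd (zsubst [zpoly [(1, 0, [0, 1, 0])], zpoly [(1, 0, [0, 0, 1])]] (last (pent'_sums (Suc h))))
         (zsubst [zpoly [(1, 0, [1, 0, 0])], zpoly [(-1, 0, [0, 0, 1])]] (last (pent'_sums (Suc h))))))"

definition S_pol :: zpol where "S_pol = zpoly [(1, 0, [0, 0, 1]), (-1, 2, [0, 2, 0])]"
definition k_pol :: zpol where "k_pol = zadd (zpoly [(32, 0, [0, 5, 0])])
  (zadd (zmul (zpoly [(8, -16, [0, 3, 0])]) S_pol) (zmul (zpoly [(2, 0, [0, 1, 0])]) (zpow S_pol 2)))"
definition phi6_pol :: zpol where "phi6_pol = zscale (-1) 2 (zpoly [(1, 0, [0, 2, 2]), (-3, 6, [0, 4, 1]), (11, 0, [0, 6, 0]), (1, 0, [1, 1, 0])])"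
definition phi10_pol :: zpol where "phi10_pol = zscale (-1) 2 (zpoly [(1, 0, [0, 2, 4]), (-11, 22, [0, 4, 3]), (187, 0, [0, 6, 2]), (-236, 472, [0, 8, 1]), (496, 0, [0, 10, 0]), (-3, 0, [1, 1, 2]), (24, -48, [1, 3, 1]), (-228, 0, [1, 5, 0]), (1, 0, [2, 0, 0])])"
text \<open>The invariants of degrees 12, 20 and 30 as polynomials in \<open>[\<alpha>, \<phi>6, \<phi>10]\<close>, up to a factor.\<close>

definition F12 :: zpol where "F12 = zpoly [(5, 0, [6, 0, 0]), (25, 0, [3, 1, 0]), (1, 0, [1, 0, 1]), (1, 0, [0, 2, 0])]"
definition F20 :: zpol where "F20 = zpoly [(720, 0, [10, 0, 0]), (-3000, 0, [7, 1, 0]), (2040, 0, [5, 0, 1]), (11265, 0, [4, 2, 0]), (-450, 0, [2, 1, 1]), (960, 0, [1, 3, 0]), (1, 0, [0, 0, 2])]"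
definition F30 :: zpol where "F30 = zpoly [(2430000, 0, [12, 1, 0]), (810000, 0, [10, 0, 1]), (3982500, 0, [9, 2, 0]), (-1737000, 0, [7, 1, 1]), (-3363525, 0, [6, 3, 0]), (58500, 0, [5, 0, 2]), (118575, 0, [4, 2, 1]), (1620000, 0, [3, 4, 0]), (5265, 0, [2, 1, 2]), (-10080, 0, [1, 3, 1]), (1728, 0, [0, 5, 0]), (5, 0, [0, 0, 3])]"


section \<open>The three invariants of higher degree\<close>

text \<open>The unit \<open>u + v * \<tau>\<close> and the integer on the right clear the denominators.\<close>

lemma inv_12: "zeq (zscale (5) (8) (zsubst [zpoly [(1, 0, [1, 0, 0])], k_pol, S_pol] (inv_pol 6)))
   (zscale (5040) 0 (zsubst [zpoly [(1, 0, [0, 0, 1])], phi6_pol, phi10_pol] F12))"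
  by code_simp

lemma inv_20: "zeq (zscale (34) (55) (zsubst [zpoly [(1, 0, [1, 0, 0])], k_pol, S_pol] (inv_pol 10)))
   (zscale (3740) 0 (zsubst [zpoly [(1, 0, [0, 0, 1])], phi6_pol, phi10_pol] F20))"
  by code_simp

lemma inv_30: "zeq (zscale (-377) (-610) (zsubst [zpoly [(1, 0, [1, 0, 0])], k_pol, S_pol] (inv_pol 15)))
   (zscale (15015) 0 (zsubst [zpoly [(1, 0, [0, 0, 1])], phi6_pol, phi10_pol] F30))"
  by code_simp


section \<open>Root power sums modulo the quadratic invariant\<close>

lemma sum_list_binomial:
  fixes Z W :: "'a::comm_ring_1 list"
  shows "(\<Sum>z\<leftarrow>Z. \<Sum>w\<leftarrow>W. (p * z + q * w) ^ n) =
    (\<Sum>m\<le>n. of_nat (n choose m) * (p ^ m * q ^ (n - m)) * ((\<Sum>z\<leftarrow>Z. z ^ m) * (\<Sum>w\<leftarrow>W. w ^ (n - m))))"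
proof -
  have W: "(\<Sum>w\<leftarrow>W. (p * z + q * w) ^ n) =
      (\<Sum>m\<le>n. of_nat (n choose m) * (p ^ m * q ^ (n - m)) * (z ^ m * (\<Sum>w\<leftarrow>W. w ^ (n - m))))" for z
  proof (induction W)
    case (Cons w W)
    then show ?case
      by (simp add: binomial_ring power_mult_distrib distrib_left sum.distrib[symmetric] mult_ac)
  qed simp
  show ?thesis
  proof (induction Z)
    case (Cons z Z)
    then show ?case
      by (simp add: W distrib_right distrib_left sum.distrib[symmetric])
  qed simp
qed

lemma zev_zconv:
  assumes "T * T = T + 1" "length cs = l" "length ps = l" "length qs = l"
  shows "zev T xs (zconv cs ps qs) = (\<Sum>i<l. of_int (cs ! i) * (zev T xs (ps ! i) * zev T xs (qs ! i)))"
  using assms(2-)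
proof (induction cs ps qs arbitrary: l rule: zconv.induct)
  case (1 c cs p ps q qs)
  then obtain j where "l = Suc j" by (cases l) auto
  then show ?case
    using 1 by (simp add: zev_zadd zev_zscale[OF assms(1)] zev_zmul[OF assms(1)] sum.lessThan_Suc_shift del: sum.lessThan_Suc)
qed auto

lemma length_zgeo [simp]: "length (zgeo q r ps) = length ps"
  by (induction q r ps rule: zgeo.induct) auto

lemma zev_zgeo:
  assumes "T * T = T + 1" "i < length ps"
  shows "zev T xs (zgeo q r ps ! i) = zev T xs r * zev T xs q ^ i * zev T xs (ps ! i)"
  using assms(2)
proof (induction q r ps arbitrary: i rule: zgeo.induct)
  case (2 q r p ps i)
  then show ?case by (cases i) (auto simp: zev_zmul[OF assms(1)] mult_ac)
qed simp

locale real_ideal =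
  fixes J :: "'a::{comm_ring_1,real_algebra_1} set"
  assumes J_subspace: "subspace J" and J_mult: "j \<in> J \<Longrightarrow> f * j \<in> J"
begin

definition cong :: "'a \<Rightarrow> 'a \<Rightarrow> bool" (infix "\<approx>" 50) where
  "f \<approx> h \<longleftrightarrow> f - h \<in> J"

lemma J_add: "f \<in> J \<Longrightarrow> h \<in> J \<Longrightarrow> f + h \<in> J" by (rule subspace_add[OF J_subspace])
lemma J_0: "0 \<in> J" by (rule subspace_0[OF J_subspace])
lemma cong_refl [simp, intro]: "f \<approx> f" by (simp add: cong_def J_0)
lemma cong_sym: "f \<approx> h \<Longrightarrow> h \<approx> f"
  using subspace_neg[OF J_subspace] unfolding cong_def by (metis minus_diff_eq)
lemma cong_trans [trans]: "f \<approx> h \<Longrightarrow> h \<approx> k \<Longrightarrow> f \<approx> k"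
  using J_add[of "f - h" "h - k"] by (simp add: cong_def)
lemma cong_add: "f \<approx> f' \<Longrightarrow> h \<approx> h' \<Longrightarrow> f + h \<approx> f' + h'"
  using J_add[of "f - f'" "h - h'"] by (simp add: cong_def algebra_simps)
lemma cong_mult:
  assumes "f \<approx> f'" "h \<approx> h'" shows "f * h \<approx> f' * h'"
proof -
  have "f * h - f' * h' = h * (f - f') + f' * (h - h')" by (simp add: algebra_simps)
  then show ?thesis using assms J_mult J_add unfolding cong_def by simp
qed
lemma cong_sum: "(\<And>i. i \<in> A \<Longrightarrow> f i \<approx> h i) \<Longrightarrow> sum f A \<approx> sum h A"
  by (induction A rule: infinite_finite_induct) (auto intro: cong_add)
lemma cong_0: "f \<approx> 0 \<longleftrightarrow> f \<in> J" by (simp add: cong_def)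
lemma cong_J: "f \<approx> h \<Longrightarrow> f \<in> J \<longleftrightarrow> h \<in> J"
  using cong_trans cong_sym cong_0 by metis

lemma zev_cong: "list_all2 (\<approx>) xs ys \<Longrightarrow> zev T xs p \<approx> zev T ys p"
proof (induction T xs p arbitrary: ys rule: zev.induct)
  case (3 T x xs p q)
  then obtain y ys' where "ys = y # ys'" "x \<approx> y" "list_all2 (\<approx>) xs ys'" by (auto simp: list_all2_Cons1)
  then show ?case using 3 by (auto intro!: cong_add cong_mult)
qed auto

lemma J_of_int: "of_int n * f \<in> J \<Longrightarrow> n \<noteq> 0 \<Longrightarrow> f \<in> J"
proof -
  assume a: "of_int n * f \<in> J" "n \<noteq> 0"
  have "(of_int n :: 'a) * f = of_int n *\<^sub>R f" by (metis of_real_of_int_eq scaleR_conv_of_real)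
  then have "(1 / of_int n) *\<^sub>R (of_int n *\<^sub>R f) \<in> J" using subspace_scale[OF J_subspace] a(1) by metis
  then show "f \<in> J" using a(2) by simp
qed

end

text \<open>The planes of \<open>(a, b)\<close> and \<open>(d, c)\<close> carry the quadratic forms \<open>S\<close>, \<open>G\<close> and the quintic forms \<open>k\<close>, \<open>g\<close>; the quadratic invariant of \<open>H\<^sub>4\<close> is a multiple of \<open>S + G\<close>.\<close>

locale h4_forms = real_ideal J for J :: "'a::{comm_ring_1,real_algebra_1} set" +
  fixes T a b c d :: 'a
  assumes T: "T * T = T + 1"
begin

definition S where "S = zev T [a, b] quad"
definition G where "G = zev T [d, c] quad"
definition k where "k = zev T [a, b] quint"
definition g where "g = zev T [d, c] quint"
definition \<alpha> where "\<alpha> = T * a ^ 2"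

text \<open>The 60 roots: 25 for each of the two ways to combine the pentagons, where \<open>s = 1 / \<tau>\<close>, and five in each of the two planes.\<close>

definition inv_sum :: "nat \<Rightarrow> 'a" where
  "inv_sum n = (let Z = map (zev T [a, b]) pent; W = map (zev T [d, c]) pent; s = T - 1 in
    (\<Sum>z\<leftarrow>Z. \<Sum>w\<leftarrow>W. (z + s * w) ^ n) + (\<Sum>z\<leftarrow>Z. \<Sum>w\<leftarrow>W. (w - s * z) ^ n) +
    (\<Sum>z\<leftarrow>map (zev T [a, b]) pent'. z ^ n) + (\<Sum>w\<leftarrow>map (zev T [d, c]) pent'. w ^ n))"

lemma inv_sum_cong:
  assumes SG: "S + G \<in> J"
  shows "inv_sum (2 * h) \<approx> zev T [g, k, S] (inv_pol h)"
proof -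
  define n where "n = 2 * h"
  define s where "s = T - 1"
  have sT: "s * T = 1" using T by (simp add: s_def algebra_simps)
  have GS: "G \<approx> - S" using SG by (simp add: cong_def add.commute)
  define v where "v m = (\<Sum>z\<leftarrow>map (zev T [a, b]) pent. z ^ m)" for m
  define u where "u m = (\<Sum>z\<leftarrow>map (zev T [d, c]) pent. z ^ m)" for m
  define ps where "ps = pent_sums (Suc n)"
  define qs where "qs = pent'_sums (Suc h)"
  define v' where "v' m = zev T [k, S] (ps ! m)" for m
  define u' where "u' m = zev T [g, - S] (ps ! m)" for m
  have vv: "v m = v' m" if "m < Suc n" for m using pent_sums[OF T that] by (simp add: v_def v'_def k_def S_def ps_def)
  have uu: "u m \<approx> u' m" if "m < Suc n" for m
  proof -
    have "u m = zev T [g, G] (ps ! m)" using pent_sums[OF T that] by (simp add: u_def g_def G_def ps_def)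
    then show ?thesis unfolding u'_def using zev_cong[of "[g, G]" "[g, - S]"] GS by simp
  qed
  define C where "C m = of_nat (n choose m) * (s ^ (n - m) + (- s) ^ m)" for m
  have 1: "(\<Sum>z\<leftarrow>map (zev T [a, b]) pent. \<Sum>w\<leftarrow>map (zev T [d, c]) pent. (z + s * w) ^ n) +
     (\<Sum>z\<leftarrow>map (zev T [a, b]) pent. \<Sum>w\<leftarrow>map (zev T [d, c]) pent. (w - s * z) ^ n) = (\<Sum>m\<le>n. C m * (v m * u (n - m)))"
    using sum_list_binomial[of 1 s n "map (zev T [d, c]) pent" "map (zev T [a, b]) pent"]
      sum_list_binomial[of "- s" 1 n "map (zev T [d, c]) pent" "map (zev T [a, b]) pent"]
    by (simp add: v_def u_def C_def sum.distrib[symmetric] algebra_simps)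
  have 2: "(\<Sum>m\<le>n. C m * (v m * u (n - m))) \<approx> (\<Sum>m\<le>n. C m * (v' m * u' (n - m)))"
    using vv uu by (intro cong_sum cong_mult) auto
  have half: "(\<Sum>z\<leftarrow>map (zev T [x, y]) pent'. z ^ n) = s ^ h * zev T [zev T [x, y] quint, zev T [x, y] quad] (qs ! h)" for x y
  proof -
    have "s ^ h * (T ^ h * (\<Sum>z\<leftarrow>map (zev T [x, y]) pent'. z ^ (2 * h))) = (s * T) ^ h * (\<Sum>z\<leftarrow>map (zev T [x, y]) pent'. z ^ (2 * h))"
      by (simp only: power_mult_distrib mult.assoc)
    then show ?thesis using pent'_sums[OF T, of h "Suc h" x y] sT by (simp add: n_def qs_def)
  qed
  have 3: "(\<Sum>z\<leftarrow>map (zev T [a, b]) pent'. z ^ n) + (\<Sum>z\<leftarrow>map (zev T [d, c]) pent'. z ^ n) \<approx>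
      s ^ h * (zev T [k, S] (qs ! h) + zev T [g, - S] (qs ! h))"
    unfolding half distrib_left k_def[symmetric] S_def[symmetric] g_def[symmetric] G_def[symmetric]
    using zev_cong[of "[g, G]" "[g, - S]"] GS by (intro cong_add cong_mult) auto
  have len: "length ps = Suc n" "length qs = Suc h" by (simp_all add: ps_def qs_def pent_sums_def pent'_sums_def)
  define f1 where "f1 = zsubst [zpoly [(1, 0, [0, 1, 0])], zpoly [(1, 0, [0, 0, 1])]]"
  define f2 where "f2 = zsubst [zpoly [(1, 0, [1, 0, 0])], zpoly [(-1, 0, [0, 0, 1])]]"
  define E where "E = zev T [g, k, S]"
  have e1: "E (f1 p) = zev T [k, S] p" and e2: "E (f2 p) = zev T [g, - S] p" for p
    by (simp_all add: zev_zsubst[OF T] zev_zpoly E_def f1_def f2_def)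
  have c: "E (zconv cs V U) = (\<Sum>i<Suc n. of_int (cs ! i) * (E (V ! i) * E (U ! i)))"
    if "length cs = Suc n" "length V = Suc n" "length U = Suc n" for cs V U
    unfolding E_def by (rule zev_zconv[OF T that])
  have zg: "E (zgeo q (Cst 1 0) V ! i) = E q ^ i * E (V ! i)" if "i < length V" for q V i
    using zev_zgeo[OF T that, of "[g, k, S]" q "Cst 1 0"] by (simp add: E_def)
  have "E (zbinom (pascal (h + h)) (map f1 ps) (map f2 ps)) =
    (\<Sum>i<Suc n. of_int (pascal n ! i) * (v' i * (s ^ (n - i) * u' (n - i)))) +
    (\<Sum>i<Suc n. of_int (pascal n ! i) * (((- s) ^ i * v' i) * u' (n - i)))"
  proof -
    have hh: "h + h = n" by (simp add: n_def)
    have z: "E (zbinom cs V U) = E (zconv cs V (rev (zgeo (Cst (-1) 1) (Cst 1 0) U))) +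
      E (zconv cs (zgeo (Cst 1 (-1)) (Cst 1 0) V) (rev U))" for cs V U
      by (simp add: zbinom_def E_def zev_zadd)
    have q: "E (Cst (-1) 1) = s" "E (Cst 1 (-1)) = - s" by (simp_all add: E_def s_def)
    have r: "E (rev (zgeo (Cst (-1) 1) (Cst 1 0) (map f2 ps)) ! i) = s ^ (n - i) * u' (n - i)"
      "E (rev (map f2 ps) ! i) = u' (n - i)" "E (map f1 ps ! i) = v' i"
      "E (zgeo (Cst 1 (-1)) (Cst 1 0) (map f1 ps) ! i) = (- s) ^ i * v' i" if "i < Suc n" for i
      using that len by (simp_all add: rev_nth zg q e1 e2 u'_def v'_def)
    have r0: "E (f1 (ps ! i)) = v' i" for i by (simp add: e1 v'_def)
    show ?thesis unfolding z hh using len by (simp add: c r r0 del: sum.lessThan_Suc)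
  qed
  also have "\<dots> = (\<Sum>m\<le>n. C m * (v' m * u' (n - m)))"
    unfolding sum.distrib[symmetric] lessThan_Suc_atMost
    by (intro sum.cong refl) (simp add: pascal_nth C_def algebra_simps)
  finally have 4: "E (zbinom (pascal (h + h)) (map f1 ps) (map f2 ps)) = (\<Sum>m\<le>n. C m * (v' m * u' (n - m)))" .
  have l: "last qs = qs ! h" using len by (subst last_conv_nth) auto
  have "E (zmul (zpow (Cst (-1) 1) h) (zadd (f1 (last qs)) (f2 (last qs)))) =
     s ^ h * (zev T [k, S] (qs ! h) + zev T [g, - S] (qs ! h))"
    using e1 e2 unfolding E_def by (simp add: zev_zmul[OF T] zev_zadd zev_zpow[OF T] l s_def)
  then have 5: "E (inv_pol h) = (\<Sum>m\<le>n. C m * (v' m * u' (n - m))) +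
      s ^ h * (zev T [k, S] (qs ! h) + zev T [g, - S] (qs ! h))"
    using 4 unfolding inv_pol_def f1_def f2_def ps_def qs_def n_def mult_2 E_def zev_zadd by simp
  have "inv_sum n = (\<Sum>m\<le>n. C m * (v m * u (n - m))) +
     ((\<Sum>z\<leftarrow>map (zev T [a, b]) pent'. z ^ n) + (\<Sum>z\<leftarrow>map (zev T [d, c]) pent'. z ^ n))"
    unfolding inv_sum_def Let_def s_def[symmetric] 1[symmetric] by (simp only: add.assoc)
  then show ?thesis using cong_add[OF 2 3] 5 by (simp add: E_def n_def)
qed

definition \<phi>6 where "\<phi>6 = zev T [g, b, \<alpha>] phi6_pol"
definition \<phi>10 where "\<phi>10 = zev T [g, b, \<alpha>] phi10_pol"

lemma S_eq: "S = \<alpha> + (2 * T - 1) * b ^ 2"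
  by (simp add: S_def \<alpha>_def quad_def zev_zpoly)

lemma zev_S_pol: "zev T [g, b, \<alpha>] S_pol = S"
  by (simp add: S_eq S_pol_def zev_zpoly)

lemma zev_k_pol: "zev T [g, b, \<alpha>] k_pol = k"
proof -
  have "k = 32 * b ^ 5 + (8 - 16 * T) * b ^ 3 * S + 2 * b * S ^ 2"
    by (simp add: k_def quint_def S_def zev_simps[OF T] zev_zpoly)
  then show ?thesis by (simp add: k_pol_def zev_simps[OF T] zev_zpoly zev_S_pol)
qed

text \<open>Modulo \<open>S + G\<close> the form \<open>G\<close> is \<open>- S\<close>, hence only \<open>g\<close>, \<open>k\<close> and \<open>S\<close> remain; these are polynomials in \<open>g\<close>, \<open>b\<close> and \<open>\<alpha>\<close>.\<close>

lemma F_in_J: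
  assumes "S + G \<in> J" "inv_sum (2 * h) \<in> J"
    and "zeq (zscale u v (zsubst [zpoly [(1, 0, [1, 0, 0])], k_pol, S_pol] (inv_pol h)))
      (zscale N 0 (zsubst [zpoly [(1, 0, [0, 0, 1])], phi6_pol, phi10_pol] F))" "N \<noteq> 0"
  shows "zev T [\<alpha>, \<phi>6, \<phi>10] F \<in> J"
proof -
  have "zev T [g, k, S] (inv_pol h) \<in> J"
    using cong_J[OF inv_sum_cong[OF assms(1)]] assms(2) by blast
  then have "(of_int u + of_int v * T) * zev T [g, k, S] (inv_pol h) \<in> J" by (rule J_mult)
  also have "(of_int u + of_int v * T) * zev T [g, k, S] (inv_pol h) = of_int N * zev T [\<alpha>, \<phi>6, \<phi>10] F"
    using zev_zeq[OF T assms(3), of "[g, b, \<alpha>]"]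
    by (simp add: zev_simps[OF T] zev_zsubst[OF T] zev_k_pol zev_S_pol zev_zpoly \<phi>6_def \<phi>10_def)
  finally show ?thesis using J_of_int assms(4) by blast
qed

end


section \<open>Relations along the last variable\<close>

text \<open>The four top elements as polynomials in \<open>[\<alpha>, \<phi>6, \<phi>10]\<close>. They are chosen such that the power of \<open>\<alpha>\<close>, of half the length of the string, sends them into the ideal.\<close>

definition sigs :: "zpol list" where
  "sigs = [zpoly [(1, 0, [0, 0, 0])],
    zpoly [(295, 0, [3, 0, 0]), (1763, 0, [0, 1, 0])],
    zpoly [(372180, 0, [5, 0, 0]), (1866465, 0, [2, 1, 0]), (69967, 0, [0, 0, 1])],
    zpoly [(-1092795, 0, [8, 0, 0]), (-5272728, 0, [5, 1, 0]), (-250170, 0, [3, 0, 1]), (24149, 0, [0, 1, 1])]]"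

definition string_length :: "nat list" where "string_length = [46, 34, 26, 14]"
definition string_degree :: "nat list" where "string_degree = [0, 6, 10, 16]"

fun zcomb :: "(int \<times> nat \<times> nat) list \<Rightarrow> zpol" where
  "zcomb [] = Cst 0 0"
| "zcomb ((c, i, s) # ts) = zadd (zscale c 0 (zmul (zpow (zpoly [(1, 0, [1, 0, 0])]) i) (sigs ! s))) (zcomb ts)"

definition zrel :: "zpol \<Rightarrow> zpol \<Rightarrow> zpol \<Rightarrow> zpol" where
  "zrel p q r = zadd (zmul p F12) (zadd (zmul q F20) (zmul r F30))"

text \<open>A certificate for rewriting \<open>v * \<sigma> s\<close> modulo the ideal: \<open>N\<close> clears the denominators, \<open>ts\<close> lists the terms \<open>c * \<alpha> ^ i * \<sigma> s'\<close> of the result, and \<open>p\<close>, \<open>q\<close>, \<open>r\<close> are the cofactors of \<open>F12\<close>, \<open>F20\<close>, \<open>F30\<close>.\<close>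

definition closed_under :: "nat \<Rightarrow> zpol \<Rightarrow> int \<Rightarrow> nat \<Rightarrow> (int \<times> nat \<times> nat) list \<Rightarrow> zpol \<Rightarrow> zpol \<Rightarrow> zpol \<Rightarrow> bool" where
  "closed_under e v N s ts p q r \<longleftrightarrow> N \<noteq> 0 \<and> (\<forall>(c, i, s')\<in>set ts. s' < 4 \<and> 2 * i + string_degree ! s' = e + string_degree ! s) \<and>
     zeq (zscale N 0 (zmul v (sigs ! s))) (zadd (zcomb ts) (zrel p q r))"

lemma string_end_0: "closed_under 46 (zpoly [(1, 0, [23, 0, 0])]) 126663739519795200 0 []
    (zpoly [(80888366990865600, 0, [17, 0, 0]), (-262667381934189600, 0, [14, 1, 0]), (173215924846290000, 0, [12, 0, 1]), (980487387287004600, 0, [11, 2, 0]), (-49896987432823800, 0, [9, 1, 1]), (48077453647972800, 0, [8, 3, 0]), (320776282337280, 0, [7, 0, 2]), (1764326637041355, 0, [6, 2, 1]), (52449626580480, 0, [5, 4, 0]), (-3581188507830, 0, [4, 1, 2]), (8202270958560, 0, [3, 3, 1]), (48780589803, 0, [2, 0, 3]), (-33584049888, 0, [1, 2, 2]), (3494294208, 0, [0, 4, 1])])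
    (zpoly [(-385802910325740, 0, [13, 0, 0]), (-2167897967737725, 0, [10, 1, 0]), (-80738751466050, 0, [8, 0, 1]), (2464334658555, 0, [5, 1, 1]), (-34273276453, 0, [3, 0, 2]), (10110805, 0, [0, 1, 2])])
    (zpoly [(-125676732225, 0, [8, 0, 0]), (-30352793160, 0, [5, 1, 0]), (-2901462670, 0, [3, 0, 1]), (-2022161, 0, [0, 1, 1])])"
  by code_simp

lemma string_end_1: "closed_under 34 (zpoly [(1, 0, [17, 0, 0])]) 6184752906240 1 []
    (zpoly [(392166151729200, 0, [14, 0, 0]), (74677918421880, 0, [11, 1, 0]), (-8854503904440, 0, [9, 0, 1]), (-20487317110785, 0, [8, 2, 0]), (975096374274, 0, [6, 1, 1]), (-4360776800544, 0, [5, 3, 0]), (-3295755585, 0, [4, 0, 2]), (4309666560, 0, [3, 2, 1]), (-4694552640, 0, [2, 4, 0]), (-31405728, 0, [1, 1, 2]), (3267648, 0, [0, 3, 1])])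
    (zpoly [(-189345349035, 0, [10, 0, 0]), (69253032801, 0, [7, 1, 0]), (3164297145, 0, [5, 0, 1]), (32032818, 0, [2, 1, 1]), (9455, 0, [0, 0, 2])])
    (zpoly [(44558748, 0, [5, 0, 0]), (2716755, 0, [2, 1, 0]), (-1891, 0, [0, 0, 1])])"
  by code_simp

lemma string_end_2: "closed_under 26 (zpoly [(1, 0, [13, 0, 0])]) 8053063680 2 []
    (zpoly [(602143523370000, 0, [12, 0, 0]), (-15448530807000, 0, [9, 1, 0]), (111413419800, 0, [7, 0, 1]), (696894929865, 0, [6, 2, 0]), (-1515777810, 0, [4, 1, 1]), (3173942880, 0, [3, 3, 0]), (18791817, 0, [2, 0, 2]), (-12937632, 0, [1, 2, 1]), (1346112, 0, [0, 4, 0])])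
    (zpoly [(-18789411705, 0, [8, 0, 0]), (1088691960, 0, [5, 1, 0]), (-13162142, 0, [3, 0, 1]), (3895, 0, [0, 1, 1])])
    (zpoly [(-1125935, 0, [3, 0, 0]), (-779, 0, [0, 1, 0])])"
  by code_simp

lemma string_end_3: "closed_under 14 (zpoly [(1, 0, [7, 0, 0])]) 1966080 3 []
    (zpoly [(-424971806400, 0, [9, 0, 0]), (31815563040, 0, [6, 1, 0]), (32914080, 0, [4, 0, 1]), (-21581280, 0, [3, 2, 0]), (-16608, 0, [1, 1, 1]), (1728, 0, [0, 3, 0])])
    (zpoly [(-32865780, 0, [5, 0, 0]), (24123, 0, [2, 1, 0]), (5, 0, [0, 0, 1])])
    (zpoly [(-1, 0, [0, 0, 0])])"
  by code_simp

lemma string_phi6_0: "closed_under 6 (zpoly [(1, 0, [0, 1, 0])]) 1763 0 [(1, 0, 1), (-295, 3, 0)]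
    (zpoly []) (zpoly []) (Cst 0 0)"
  by code_simp

lemma string_phi6_1: "closed_under 6 (zpoly [(1, 0, [0, 1, 0])]) 123351821 1 [(-3108169, 1, 2), (227422535, 3, 1), (2362388480, 6, 0)]
    (zpoly [(217469260423, 0, [0, 0, 0])]) (zpoly []) (Cst 0 0)"
  by code_simp

lemma string_phi6_2: "closed_under 6 (zpoly [(1, 0, [0, 1, 0])]) 1473089 2 [(4267987, 0, 3), (-24036285, 3, 2), (-466053888, 5, 1)]
    (zpoly [(2749469060385, 0, [2, 0, 0])]) (zpoly []) (Cst 0 0)"
  by code_simp

lemma string_phi6_3: "closed_under 6 (zpoly [(1, 0, [0, 1, 0])]) 779 3 [(-1125935, 3, 3), (4096, 6, 2)]
    (zpoly [(-243679179297, 0, [5, 0, 0]), (18059588160, 0, [2, 1, 0]), (18812071, 0, [0, 0, 1])]) (zpoly [(-18812071, 0, [1, 0, 0])]) (Cst 0 0)"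
  by code_simp

lemma string_phi10_0: "closed_under 10 (zpoly [(1, 0, [0, 0, 1])]) 123351821 0 [(1763, 0, 2), (-1866465, 2, 1), (-105546165, 5, 0)]
    (zpoly []) (zpoly []) (Cst 0 0)"
  by code_simp

lemma string_phi10_1: "closed_under 10 (zpoly [(1, 0, [0, 0, 1])]) 2343684599 1 [(171100913, 0, 3), (621660245, 3, 2), (-146420030847, 5, 1), (-1197378662400, 8, 0)]
    (zpoly []) (zpoly []) (Cst 0 0)"
  by code_simp

lemma string_phi10_2: "closed_under 10 (zpoly [(1, 0, [0, 0, 1])]) 2343684599 2 [(9755560211685, 2, 3), (265949607585, 5, 2), (7805508207360, 7, 1), (14200775639040, 10, 0)]
    (zpoly [(2088292690607397255, 0, [4, 0, 0]), (-157421357124703680, 0, [1, 1, 0])]) (zpoly [(163980580338233, 0, [0, 0, 0])]) (Cst 0 0)"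
  by code_simp

lemma string_phi10_3: "closed_under 10 (zpoly [(1, 0, [0, 0, 1])]) 1473089 3 [(-3024178276233, 5, 3), (11127828480, 8, 2), (2450522112, 10, 1)]
    (zpoly [(-654513899155497975, 0, [7, 0, 0]), (48959272405448235, 0, [4, 1, 0]), (50158813028010, 0, [2, 0, 1]), (-34150681210560, 0, [1, 2, 0])]) (zpoly [(-50527335703140, 0, [3, 0, 0]), (35573626261, 0, [0, 1, 0])]) (Cst 0 0)"
  by code_simp


locale h4_relations = h4_forms J "of_real \<tau>" a b c d
  for J :: "'a::{comm_ring_1,real_algebra_1} set" and \<tau> :: real and a b c d :: 'a +
  assumes \<tau>: "\<tau> * \<tau> = \<tau> + 1"
    and SG: "S + G \<in> J"
    and F12: "zev (of_real \<tau>) [\<alpha>, \<phi>6, \<phi>10] F12 \<in> J"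
    and F20: "zev (of_real \<tau>) [\<alpha>, \<phi>6, \<phi>10] F20 \<in> J"
    and F30: "zev (of_real \<tau>) [\<alpha>, \<phi>6, \<phi>10] F30 \<in> J"
begin

abbreviation T where "T \<equiv> of_real \<tau> :: 'a"

definition \<sigma> :: "nat \<Rightarrow> 'a" where "\<sigma> s = zev T [\<alpha>, \<phi>6, \<phi>10] (sigs ! s)"

lemma \<tau>_nz: "\<tau> \<noteq> 0" using \<tau> by auto

lemma span_J: "j \<in> J \<Longrightarrow> j \<in> span (X \<union> J)"
  by (simp add: span_base)

lemma span_cong: "f \<approx> h \<Longrightarrow> h \<in> span (X \<union> J) \<Longrightarrow> f \<in> span (X \<union> J)"
  using span_add[OF span_J[of "f - h" X], of h] by (simp add: cong_def)

lemma span_mult: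
  assumes "f \<in> span (X \<union> J)" "\<And>x. x \<in> X \<Longrightarrow> h * x \<in> span (Y \<union> J)"
  shows "h * f \<in> span (Y \<union> J)"
  using assms(1)
proof (induction rule: span_induct_alt)
  case (step r x y)
  have "h * x \<in> span (Y \<union> J)" using step(1) assms(2) span_J J_mult by blast
  then show ?case using step(2) by (simp add: distrib_left span_add span_scale)
qed (simp add: span_zero)

lemma span_mono': "f \<in> span (X \<union> J) \<Longrightarrow> X \<subseteq> Y \<Longrightarrow> f \<in> span (Y \<union> J)"
  using span_mono[of "X \<union> J" "Y \<union> J"] by blast

lemma of_int_mult: "of_int N * (f::'a) = of_int N *\<^sub>R f"
  by (metis of_real_of_int_eq scaleR_conv_of_real)

lemma T_mult: "T * f = \<tau> *\<^sub>R f" by (simp add: scaleR_conv_of_real)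

lemma zrel_in_J: "zev T [\<alpha>, \<phi>6, \<phi>10] (zrel p q r) \<in> J"
  unfolding zrel_def zev_zadd zev_zmul[OF T] by (intro J_add J_mult F12 F20 F30)

lemma zev_zcomb:
  "zev T [\<alpha>, \<phi>6, \<phi>10] (zcomb ts) = (\<Sum>(c, i, s)\<leftarrow>ts. of_int c * (\<alpha> ^ i * \<sigma> s))"
  by (induction ts rule: zcomb.induct) (auto simp: zev_simps[OF T] \<sigma>_def zev_zpoly)

text \<open>Degree \<open>n\<close> of the span of the strings along \<open>a\<close>, modulo the ideal. It is closed under multiplication by \<open>a\<close> and by the invariants of \<open>H\<^sub>3\<close>.\<close>

definition A4 :: "nat \<Rightarrow> 'a set" where
  "A4 n = span ({a ^ p * \<sigma> s | p s. s < 4 \<and> p < string_length ! s \<and> p + string_degree ! s = n} \<union> J)"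

lemma subspace_A4: "subspace (A4 n)" by (simp add: A4_def subspace_span)
lemma J_A4: "j \<in> J \<Longrightarrow> j \<in> A4 n" by (simp add: A4_def span_J)

lemma closed_underD:
  assumes "closed_under e v N s ts p q r"
  shows "of_int N * (zev T [\<alpha>, \<phi>6, \<phi>10] v * \<sigma> s) \<approx> (\<Sum>(c, i, s)\<leftarrow>ts. of_int c * (\<alpha> ^ i * \<sigma> s))"
proof -
  have "zeq (zscale N 0 (zmul v (sigs ! s))) (zadd (zcomb ts) (zrel p q r))" using assms by (simp add: closed_under_def)
  from zev_zeq[OF T this, of "[\<alpha>, \<phi>6, \<phi>10]"] show ?thesis
    using zrel_in_J[of p q r] by (simp add: cong_def zev_simps[OF T] zev_zcomb \<sigma>_def)
qed

lemma all_less_4: "(\<forall>s<4::nat. P s) \<longleftrightarrow> P 0 \<and> P 1 \<and> P 2 \<and> P 3"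
proof -
  have "s < 4 \<longleftrightarrow> s = 0 \<or> s = 1 \<or> s = 2 \<or> s = 3" for s :: nat by auto
  then show ?thesis by auto
qed

lemma string_end:
  assumes "s < 4" shows "a ^ (string_length ! s) * \<sigma> s \<in> J"
proof -
  have *: "a ^ e' * \<sigma> s \<in> J" if "closed_under e' (zpoly [(1, 0, [e, 0, 0])]) N s [] p q r" and e': "e' = 2 * e" for e' e N s p q r
  proof -
    have "of_int N * (\<alpha> ^ e * \<sigma> s) \<in> J" using closed_underD[OF that(1)] by (simp add: cong_0 zev_zpoly)
    then have "\<alpha> ^ e * \<sigma> s \<in> J" using J_of_int that(1) unfolding closed_under_def by blast
    moreover have "a ^ (2 * e) * \<sigma> s = (1 / \<tau>) ^ e *\<^sub>R (\<alpha> ^ e * \<sigma> s)"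
    proof -
      have "\<alpha> ^ e = \<tau> ^ e *\<^sub>R a ^ (2 * e)" by (simp add: \<alpha>_def power_mult_distrib power_mult scaleR_conv_of_real)
      moreover have "(1 / \<tau>) ^ e * \<tau> ^ e = 1" using \<tau>_nz by (simp add: power_mult_distrib[symmetric])
      ultimately show ?thesis by simp
    qed
    ultimately show ?thesis using subspace_scale[OF J_subspace] e' by simp
  qed
  have "\<forall>s<4. a ^ (string_length ! s) * \<sigma> s \<in> J"
    unfolding all_less_4 string_length_def
    using *[OF string_end_0] *[OF string_end_1] *[OF string_end_2] *[OF string_end_3] by simp
  then show ?thesis using assms by blast
qed

lemma a_pow_\<sigma>_A4: "s < 4 \<Longrightarrow> a ^ p * \<sigma> s \<in> A4 (p + string_degree ! s)"
proof (cases "p < string_length ! s")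
  case False
  assume s: "s < 4"
  have "a ^ p * \<sigma> s = a ^ (p - string_length ! s) * (a ^ (string_length ! s) * \<sigma> s)"
    using False by (simp add: mult.assoc[symmetric] power_add[symmetric])
  then show ?thesis using J_mult[OF string_end[OF s]] J_A4 by simp
qed (auto simp: A4_def intro!: span_base)

lemma A4_closed:
  assumes "\<And>s. s < 4 \<Longrightarrow> \<exists>N ts p q r. closed_under e v N s ts p q r" "f \<in> A4 n"
  shows "zev T [\<alpha>, \<phi>6, \<phi>10] v * f \<in> A4 (n + e)"
  unfolding A4_def
proof (rule span_mult[OF assms(2)[unfolded A4_def]], fold A4_def)
  fix x assume "x \<in> {a ^ p * \<sigma> s |p s. s < 4 \<and> p < string_length ! s \<and> p + string_degree ! s = n}"
  then obtain p s where x: "x = a ^ p * \<sigma> s" "s < 4" "p + string_degree ! s = n" by blast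
  define V where "V = zev T [\<alpha>, \<phi>6, \<phi>10] v"
  obtain N ts p1 q r where cl: "closed_under e v N s ts p1 q r" using assms(1)[OF x(2)] by blast
  have N: "N \<noteq> 0" and ts: "\<forall>(c, i, s')\<in>set ts. s' < 4 \<and> 2 * i + string_degree ! s' = e + string_degree ! s"
    using cl by (simp_all add: closed_under_def)
  have "of_int N * (V * \<sigma> s) \<approx> (\<Sum>(c, i, s)\<leftarrow>ts. of_int c * (\<alpha> ^ i * \<sigma> s))"
    using closed_underD[OF cl] by (simp add: V_def)
  then have c: "a ^ p * (of_int N * (V * \<sigma> s)) \<approx> a ^ p * (\<Sum>(c, i, s)\<leftarrow>ts. of_int c * (\<alpha> ^ i * \<sigma> s))"
    by (intro cong_mult) auto
  have "a ^ p * (\<Sum>(c, i, s)\<leftarrow>ts. of_int c * (\<alpha> ^ i * \<sigma> s)) \<in> A4 (n + e)" using ts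
  proof (induction ts)
    case Nil then show ?case using J_A4[OF J_0] by simp
  next
    case (Cons t ts)
    obtain c i s' where t: "t = (c, i, s')" by (cases t)
    have h: "s' < 4" "2 * i + string_degree ! s' = e + string_degree ! s" using Cons.prems t by auto
    have "a ^ p * (of_int c * (\<alpha> ^ i * \<sigma> s')) = (of_int c * \<tau> ^ i) *\<^sub>R (a ^ (p + 2 * i) * \<sigma> s')"
      by (simp add: \<alpha>_def power_mult_distrib power_mult[symmetric] power_add scaleR_conv_of_real mult_ac)
    moreover have "a ^ (p + 2 * i) * \<sigma> s' \<in> A4 (n + e)"
      using a_pow_\<sigma>_A4[OF h(1), of "p + 2 * i"] h(2) x(3) by (simp add: add.assoc add.commute add.left_commute)
    ultimately have "a ^ p * (of_int c * (\<alpha> ^ i * \<sigma> s')) \<in> A4 (n + e)"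
      using subspace_scale[OF subspace_A4] by simp
    then show ?case using Cons t subspace_add[OF subspace_A4] by (simp add: distrib_left)
  qed
  then have "a ^ p * (of_int N * (V * \<sigma> s)) \<in> A4 (n + e)" using span_cong[OF c] unfolding A4_def by blast
  then have "(1 / of_int N) *\<^sub>R (of_int N *\<^sub>R (V * x)) \<in> A4 (n + e)"
    using subspace_scale[OF subspace_A4] by (simp add: x(1) of_int_mult[symmetric] mult_ac)
  then show "zev T [\<alpha>, \<phi>6, \<phi>10] v * x \<in> A4 (n + e)" using N by (simp add: V_def)
qed

lemma A4_a: "f \<in> A4 n \<Longrightarrow> a * f \<in> A4 (Suc n)"
  unfolding A4_def
proof (erule span_mult, fold A4_def)
  fix x assume "x \<in> {a ^ p * \<sigma> s |p s. s < 4 \<and> p < string_length ! s \<and> p + string_degree ! s = n}"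
  then obtain p s where x: "x = a ^ p * \<sigma> s" "s < 4" "p + string_degree ! s = n" by blast
  show "a * x \<in> A4 (Suc n)" using a_pow_\<sigma>_A4[OF x(2), of "Suc p"] x by (simp add: mult.assoc)
qed

lemma ex_less_4: "P 0 \<Longrightarrow> P 1 \<Longrightarrow> P 2 \<Longrightarrow> P 3 \<Longrightarrow> s < 4 \<Longrightarrow> P (s::nat)"
  using all_less_4[of P] by blast

lemma A4_\<phi>6: "f \<in> A4 n \<Longrightarrow> \<phi>6 * f \<in> A4 (n + 6)"
proof -
  assume f: "f \<in> A4 n"
  have "\<exists>N ts p q r. closed_under 6 (zpoly [(1, 0, [0, 1, 0])]) N s ts p q r" if "s < 4" for s
    using that by (rule ex_less_4[rotated -1]) (blast intro: string_phi6_0 string_phi6_1 string_phi6_2 string_phi6_3)+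
  from A4_closed[OF this f] show ?thesis by (simp add: zev_zpoly)
qed

lemma A4_\<phi>10: "f \<in> A4 n \<Longrightarrow> \<phi>10 * f \<in> A4 (n + 10)"
proof -
  assume f: "f \<in> A4 n"
  have "\<exists>N ts p q r. closed_under 10 (zpoly [(1, 0, [0, 0, 1])]) N s ts p q r" if "s < 4" for s
    using that by (rule ex_less_4[rotated -1]) (blast intro: string_phi10_0 string_phi10_1 string_phi10_2 string_phi10_3)+
  from A4_closed[OF this f] show ?thesis by (simp add: zev_zpoly)
qed

end


section \<open>Straightening in the other variables\<close>

lemma UNIV_4: "(UNIV :: 4 set) = {1, 2, 3, 4}"
proof -
  have d: "distinct [1, 2, 3, 4 :: 4]" by simp
  have "card {1, 2, 3, 4 :: 4} = card (UNIV :: 4 set)" using distinct_card[OF d] by simp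
  then show ?thesis by (intro card_subset_eq[symmetric]) auto
qed

context h4_relations
begin

abbreviation r where "r \<equiv> 2 * \<tau> - 1"

lemma r_square: "r * r = 5" using \<tau> by (simp add: algebra_simps)
lemma r_nz: "r \<noteq> 0" using r_square by auto
lemma r_T: "2 * T - 1 = of_real r" by simp

text \<open>The second top element along \<open>b\<close>; the multiple of \<open>b ^ 5\<close> is chosen such that \<open>b * \<sigma>5\<close> straightens to terms of low weight.\<close>

definition \<sigma>5 where "\<sigma>5 = g + 11 * b ^ 5"

lemma A4_add: "f \<in> A4 n \<Longrightarrow> h \<in> A4 n \<Longrightarrow> f + h \<in> A4 n" by (rule subspace_add[OF subspace_A4])
lemma A4_scaleR: "f \<in> A4 n \<Longrightarrow> q *\<^sub>R f \<in> A4 n" by (rule subspace_scale[OF subspace_A4])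
lemma A4_\<alpha>: "f \<in> A4 n \<Longrightarrow> \<alpha> * f \<in> A4 (n + 2)"
proof -
  assume "f \<in> A4 n"
  then have "a * (a * f) \<in> A4 (n + 2)" using A4_a[OF A4_a] by simp
  then have "\<tau> *\<^sub>R (a * (a * f)) \<in> A4 (n + 2)" by (rule A4_scaleR)
  then show ?thesis by (simp add: \<alpha>_def T_mult power2_eq_square mult.assoc)
qed

lemma A4_\<alpha>_pow: "f \<in> A4 n \<Longrightarrow> \<alpha> ^ i * f \<in> A4 (n + 2 * i)"
proof (induction i)
  case (Suc i)
  then show ?case using A4_\<alpha>[of "\<alpha> ^ i * f" "n + 2 * i"] by (simp add: mult.assoc)
qed simp

lemma A4_mono: "f \<in> A4 n \<Longrightarrow> \<alpha> ^ i * (\<phi>6 ^ j * (\<phi>10 ^ l * f)) \<in> A4 (n + 10 * l + 6 * j + 2 * i)"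
proof -
  have h10: "\<phi>10 ^ l * f \<in> A4 (n + 10 * l)" if "f \<in> A4 n" for f n l
    using that
  proof (induction l)
    case (Suc l)
    then show ?case using A4_\<phi>10[of "\<phi>10 ^ l * f" "n + 10 * l"] by (simp add: mult.assoc add.assoc add.commute add.left_commute)
  qed simp
  have h6: "\<phi>6 ^ l * f \<in> A4 (n + 6 * l)" if "f \<in> A4 n" for f n l
    using that
  proof (induction l)
    case (Suc l)
    then show ?case using A4_\<phi>6[of "\<phi>6 ^ l * f" "n + 6 * l"] by (simp add: mult.assoc add.assoc add.commute add.left_commute)
  qed simp
  assume "f \<in> A4 n" then show ?thesis by (intro A4_\<alpha>_pow h6 h10)
qed

lemma \<sigma>_simps:
  "\<sigma> 0 = 1" "\<sigma> 1 = 1763 * \<phi>6 + 295 * \<alpha> ^ 3"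
  "\<sigma> 2 = 1866465 * (\<alpha> ^ 2 * \<phi>6) + 372180 * \<alpha> ^ 5 + 69967 * \<phi>10"
  "\<sigma> 3 = - 1092795 * \<alpha> ^ 8 - 5272728 * (\<alpha> ^ 5 * \<phi>6) - 250170 * (\<alpha> ^ 3 * \<phi>10) + 24149 * (\<phi>6 * \<phi>10)"
  by (simp_all add: \<sigma>_def sigs_def zev_zpoly mult_ac add_ac numeral_2_eq_2 numeral_3_eq_3)

lemma A4_\<sigma>: assumes "f \<in> A4 n" "s < 4" shows "\<sigma> s * f \<in> A4 (n + string_degree ! s)"
proof -
  have m: "q *\<^sub>R (\<alpha> ^ i * (\<phi>6 ^ j * (\<phi>10 ^ l * f))) \<in> A4 N" if "N = n + 10 * l + 6 * j + 2 * i" for q i j l N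
    using A4_scaleR[OF A4_mono[OF assms(1)]] that by simp
  have "\<sigma> 1 * f = 1763 *\<^sub>R (\<alpha> ^ 0 * (\<phi>6 ^ 1 * (\<phi>10 ^ 0 * f))) + 295 *\<^sub>R (\<alpha> ^ 3 * (\<phi>6 ^ 0 * (\<phi>10 ^ 0 * f)))"
    unfolding \<sigma>_simps by (simp add: distrib_right scaleR_conv_of_real mult.assoc)
  moreover have "\<sigma> 2 * f = 1866465 *\<^sub>R (\<alpha> ^ 2 * (\<phi>6 ^ 1 * (\<phi>10 ^ 0 * f))) + 372180 *\<^sub>R (\<alpha> ^ 5 * (\<phi>6 ^ 0 * (\<phi>10 ^ 0 * f)))
      + 69967 *\<^sub>R (\<alpha> ^ 0 * (\<phi>6 ^ 0 * (\<phi>10 ^ 1 * f)))"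
    unfolding \<sigma>_simps by (simp add: distrib_right scaleR_conv_of_real mult.assoc)
  moreover have "\<sigma> 3 * f = (- 1092795) *\<^sub>R (\<alpha> ^ 8 * (\<phi>6 ^ 0 * (\<phi>10 ^ 0 * f))) + (- 5272728) *\<^sub>R (\<alpha> ^ 5 * (\<phi>6 ^ 1 * (\<phi>10 ^ 0 * f)))
      + (- 250170) *\<^sub>R (\<alpha> ^ 3 * (\<phi>6 ^ 0 * (\<phi>10 ^ 1 * f))) + 24149 *\<^sub>R (\<alpha> ^ 0 * (\<phi>6 ^ 1 * (\<phi>10 ^ 1 * f)))"
    unfolding \<sigma>_simps by (simp add: distrib_right left_diff_distrib scaleR_conv_of_real mult.assoc)
  moreover have "\<sigma> 0 * f \<in> A4 (n + 0)" using assms(1) by (simp add: \<sigma>_simps)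
  ultimately have "\<forall>s<4. \<sigma> s * f \<in> A4 (n + string_degree ! s)"
    unfolding all_less_4 by (simp only:) (intro conjI A4_add m, simp_all add: string_degree_def)
  then show ?thesis using assms(2) by blast
qed

lemma A4_a_pow: "f \<in> A4 n \<Longrightarrow> a ^ p * f \<in> A4 (p + n)"
  by (induction p) (auto simp: mult.assoc dest: A4_a)

lemma A4_mult: assumes "f \<in> A4 m" "h \<in> A4 n" shows "f * h \<in> A4 (m + n)"
proof -
  have "h * f \<in> span ({a ^ p * \<sigma> s |p s. s < 4 \<and> p < string_length ! s \<and> p + string_degree ! s = m + n} \<union> J)"
  proof (rule span_mult[OF assms(1)[unfolded A4_def]], fold A4_def)
    fix x assume "x \<in> {a ^ p * \<sigma> s |p s. s < 4 \<and> p < string_length ! s \<and> p + string_degree ! s = m}"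
    then obtain p s where x: "x = a ^ p * \<sigma> s" "s < 4" "p + string_degree ! s = m" by blast
    have "a ^ p * (\<sigma> s * h) \<in> A4 (p + (n + string_degree ! s))" by (intro A4_a_pow A4_\<sigma> assms x(2))
    moreover have "h * x = a ^ p * (\<sigma> s * h)" by (simp add: x(1) mult_ac)
    moreover have "p + (n + string_degree ! s) = m + n" using x(3) by simp
    ultimately show "h * x \<in> A4 (m + n)" by simp
  qed
  then show ?thesis by (simp add: A4_def mult.commute)
qed

lemma A4_1: "1 \<in> A4 0"
  using a_pow_\<sigma>_A4[of 0 0] by (simp add: \<sigma>_simps string_degree_def)

text \<open>The first eleven elements form the string of \<open>1\<close> along \<open>b\<close>; the last one is the string of length 1 at \<open>\<sigma>5\<close>.\<close>

definition bt :: "nat \<Rightarrow> 'a" where "bt j = (if j \<le> 10 then b ^ j else \<sigma>5)"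
definition bd :: "nat \<Rightarrow> nat" where "bd j = (if j \<le> 10 then j else 5)"

text \<open>Combinations of the twelve elements \<open>bt j\<close> with coefficients from the preceding stage, restricted to weight at most \<open>u\<close>.\<close>

definition B3 :: "nat \<Rightarrow> nat \<Rightarrow> 'a set" where
  "B3 u n = span ({f * bt j | f j. j < 12 \<and> bd j \<le> u \<and> bd j \<le> n \<and> f \<in> A4 (n - bd j)} \<union> J)"

lemma subspace_B3: "subspace (B3 u n)" by (simp add: B3_def subspace_span)
lemma B3_add: "f \<in> B3 u n \<Longrightarrow> h \<in> B3 u n \<Longrightarrow> f + h \<in> B3 u n" by (rule subspace_add[OF subspace_B3])
lemma B3_diff: "f \<in> B3 u n \<Longrightarrow> h \<in> B3 u n \<Longrightarrow> f - h \<in> B3 u n" by (rule subspace_diff[OF subspace_B3])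
lemma B3_scaleR: "f \<in> B3 u n \<Longrightarrow> q *\<^sub>R f \<in> B3 u n" by (rule subspace_scale[OF subspace_B3])
lemma B3_base: "f \<in> A4 m \<Longrightarrow> j < 12 \<Longrightarrow> bd j \<le> u \<Longrightarrow> n = m + bd j \<Longrightarrow> f * bt j \<in> B3 u n"
  unfolding B3_def by (intro span_base) (auto intro!: exI[of _ f] exI[of _ j])
lemma B3_b_pow: "f \<in> A4 m \<Longrightarrow> j \<le> u \<Longrightarrow> j \<le> 10 \<Longrightarrow> n = m + j \<Longrightarrow> f * b ^ j \<in> B3 u n"
  using B3_base[of f m j u n] by (simp add: bd_def bt_def)
lemma B3_mono: "f \<in> B3 u n \<Longrightarrow> u \<le> v \<Longrightarrow> f \<in> B3 v n"
  unfolding B3_def by (erule span_mono') (blast intro: order_trans)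

lemma A4_B3: assumes "f \<in> A4 m" "h \<in> B3 u n" shows "f * h \<in> B3 u (m + n)"
  unfolding B3_def
proof (rule span_mult[OF assms(2)[unfolded B3_def]], fold B3_def)
  fix x assume "x \<in> {f * bt j |f j. j < 12 \<and> bd j \<le> u \<and> bd j \<le> n \<and> f \<in> A4 (n - bd j)}"
  then obtain e j where x: "x = e * bt j" "j < 12" "bd j \<le> u" "bd j \<le> n" "e \<in> A4 (n - bd j)" by blast
  have "(f * e) * bt j \<in> B3 u (m + n)"
    using x A4_mult[OF assms(1) x(5)] by (intro B3_base) auto
  then show "f * x \<in> B3 u (m + n)" by (simp add: x(1) mult.assoc)
qed

definition X where "X = b * \<sigma>5"

lemma \<phi>6_eq: "\<phi>6 = r *\<^sub>R (\<alpha> ^ 2 * b ^ 2 + 3 * r *\<^sub>R (\<alpha> * b ^ 4) + X)"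
proof -
  have "\<phi>6 = (2 * T - 1) * (\<alpha> ^ 2 * b ^ 2 + 3 * (2 * T - 1) * \<alpha> * b ^ 4 + 11 * b ^ 6 + g * b)"
    by (simp add: \<phi>6_def phi6_pol_def zev_simps[OF T] zev_zpoly algebra_simps)
  then show ?thesis
    unfolding r_T X_def \<sigma>5_def by (simp add: scaleR_conv_of_real algebra_simps eval_nat_numeral)
qed

text \<open>The invariant of degree 10 expresses \<open>b ^ 10\<close> and \<open>\<sigma>5\<^sup>2\<close> through each other; multiplied by \<open>b\<close> it yields the relation for \<open>b ^ 11\<close>.\<close>

lemma \<phi>10_eq: "\<phi>10 = r *\<^sub>R (\<alpha> ^ 4 * b ^ 2 + 11 * r *\<^sub>R (\<alpha> ^ 3 * b ^ 4) + 220 * (\<alpha> ^ 2 * b ^ 6) + 500 * r *\<^sub>R (\<alpha> * b ^ 8)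
   + 3125 * b ^ 10 - 3 * (\<alpha> ^ 2 * X) - 24 * r *\<^sub>R (\<alpha> * (b ^ 2 * X)) - 250 * (b ^ 4 * X) + \<sigma>5 * \<sigma>5)"
proof -
  have "\<phi>10 = (2 * T - 1) * (\<alpha> ^ 4 * b ^ 2 + 11 * (2 * T - 1) * \<alpha> ^ 3 * b ^ 4 + 187 * \<alpha> ^ 2 * b ^ 6 + 236 * (2 * T - 1) * \<alpha> * b ^ 8
    + 496 * b ^ 10 - 3 * \<alpha> ^ 2 * b * g - 24 * (2 * T - 1) * \<alpha> * b ^ 3 * g - 228 * b ^ 5 * g + g ^ 2)"
    by (simp add: \<phi>10_def phi10_pol_def zev_simps[OF T] zev_zpoly algebra_simps)
  then show ?thesis
    unfolding r_T X_def \<sigma>5_def by (simp add: scaleR_conv_of_real algebra_simps eval_nat_numeral)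
qed

abbreviation B where "B \<equiv> B3 10"

lemma A4_\<phi>6': "\<phi>6 \<in> A4 6" using A4_\<phi>6[OF A4_1] by simp
lemma A4_\<phi>10': "\<phi>10 \<in> A4 10" using A4_\<phi>10[OF A4_1] by simp
lemma A4_\<alpha>': "\<alpha> ^ i \<in> A4 (2 * i)" using A4_\<alpha>_pow[OF A4_1, of i] by simp

lemma X_eq: "X = (1 / r) *\<^sub>R \<phi>6 - \<alpha> ^ 2 * b ^ 2 - (3 * r) *\<^sub>R (\<alpha> * b ^ 4)"
proof -
  have "(1 / r) *\<^sub>R \<phi>6 = \<alpha> ^ 2 * b ^ 2 + 3 * r *\<^sub>R (\<alpha> * b ^ 4) + X" unfolding \<phi>6_eq using r_nz by simp
  moreover have "3 * r *\<^sub>R (\<alpha> * b ^ 4) = (3 * r) *\<^sub>R (\<alpha> * b ^ 4)" by (simp add: scaleR_conv_of_real algebra_simps)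
  ultimately show ?thesis by simp
qed

lemma X_B3: "X \<in> B3 4 6"
proof -
  have "\<phi>6 * b ^ 0 \<in> B3 4 6" by (rule B3_b_pow[OF A4_\<phi>6']) auto
  moreover have "\<alpha> ^ 2 * b ^ 2 \<in> B3 4 6" by (rule B3_b_pow[OF A4_\<alpha>']) auto
  moreover have "\<alpha> ^ 1 * b ^ 4 \<in> B3 4 6" by (rule B3_b_pow[OF A4_\<alpha>']) auto
  ultimately show ?thesis unfolding X_eq by (intro B3_diff B3_scaleR) simp_all
qed

lemma b11_eq: "3125 *\<^sub>R b ^ 11 = (1 / r) *\<^sub>R (\<phi>10 * b) - \<alpha> ^ 4 * b ^ 3 - (11 * r) *\<^sub>R (\<alpha> ^ 3 * b ^ 5) - 220 *\<^sub>R (\<alpha> ^ 2 * b ^ 7)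
   - (500 * r) *\<^sub>R (\<alpha> * b ^ 9) + 4 *\<^sub>R (\<alpha> ^ 2 * (b * X)) + (27 * r) *\<^sub>R (\<alpha> * (b ^ 3 * X)) + 250 *\<^sub>R (b ^ 5 * X)
   - (1 / r) *\<^sub>R (\<phi>6 * \<sigma>5)"
proof -
  have "\<phi>10 * b = r *\<^sub>R (\<alpha> ^ 4 * b ^ 3 + (11 * r) *\<^sub>R (\<alpha> ^ 3 * b ^ 5) + 220 *\<^sub>R (\<alpha> ^ 2 * b ^ 7) + (500 * r) *\<^sub>R (\<alpha> * b ^ 9)
   + 3125 *\<^sub>R b ^ 11 - 3 *\<^sub>R (\<alpha> ^ 2 * (b * X)) - (24 * r) *\<^sub>R (\<alpha> * (b ^ 3 * X)) - 250 *\<^sub>R (b ^ 5 * X) + \<sigma>5 * X)"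
    unfolding \<phi>10_eq X_def by (simp add: scaleR_conv_of_real algebra_simps eval_nat_numeral)
  then have 1: "(1 / r) *\<^sub>R (\<phi>10 * b) = \<alpha> ^ 4 * b ^ 3 + (11 * r) *\<^sub>R (\<alpha> ^ 3 * b ^ 5) + 220 *\<^sub>R (\<alpha> ^ 2 * b ^ 7) + (500 * r) *\<^sub>R (\<alpha> * b ^ 9)
   + 3125 *\<^sub>R b ^ 11 - 3 *\<^sub>R (\<alpha> ^ 2 * (b * X)) - (24 * r) *\<^sub>R (\<alpha> * (b ^ 3 * X)) - 250 *\<^sub>R (b ^ 5 * X) + \<sigma>5 * X"
    using r_nz by simp
  have "\<sigma>5 * X = \<sigma>5 * ((1 / r) *\<^sub>R \<phi>6 - \<alpha> ^ 2 * b ^ 2 - (3 * r) *\<^sub>R (\<alpha> * b ^ 4))" by (simp only: X_eq[symmetric])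
  also have "\<dots> = (1 / r) *\<^sub>R (\<phi>6 * \<sigma>5) - \<alpha> ^ 2 * (b * X) - (3 * r) *\<^sub>R (\<alpha> * (b ^ 3 * X))"
    unfolding X_def by (simp add: right_diff_distrib mult_ac eval_nat_numeral)
  finally show ?thesis unfolding 1
    by (simp only:) (simp add: scaleR_conv_of_real algebra_simps)
qed

lemma B3_b_pow_X:
  assumes "i \<le> 6" shows "b ^ i * X \<in> B (6 + i)"
proof -
  have "\<phi>6 * b ^ i \<in> B (6 + i)" by (rule B3_b_pow[OF A4_\<phi>6']) (use assms in auto)
  moreover have "\<alpha> ^ 2 * b ^ (2 + i) \<in> B (6 + i)" by (rule B3_b_pow[OF A4_\<alpha>']) (use assms in auto)
  moreover have "\<alpha> ^ 1 * b ^ (4 + i) \<in> B (6 + i)" by (rule B3_b_pow[OF A4_\<alpha>']) (use assms in auto)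
  moreover have "b ^ i * X = (1 / r) *\<^sub>R (\<phi>6 * b ^ i) - \<alpha> ^ 2 * b ^ (2 + i) - (3 * r) *\<^sub>R (\<alpha> ^ 1 * b ^ (4 + i))"
    unfolding X_eq power_add by (simp add: right_diff_distrib mult_ac)
  ultimately show ?thesis by (simp only:) (intro B3_diff B3_scaleR)
qed

lemma b11_B3: "b ^ 11 \<in> B 11"
proof -
  have A: "\<alpha> ^ i * (b ^ j * X) \<in> B 11" if "2 * i + (6 + j) = 11" "j \<le> 6" for i j
    using A4_B3[OF A4_\<alpha>'[of i] B3_b_pow_X[OF that(2)]] that(1) by simp
  have P: "\<alpha> ^ i * b ^ j \<in> B 11" if "2 * i + j = 11" "j \<le> 10" for i j
    by (rule B3_b_pow[OF A4_\<alpha>']) (use that in auto)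
  have "\<phi>10 * b ^ 1 \<in> B 11" by (rule B3_b_pow[OF A4_\<phi>10']) auto
  moreover have "\<phi>6 * bt 11 \<in> B 11" by (rule B3_base[OF A4_\<phi>6']) (auto simp: bd_def)
  ultimately have "3125 *\<^sub>R b ^ 11 \<in> B 11" unfolding b11_eq
    using A[of 2 1] A[of 1 3] A[of 0 5] P[of 4 3] P[of 3 5] P[of 2 7] P[of 1 9]
    by (intro B3_diff B3_add B3_scaleR) (simp_all add: bt_def)
  from B3_scaleR[OF this, of "1 / 3125"] show ?thesis by simp
qed

lemma B_b: assumes "f \<in> B n" shows "b * f \<in> B (Suc n)"
  unfolding B3_def
proof (rule span_mult[OF assms[unfolded B3_def]], fold B3_def)
  fix x assume "x \<in> {f * bt j |f j. j < 12 \<and> bd j \<le> 10 \<and> bd j \<le> n \<and> f \<in> A4 (n - bd j)}"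
  then obtain e j where x: "x = e * bt j" "j < 12" "bd j \<le> n" "e \<in> A4 (n - bd j)" by blast
  consider "j < 10" | "j = 10" | "j = 11" using x(2) by linarith
  then show "b * x \<in> B (Suc n)"
  proof cases
    case 1
    then have "e * b ^ Suc j \<in> B (Suc n)" using x by (intro B3_b_pow[of e "n - j"]) (auto simp: bd_def)
    then show ?thesis using 1 by (simp add: x(1) bt_def mult_ac)
  next
    case 2
    then have "e * b ^ 11 \<in> B (n - 10 + 11)" using x by (intro A4_B3 b11_B3) (auto simp: bd_def)
    moreover have "n - 10 + 11 = Suc n" using 2 x(3) by (simp add: bd_def)
    moreover have "b ^ 11 = b * b ^ 10" using power_Suc[of b 10] by simp
    ultimately show ?thesis using 2 by (simp add: x(1) bt_def mult_ac)
  next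
    case 3
    then have "e * X \<in> B (n - 5 + 6)" using x B3_b_pow_X[of 0] by (intro A4_B3) (auto simp: bd_def)
    then show ?thesis using 3 x(3) by (simp add: x(1) bt_def bd_def X_def mult_ac)
  qed
qed

lemma B_b_pow: "f \<in> B n \<Longrightarrow> b ^ i * f \<in> B (n + i)"
  by (induction i) (auto simp: mult.assoc dest: B_b)

lemma \<sigma>5_square: "\<sigma>5 * \<sigma>5 \<in> B 10"
proof -
  have A: "\<alpha> ^ i * (b ^ j * X) \<in> B 10" if "2 * i + (6 + j) = 10" "j \<le> 6" for i j
    using A4_B3[OF A4_\<alpha>'[of i] B3_b_pow_X[OF that(2)]] that(1) by simp
  have P: "\<alpha> ^ i * b ^ j \<in> B 10" if "2 * i + j = 10" "j \<le> 10" for i j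
    by (rule B3_b_pow[OF A4_\<alpha>']) (use that in auto)
  have f: "\<phi>10 * b ^ 0 \<in> B 10" by (rule B3_b_pow[OF A4_\<phi>10']) auto
  have "(1 / r) *\<^sub>R \<phi>10 = \<alpha> ^ 4 * b ^ 2 + 11 * r *\<^sub>R (\<alpha> ^ 3 * b ^ 4) + 220 * (\<alpha> ^ 2 * b ^ 6) + 500 * r *\<^sub>R (\<alpha> * b ^ 8)
   + 3125 * b ^ 10 - 3 * (\<alpha> ^ 2 * X) - 24 * r *\<^sub>R (\<alpha> * (b ^ 2 * X)) - 250 * (b ^ 4 * X) + \<sigma>5 * \<sigma>5"
    unfolding \<phi>10_eq using r_nz by simp
  then have "\<sigma>5 * \<sigma>5 = (1 / r) *\<^sub>R (\<phi>10 * b ^ 0) - \<alpha> ^ 4 * b ^ 2 - (11 * r) *\<^sub>R (\<alpha> ^ 3 * b ^ 4) - 220 *\<^sub>R (\<alpha> ^ 2 * b ^ 6)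
   - (500 * r) *\<^sub>R (\<alpha> ^ 1 * b ^ 8) - 3125 *\<^sub>R (\<alpha> ^ 0 * b ^ 10) + 3 *\<^sub>R (\<alpha> ^ 2 * (b ^ 0 * X)) + (24 * r) *\<^sub>R (\<alpha> ^ 1 * (b ^ 2 * X))
   + 250 *\<^sub>R (\<alpha> ^ 0 * (b ^ 4 * X))"
    by (simp add: scaleR_conv_of_real algebra_simps)
  also have "\<dots> \<in> B 10" using f by (intro B3_diff B3_add B3_scaleR A P) simp_all
  finally show ?thesis .
qed

lemma B_\<sigma>5: assumes "f \<in> B n" shows "\<sigma>5 * f \<in> B (n + 5)"
  unfolding B3_def
proof (rule span_mult[OF assms[unfolded B3_def]], fold B3_def)
  fix x assume "x \<in> {f * bt j |f j. j < 12 \<and> bd j \<le> 10 \<and> bd j \<le> n \<and> f \<in> A4 (n - bd j)}"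
  then obtain e j where x: "x = e * bt j" "j < 12" "bd j \<le> n" "e \<in> A4 (n - bd j)" by blast
  consider "j = 0" | i where "j = Suc i" "j \<le> 10" | "j = 11" using x(2) by (cases j) force+
  then show "\<sigma>5 * x \<in> B (n + 5)"
  proof cases
    case 1
    then have "e * bt 11 \<in> B (n + 5)" using x by (intro B3_base[of e n]) (auto simp: bd_def)
    then show ?thesis using 1 by (simp add: x(1) bt_def mult_ac)
  next
    case 2
    then have "e * (b ^ i * X) \<in> B (n - j + (6 + i))"
      using x 2 B_b_pow[OF B3_mono[OF X_B3, of 10], of i]
      by (intro A4_B3[of e "n - j" "b ^ i * X" 10 "6 + i"]) (auto simp: bd_def)
    moreover have "\<sigma>5 * x = e * (b ^ i * X)" using 2 by (simp add: x(1) bt_def X_def mult_ac)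
    moreover have "n - j + (6 + i) = n + 5" using 2 x(3) by (simp add: bd_def)
    ultimately show ?thesis by simp
  next
    case 3
    then have "e * (\<sigma>5 * \<sigma>5) \<in> B (n - 5 + 10)" using x by (intro A4_B3 \<sigma>5_square) (auto simp: bd_def)
    then show ?thesis using 3 x(3) by (simp add: x(1) bt_def bd_def mult_ac add.commute)
  qed
qed

lemma B_g: assumes "f \<in> B n" shows "g * f \<in> B (n + 5)"
proof -
  have "g * f = \<sigma>5 * f - 11 *\<^sub>R (b ^ 5 * f)" by (simp add: \<sigma>5_def scaleR_conv_of_real algebra_simps)
  also have "\<dots> \<in> B (n + 5)" by (intro B3_diff B3_scaleR B_\<sigma>5 B_b_pow assms)
  finally show ?thesis .
qed

lemma B_\<alpha>: "f \<in> B n \<Longrightarrow> \<alpha> * f \<in> B (n + 2)"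
  using A4_B3[OF A4_\<alpha>'[of 1]] by (simp add: add.commute)

lemma B_a: "f \<in> B n \<Longrightarrow> a * f \<in> B (Suc n)"
  using A4_B3[OF A4_a[OF A4_1]] by simp

lemma B_S: assumes "f \<in> B n" shows "S * f \<in> B (n + 2)"
proof -
  have "S * f = \<alpha> * f + r *\<^sub>R (b ^ 2 * f)" unfolding S_eq r_T by (simp add: scaleR_conv_of_real distrib_right mult.assoc)
  then show ?thesis using B_\<alpha>[OF assms] B_b_pow[OF assms, of 2] by (simp add: B3_add B3_scaleR)
qed

text \<open>The stage of \<open>c\<close>: the quintic form \<open>g\<close> reduces \<open>c ^ 5\<close>.\<close>

definition C2 :: "nat \<Rightarrow> 'a set" where
  "C2 n = span ({f * c ^ j | f j. j \<le> 4 \<and> j \<le> n \<and> f \<in> B (n - j)} \<union> J)"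

lemma subspace_C2: "subspace (C2 n)" by (simp add: C2_def subspace_span)
lemma C2_diff: "f \<in> C2 n \<Longrightarrow> h \<in> C2 n \<Longrightarrow> f - h \<in> C2 n" by (rule subspace_diff[OF subspace_C2])
lemma C2_scaleR: "f \<in> C2 n \<Longrightarrow> q *\<^sub>R f \<in> C2 n" by (rule subspace_scale[OF subspace_C2])
lemma C2_base: "f \<in> B m \<Longrightarrow> j \<le> 4 \<Longrightarrow> n = m + j \<Longrightarrow> f * c ^ j \<in> C2 n"
  unfolding C2_def by (intro span_base) (auto intro!: exI[of _ f] exI[of _ j])

lemma C2_closed:
  assumes "\<And>f n. f \<in> B n \<Longrightarrow> h * f \<in> B (n + e)" "f \<in> C2 n" shows "h * f \<in> C2 (n + e)"
  unfolding C2_def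
proof (rule span_mult[OF assms(2)[unfolded C2_def]], fold C2_def)
  fix x assume "x \<in> {f * c ^ j |f j. j \<le> 4 \<and> j \<le> n \<and> f \<in> B (n - j)}"
  then obtain f j where x: "x = f * c ^ j" "j \<le> 4" "j \<le> n" "f \<in> B (n - j)" by blast
  have "(h * f) * c ^ j \<in> C2 (n + e)" by (rule C2_base[OF assms(1)[OF x(4)]]) (use x in auto)
  then show "h * x \<in> C2 (n + e)" by (simp add: x(1) mult.assoc)
qed

lemma C2_a: "f \<in> C2 n \<Longrightarrow> a * f \<in> C2 (Suc n)" using C2_closed[of a 1] B_a by simp
lemma C2_b: "f \<in> C2 n \<Longrightarrow> b * f \<in> C2 (Suc n)" using C2_closed[of b 1] B_b by simp

lemma c5_cong: "32 *\<^sub>R c ^ 5 \<approx> g - (8 * r) *\<^sub>R (S * c ^ 3) - 2 *\<^sub>R (S * (S * c))"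
proof -
  have GS: "- G \<approx> S" using SG subspace_neg[OF J_subspace, of "S + G"] by (simp add: cong_def algebra_simps)
  have "g = 32 * c ^ 5 + (8 - 16 * T) * c ^ 3 * G + 2 * c * G ^ 2"
    by (simp add: g_def quint_def G_def zev_simps[OF T] zev_zpoly)
  then have e: "32 *\<^sub>R c ^ 5 = g - (8 * r) *\<^sub>R ((- G) * c ^ 3) - 2 *\<^sub>R ((- G) * ((- G) * c))"
    by (simp add: scaleR_conv_of_real algebra_simps power2_eq_square)
  have m: "q *\<^sub>R f \<approx> q *\<^sub>R h" if "f \<approx> h" for q f h
    using that subspace_scale[OF J_subspace] by (simp add: cong_def scaleR_diff_right[symmetric])
  have n: "f \<approx> h \<Longrightarrow> f' \<approx> h' \<Longrightarrow> f - f' \<approx> h - h'" for f h f' h'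
    using subspace_diff[OF J_subspace, of "f - h" "f' - h'"] by (simp add: cong_def algebra_simps)
  show ?thesis unfolding e by (intro n m cong_mult GS cong_refl)
qed

lemma C2_c: assumes "f \<in> C2 n" shows "c * f \<in> C2 (Suc n)"
  unfolding C2_def
proof (rule span_mult[OF assms[unfolded C2_def]], fold C2_def)
  fix x assume "x \<in> {f * c ^ j |f j. j \<le> 4 \<and> j \<le> n \<and> f \<in> B (n - j)}"
  then obtain f j where x: "x = f * c ^ j" "j \<le> 4" "j \<le> n" "f \<in> B (n - j)" by blast
  show "c * x \<in> C2 (Suc n)"
  proof (cases "j < 4")
    case True
    have "f * c ^ Suc j \<in> C2 (Suc n)" by (rule C2_base[OF x(4)]) (use x True in auto)
    then show ?thesis by (simp add: x(1) mult_ac)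
  next
    case False
    then have j: "j = 4" using x by simp
    have "f * (32 *\<^sub>R c ^ 5) \<approx> f * (g - (8 * r) *\<^sub>R (S * c ^ 3) - 2 *\<^sub>R (S * (S * c)))"
      by (intro cong_mult c5_cong cong_refl)
    also have "f * (g - (8 * r) *\<^sub>R (S * c ^ 3) - 2 *\<^sub>R (S * (S * c))) =
        (g * f) * c ^ 0 - (8 * r) *\<^sub>R ((S * f) * c ^ 3) - 2 *\<^sub>R ((S * (S * f)) * c ^ 1)"
      by (simp add: right_diff_distrib mult_ac)
    finally have 1: "f * (32 *\<^sub>R c ^ 5) \<approx> (g * f) * c ^ 0 - (8 * r) *\<^sub>R ((S * f) * c ^ 3) - 2 *\<^sub>R ((S * (S * f)) * c ^ 1)" .
    have "(g * f) * c ^ 0 \<in> C2 (Suc n)" by (rule C2_base[OF B_g[OF x(4)]]) (use x j in auto)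
    moreover have "(S * f) * c ^ 3 \<in> C2 (Suc n)" by (rule C2_base[OF B_S[OF x(4)]]) (use x j in auto)
    moreover have "(S * (S * f)) * c ^ 1 \<in> C2 (Suc n)" by (rule C2_base[OF B_S[OF B_S[OF x(4)]]]) (use x j in auto)
    ultimately have "(g * f) * c ^ 0 - (8 * r) *\<^sub>R ((S * f) * c ^ 3) - 2 *\<^sub>R ((S * (S * f)) * c ^ 1) \<in> C2 (Suc n)"
      by (intro C2_diff C2_scaleR)
    then have "f * (32 *\<^sub>R c ^ 5) \<in> C2 (Suc n)" using span_cong[OF 1] unfolding C2_def by blast
    from C2_scaleR[OF this, of "1 / 32"] show ?thesis by (simp add: x(1) j mult_ac eval_nat_numeral)
  qed
qed

lemma d2_cong: "\<tau> *\<^sub>R d ^ 2 \<approx> (- \<tau>) *\<^sub>R (a * a) - r *\<^sub>R (b * b) - r *\<^sub>R (c * c)"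
proof -
  have "S = \<tau> *\<^sub>R (a * a) + r *\<^sub>R (b * b)" unfolding S_eq r_T by (simp add: \<alpha>_def scaleR_conv_of_real power2_eq_square)
  moreover have "G = \<tau> *\<^sub>R (d ^ 2) + r *\<^sub>R (c * c)"
    by (simp add: G_def quad_def zev_zpoly scaleR_conv_of_real power2_eq_square)
  moreover have "x - ((- \<tau>) *\<^sub>R y - z - w) = (\<tau> *\<^sub>R y + z) + (x + w)" for x y z w :: 'a by simp
  ultimately have "\<tau> *\<^sub>R d ^ 2 - ((- \<tau>) *\<^sub>R (a * a) - r *\<^sub>R (b * b) - r *\<^sub>R (c * c)) = S + G" by simp
  then show ?thesis using SG by (simp only: cong_def)
qed

lemma C2_d2: assumes "f \<in> C2 n" shows "d ^ 2 * f \<in> C2 (n + 2)"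
proof -
  have "\<tau> *\<^sub>R d ^ 2 * f \<approx> ((- \<tau>) *\<^sub>R (a * a) - r *\<^sub>R (b * b) - r *\<^sub>R (c * c)) * f" by (intro cong_mult d2_cong cong_refl)
  also have "((- \<tau>) *\<^sub>R (a * a) - r *\<^sub>R (b * b) - r *\<^sub>R (c * c)) * f =
     (- \<tau>) *\<^sub>R (a * (a * f)) - r *\<^sub>R (b * (b * f)) - r *\<^sub>R (c * (c * f))" by (simp add: left_diff_distrib mult.assoc)
  finally have 1: "\<tau> *\<^sub>R d ^ 2 * f \<approx> (- \<tau>) *\<^sub>R (a * (a * f)) - r *\<^sub>R (b * (b * f)) - r *\<^sub>R (c * (c * f))" .
  have "(- \<tau>) *\<^sub>R (a * (a * f)) - r *\<^sub>R (b * (b * f)) - r *\<^sub>R (c * (c * f)) \<in> C2 (Suc (Suc n))"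
    by (intro C2_diff C2_scaleR C2_a C2_b C2_c assms)
  then have "\<tau> *\<^sub>R d ^ 2 * f \<in> C2 (n + 2)" using span_cong[OF 1] unfolding C2_def by simp
  from C2_scaleR[OF this, of "1 / \<tau>"] show ?thesis using \<tau>_nz by simp
qed

text \<open>The stage of \<open>d\<close>: the quadratic form reduces \<open>d\<^sup>2\<close>. The stage is closed under all four variables, hence contains everything.\<close>

definition D1 :: "nat \<Rightarrow> 'a set" where
  "D1 n = span ({f * d ^ e | f e. e \<le> 1 \<and> e \<le> n \<and> f \<in> C2 (n - e)} \<union> J)"

lemma subspace_D1: "subspace (D1 n)" by (simp add: D1_def subspace_span)
lemma D1_base: "f \<in> C2 m \<Longrightarrow> e \<le> 1 \<Longrightarrow> n = m + e \<Longrightarrow> f * d ^ e \<in> D1 n"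
  unfolding D1_def by (intro span_base) (auto intro!: exI[of _ f] exI[of _ e])

lemma D1_closed:
  assumes "\<And>f n. f \<in> C2 n \<Longrightarrow> h * f \<in> C2 (Suc n)" "f \<in> D1 n" shows "h * f \<in> D1 (Suc n)"
  unfolding D1_def
proof (rule span_mult[OF assms(2)[unfolded D1_def]], fold D1_def)
  fix x assume "x \<in> {f * d ^ e |f e. e \<le> 1 \<and> e \<le> n \<and> f \<in> C2 (n - e)}"
  then obtain f e where x: "x = f * d ^ e" "e \<le> 1" "e \<le> n" "f \<in> C2 (n - e)" by blast
  have "(h * f) * d ^ e \<in> D1 (Suc n)" by (rule D1_base[OF assms(1)[OF x(4)]]) (use x in auto)
  then show "h * x \<in> D1 (Suc n)" by (simp add: x(1) mult.assoc)
qed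

lemma D1_a: "f \<in> D1 n \<Longrightarrow> a * f \<in> D1 (Suc n)" by (rule D1_closed[OF C2_a])
lemma D1_b: "f \<in> D1 n \<Longrightarrow> b * f \<in> D1 (Suc n)" by (rule D1_closed[OF C2_b])
lemma D1_c: "f \<in> D1 n \<Longrightarrow> c * f \<in> D1 (Suc n)" by (rule D1_closed[OF C2_c])

lemma D1_d: assumes "f \<in> D1 n" shows "d * f \<in> D1 (Suc n)"
  unfolding D1_def
proof (rule span_mult[OF assms[unfolded D1_def]], fold D1_def)
  fix x assume "x \<in> {f * d ^ e |f e. e \<le> 1 \<and> e \<le> n \<and> f \<in> C2 (n - e)}"
  then obtain f e where x: "x = f * d ^ e" "e \<le> 1" "e \<le> n" "f \<in> C2 (n - e)" by blast
  show "d * x \<in> D1 (Suc n)"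
  proof (cases "e = 0")
    case True
    have "f * d ^ 1 \<in> D1 (Suc n)" by (rule D1_base[OF x(4)]) (use x True in auto)
    then show ?thesis using True by (simp add: x(1) mult.commute)
  next
    case False
    then have e: "e = 1" using x by simp
    have "(d ^ 2 * f) * d ^ 0 \<in> D1 (Suc n)" by (rule D1_base[OF C2_d2[OF x(4)]]) (use x e in auto)
    then show ?thesis using e by (simp add: x(1) power2_eq_square mult_ac)
  qed
qed

lemma D1_1: "1 \<in> D1 0"
proof -
  have "1 * b ^ 0 \<in> B 0" by (rule B3_b_pow[OF A4_1]) auto
  then have "(1 * b ^ 0) * c ^ 0 \<in> C2 0" by (intro C2_base) auto
  then have "(1 * b ^ 0) * c ^ 0 * d ^ 0 \<in> D1 0" by (intro D1_base) auto
  then show ?thesis by simp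
qed

end


section \<open>The string basis\<close>

context h4_relations
begin

definition vars :: "4 \<Rightarrow> 'a" where
  "vars v = (if v = 1 then d else if v = 2 then c else if v = 3 then b else a)"
text \<open>Each weight exceeds the largest weight that the later variables can accumulate: 10 along \<open>b\<close>, and \<open>10 + 4 * 11 = 54\<close> along \<open>b\<close> and \<open>c\<close>.\<close>

definition weights :: "4 \<Rightarrow> nat" where
  "weights v = (if v = 1 then 55 else if v = 2 then 11 else if v = 3 then 1 else 0)"
definition tops :: "(nat \<times> nat) set" where "tops = {..<4} \<times> {..<2}"
definition top_elt :: "nat \<times> nat \<Rightarrow> 'a" where "top_elt i = \<sigma> (fst i) * (if snd i = 0 then 1 else \<sigma>5)"
definition sides :: "nat \<times> nat \<Rightarrow> 4 \<Rightarrow> nat" where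
  "sides i v = (if v = 1 then 2 else if v = 2 then 5 else if v = 3 then (if snd i = 0 then 11 else 1) else string_length ! fst i)"
definition top_deg :: "nat \<times> nat \<Rightarrow> nat" where "top_deg i = string_degree ! fst i + 5 * snd i"
definition top_wt :: "nat \<times> nat \<Rightarrow> nat" where "top_wt i = 5 * snd i"

lemma all4: "(\<forall>v::4. P v) \<longleftrightarrow> P 1 \<and> P 2 \<and> P 3 \<and> P 4"
proof
  assume *: "P 1 \<and> P 2 \<and> P 3 \<and> P 4"
  show "\<forall>v. P v"
  proof
    fix v :: 4
    have "v \<in> {1, 2, 3, 4}" unfolding UNIV_4[symmetric] by simp
    then show "P v" using * by blast
  qed
qed blast

lemma sum4: "(\<Sum>v\<in>(UNIV::4 set). f v) = f 1 + f 2 + f 3 + f 4"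
  unfolding UNIV_4 by (simp add: add.assoc)

lemma prod4: "(\<Prod>v\<in>(UNIV::4 set). f v) = f 1 * f 2 * f 3 * f 4"
  unfolding UNIV_4 by (simp add: mult.assoc)

sublocale string_basis J vars weights tops top_elt sides top_deg top_wt 60
proof
  show "subspace J" by (rule J_subspace)
  show "f * j \<in> J" if "j \<in> J" for f j using J_mult[OF that] .
  show "finite tops" by (simp add: tops_def)
  show "2 * top_deg i + sum (sides i) UNIV = 60 + CARD(4)" if "i \<in> tops" for i
  proof -
    obtain s t where i: "i = (s, t)" by (cases i)
    then have "s = 0 \<or> s = 1 \<or> s = 2 \<or> s = 3" "t = 0 \<or> t = 1" using that by (auto simp: tops_def)
    then show ?thesis by (auto simp: i top_deg_def sum4 sides_def string_length_def string_degree_def)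
  qed
qed

definition mk :: "nat \<Rightarrow> nat \<Rightarrow> nat \<Rightarrow> nat \<Rightarrow> 4 \<Rightarrow> nat" where
  "mk n1 n2 n3 n4 v = (if v = 1 then n1 else if v = 2 then n2 else if v = 3 then n3 else n4)"

lemma mk_eq: "p = mk (p 1) (p 2) (p 3) (p 4)"
proof (rule ext)
  have "\<forall>v. p v = mk (p 1) (p 2) (p 3) (p 4) v" unfolding all4 by (simp add: mk_def)
  then show "p v = mk (p 1) (p 2) (p 3) (p 4) v" for v by (rule spec)
qed

lemma elt_mk: "elt ((s, t), mk n1 n2 n3 n4) = a ^ n4 * \<sigma> s * ((if t = 0 then 1 else \<sigma>5) * b ^ n3) * c ^ n2 * d ^ n1"
  by (simp add: elt_def prod4 vars_def mk_def top_elt_def mult_ac)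

lemma deg_mk: "deg ((s, t), mk n1 n2 n3 n4) = string_degree ! s + 5 * t + n1 + n2 + n3 + n4"
  by (simp add: deg_def sum4 mk_def top_deg_def)

lemma wt_mk: "wt ((s, t), mk n1 n2 n3 n4) = 5 * t + 55 * n1 + 11 * n2 + n3"
  by (simp add: wt_def sum4 mk_def top_wt_def weights_def)

lemma idx_mk: "((s, t), mk n1 n2 n3 n4) \<in> idx n \<longleftrightarrow> s < 4 \<and> t < 2 \<and> n1 < 2 \<and> n2 < 5 \<and>
   n3 < (if t = 0 then 11 else 1) \<and> n4 < string_length ! s \<and> string_degree ! s + 5 * t + n1 + n2 + n3 + n4 = n"
  unfolding idx_def all4 by (auto simp: deg_mk tops_def sides_def mk_def)

lemma elt_in_span: "q \<in> idx n \<Longrightarrow> wt q \<le> w \<Longrightarrow> elt q \<in> span (elt ` {q \<in> idx n. wt q \<le> w} \<union> J)"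
  by (intro span_base) auto

lemma A4_in_span:
  assumes "f \<in> A4 m" "j < 12" "l < 5" "e < 2"
  shows "bt j * c ^ l * d ^ e * f \<in> span (elt ` {q \<in> idx (m + bd j + l + e). wt q \<le> bd j + 11 * l + 55 * e} \<union> J)"
proof (rule span_mult[OF assms(1)[unfolded A4_def]])
  fix x assume "x \<in> {a ^ p * \<sigma> s |p s. s < 4 \<and> p < string_length ! s \<and> p + string_degree ! s = m}"
  then obtain p s where x: "x = a ^ p * \<sigma> s" "s < 4" "p < string_length ! s" "p + string_degree ! s = m" by blast
  define q where "q = (if j \<le> 10 then ((s, 0), mk e l j p) else ((s, 1::nat), mk e l 0 p))"
  have "bt j * c ^ l * d ^ e * x = elt q" by (simp add: q_def elt_mk bt_def x(1) mult_ac)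
  moreover have "q \<in> idx (m + bd j + l + e)" using x assms by (simp add: q_def idx_mk bd_def)
  moreover have "wt q \<le> bd j + 11 * l + 55 * e" by (simp add: q_def wt_mk bd_def)
  ultimately show "bt j * c ^ l * d ^ e * x \<in> span (elt ` {q \<in> idx (m + bd j + l + e). wt q \<le> bd j + 11 * l + 55 * e} \<union> J)"
    using elt_in_span by simp
qed

lemma idx_mono: "w \<le> w' \<Longrightarrow> f \<in> span (elt ` {q \<in> idx n. wt q \<le> w} \<union> J) \<Longrightarrow> f \<in> span (elt ` {q \<in> idx n. wt q \<le> w'} \<union> J)"
  by (erule span_mono') (auto intro: order_trans)

lemma B3_in_span:
  assumes "f \<in> B3 u m" "l < 5" "e < 2"
  shows "c ^ l * d ^ e * f \<in> span (elt ` {q \<in> idx (m + l + e). wt q \<le> u + 11 * l + 55 * e} \<union> J)"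
proof (rule span_mult[OF assms(1)[unfolded B3_def]])
  fix x assume "x \<in> {f * bt j |f j. j < 12 \<and> bd j \<le> u \<and> bd j \<le> m \<and> f \<in> A4 (m - bd j)}"
  then obtain f j where x: "x = f * bt j" "j < 12" "bd j \<le> u" "bd j \<le> m" "f \<in> A4 (m - bd j)" by blast
  have "bt j * c ^ l * d ^ e * f \<in> span (elt ` {q \<in> idx (m - bd j + bd j + l + e). wt q \<le> bd j + 11 * l + 55 * e} \<union> J)"
    by (rule A4_in_span[OF x(5,2) assms(2,3)])
  moreover have "bt j * c ^ l * d ^ e * f = c ^ l * d ^ e * x" by (simp add: x(1) mult_ac)
  ultimately show "c ^ l * d ^ e * x \<in> span (elt ` {q \<in> idx (m + l + e). wt q \<le> u + 11 * l + 55 * e} \<union> J)"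
    using x(3,4) by (intro idx_mono[of "bd j + 11 * l + 55 * e" "u + 11 * l + 55 * e"]) auto
qed

lemma C2_in_span:
  assumes "f \<in> C2 m" "e < 2"
  shows "d ^ e * f \<in> span (elt ` {q \<in> idx (m + e). wt q \<le> 54 + 55 * e} \<union> J)"
proof (rule span_mult[OF assms(1)[unfolded C2_def]])
  fix x assume "x \<in> {f * c ^ j |f j. j \<le> 4 \<and> j \<le> m \<and> f \<in> B (m - j)}"
  then obtain f j where x: "x = f * c ^ j" "j \<le> 4" "j \<le> m" "f \<in> B (m - j)" by blast
  have "c ^ j * d ^ e * f \<in> span (elt ` {q \<in> idx (m - j + j + e). wt q \<le> 10 + 11 * j + 55 * e} \<union> J)"
    by (rule B3_in_span[OF x(4) _ assms(2)]) (use x in simp)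
  moreover have "c ^ j * d ^ e * f = d ^ e * x" by (simp add: x(1) mult_ac)
  ultimately show "d ^ e * x \<in> span (elt ` {q \<in> idx (m + e). wt q \<le> 54 + 55 * e} \<union> J)"
    using x(2,3) by (intro idx_mono[of "10 + 11 * j + 55 * e" "54 + 55 * e"]) auto
qed

lemma D1_in_span:
  assumes "f \<in> D1 m" shows "f \<in> span (elt ` idx m \<union> J)"
proof -
  have "1 * f \<in> span (elt ` idx m \<union> J)"
  proof (rule span_mult[OF assms(1)[unfolded D1_def]])
    fix x assume "x \<in> {f * d ^ e |f e. e \<le> 1 \<and> e \<le> m \<and> f \<in> C2 (m - e)}"
    then obtain f e where x: "x = f * d ^ e" "e \<le> 1" "e \<le> m" "f \<in> C2 (m - e)" by blast
    have e: "e < 2" "m - e + e = m" using x(2,3) by simp_all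
    have eq: "1 * x = d ^ e * f" unfolding x(1) by (simp only: mult_1_left mult.commute)
    have "d ^ e * f \<in> span (elt ` {q \<in> idx m. wt q \<le> 54 + 55 * e} \<union> J)"
      using C2_in_span[OF x(4) e(1)] unfolding e(2) .
    then show "1 * x \<in> span (elt ` idx m \<union> J)" unfolding eq
      by (rule span_mono') (rule image_mono, rule Collect_restrict)
  qed
  then show ?thesis by (simp only: mult_1_left)
qed

lemma le_less: "w < w' \<Longrightarrow> f \<in> span (elt ` {q \<in> idx n. wt q \<le> w} \<union> J) \<Longrightarrow> f \<in> span (elt ` {q \<in> idx n. wt q < w'} \<union> J)"
  by (erule span_mono') auto

sublocale straightened_string_basis J vars weights tops top_elt sides top_deg top_wt 60
proof
  fix i p v assume i: "i \<in> tops" and p: "\<forall>j. p j < sides i j" and top: "Suc (p v) = sides i v"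
  obtain s t where st: "i = (s, t)" by (cases i)
  define n1 n2 n3 n4 where n: "n1 = p 1" "n2 = p 2" "n3 = p 3" "n4 = p 4"
  have pm: "p = mk n1 n2 n3 n4" unfolding n by (rule mk_eq)
  have b: "s < 4" "t < 2" "n1 < 2" "n2 < 5" "n3 < (if t = 0 then 11 else 1)" "n4 < string_length ! s"
    using i p unfolding all4 by (auto simp: st tops_def sides_def n)
  have \<sigma>A: "a ^ n4 * \<sigma> s \<in> A4 (n4 + string_degree ! s)" using a_pow_\<sigma>_A4[OF b(1)] .
  define j where "j = (if t = 0 then n3 else 11)"
  have j: "j < 12" "bd j = 5 * t + n3" "bt j = (if t = 0 then 1 else \<sigma>5) * b ^ n3"
    using b by (auto simp: j_def bd_def bt_def split: if_splits)
  have E: "elt (i, p) = a ^ n4 * \<sigma> s * bt j * c ^ n2 * d ^ n1" unfolding st pm elt_mk j(3) by simp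
  have dg: "deg (i, p) = n4 + string_degree ! s + bd j + n2 + n1" unfolding st pm deg_mk j(2) by simp
  have w: "wt (i, p) = bd j + 11 * n2 + 55 * n1" unfolding st pm wt_mk j(2) by simp
  consider "v = 1" | "v = 2" | "v = 3" | "v = 4" using all4[of "\<lambda>w. w = 1 \<or> w = 2 \<or> w = 3 \<or> w = 4"] by blast
  then show "vars v * elt (i, p) \<in> span (elt ` {q \<in> idx (Suc (deg (i, p))). wt q < wt (i, p) + weights v} \<union> J)"
  proof cases
    case 1
    then have n1: "n1 = 1" using top by (simp add: st sides_def n)
    have "(a ^ n4 * \<sigma> s) * bt j \<in> B (n4 + string_degree ! s + bd j)"
      by (rule B3_base[OF \<sigma>A j(1)]) (use b j in \<open>auto split: if_splits\<close>)
    then have "((a ^ n4 * \<sigma> s) * bt j) * c ^ n2 \<in> C2 (n4 + string_degree ! s + bd j + n2)"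
      using b by (intro C2_base) auto
    from C2_in_span[OF C2_d2[OF this], of 0]
    have "d ^ 2 * ((a ^ n4 * \<sigma> s) * bt j * c ^ n2) \<in> span (elt ` {q \<in> idx (Suc (deg (i, p))). wt q \<le> 54} \<union> J)"
      by (simp add: dg n1)
    moreover have "vars v * elt (i, p) = d ^ 2 * ((a ^ n4 * \<sigma> s) * bt j * c ^ n2)"
      using 1 by (simp add: vars_def E n1 power2_eq_square mult_ac)
    ultimately show ?thesis using 1 by (intro le_less[of 54]) (simp_all add: w n1 weights_def)
  next
    case 2
    then have n2: "n2 = 4" using top by (simp add: st sides_def n)
    have "(a ^ n4 * \<sigma> s) * bt j \<in> B (n4 + string_degree ! s + bd j)"
      by (rule B3_base[OF \<sigma>A j(1)]) (use b j in \<open>auto split: if_splits\<close>)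
    then have "((a ^ n4 * \<sigma> s) * bt j) * c ^ 4 \<in> C2 (n4 + string_degree ! s + bd j + 4)"
      by (intro C2_base) auto
    from C2_in_span[OF C2_c[OF this] b(3)]
    have "d ^ n1 * (c * ((a ^ n4 * \<sigma> s) * bt j * c ^ 4)) \<in> span (elt ` {q \<in> idx (Suc (deg (i, p))). wt q \<le> 54 + 55 * n1} \<union> J)"
      by (simp add: dg n2 add_ac)
    moreover have "vars v * elt (i, p) = d ^ n1 * (c * ((a ^ n4 * \<sigma> s) * bt j * c ^ 4))"
      using 2 by (simp add: vars_def E n2 mult_ac)
    ultimately show ?thesis using 2 by (intro le_less[of "54 + 55 * n1"]) (simp_all add: w n2 weights_def)
  next
    case 3
    define u where "u = (if t = 0 then 10 else 4 :: nat)"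
    have t3: "b * bt j \<in> B3 u (bd j + 1)" "u \<le> bd j"
    proof -
      have n3: "n3 = (if t = 0 then 10 else 0)" using 3 top by (auto simp: st sides_def n split: if_splits)
      show "b * bt j \<in> B3 u (bd j + 1)"
      proof (cases "t = 0")
        case True
        then show ?thesis using b11_B3 n3 power_Suc[of b 10] by (simp add: j j_def bd_def bt_def u_def)
      next
        case False
        then have "bd j + 1 = 6" "b * bt j = X" using n3 b by (simp_all add: j_def bd_def bt_def X_def)
        then show ?thesis using X_B3 False by (simp add: u_def)
      qed
      show "u \<le> bd j" using n3 b by (auto simp: u_def j_def bd_def)
    qed
    have "(a ^ n4 * \<sigma> s) * (b * bt j) \<in> B3 u (n4 + string_degree ! s + (bd j + 1))" by (rule A4_B3[OF \<sigma>A t3(1)])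
    from B3_in_span[OF this b(4,3)]
    have "c ^ n2 * d ^ n1 * ((a ^ n4 * \<sigma> s) * (b * bt j)) \<in>
      span (elt ` {q \<in> idx (Suc (deg (i, p))). wt q \<le> u + 11 * n2 + 55 * n1} \<union> J)"
      by (simp add: dg)
    moreover have "vars v * elt (i, p) = c ^ n2 * d ^ n1 * ((a ^ n4 * \<sigma> s) * (b * bt j))"
      using 3 by (simp add: vars_def E mult_ac)
    ultimately show ?thesis using 3 t3(2) by (intro le_less[of "u + 11 * n2 + 55 * n1"]) (simp_all add: w weights_def)
  next
    case 4
    then have "Suc n4 = string_length ! s" using top by (simp add: st sides_def n)
    then have "a ^ Suc n4 * \<sigma> s \<in> J" using string_end[OF b(1)] by simp
    then have "(bt j * c ^ n2 * d ^ n1) * (a ^ Suc n4 * \<sigma> s) \<in> J" by (rule J_mult)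
    moreover have "vars v * elt (i, p) = (bt j * c ^ n2 * d ^ n1) * (a ^ Suc n4 * \<sigma> s)"
      using 4 by (simp add: vars_def E mult_ac)
    ultimately show ?thesis by (simp add: span_J)
  qed
qed

end


section \<open>Coordinates of the roots\<close>

type_synonym lform = "(int \<times> int) list"

fun neg :: "int \<times> int \<Rightarrow> int \<times> int" where "neg (u, v) = (- u, - v)"
text \<open>Multiplication of \<open>u + v * \<tau>\<close> by \<open>1 / \<tau> = \<tau> - 1\<close>.\<close>

fun mul_inv_tau :: "int \<times> int \<Rightarrow> int \<times> int" where "mul_inv_tau (u, v) = (v - u, u)"
fun pls :: "int \<times> int \<Rightarrow> int \<times> int \<Rightarrow> int \<times> int" where "pls (u, v) (u', v') = (u + u', v + v')"

fun lin_val :: "'a::comm_ring_1 \<Rightarrow> 'a list \<Rightarrow> lform \<Rightarrow> 'a" where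
  "lin_val T (x # xs) ((u, v) # ps) = (of_int u + of_int v * T) * x + lin_val T xs ps"
| "lin_val T _ _ = 0"

definition pentv :: "lform list" where
  "pentv = [[(0, 0), (2, 0)], [(0, 1), (-1, 1)], [(0, -1), (-1, 1)], [(1, 0), (0, -1)], [(-1, 0), (0, -1)]]"
definition pentv' :: "lform list" where
  "pentv' = [[(2, 0), (0, 0)], [(-1, 1), (-1, 2)], [(-1, 1), (1, -2)], [(0, 1), (3, -1)], [(0, 1), (-3, 1)]]"

text \<open>The linear forms of \<open>inv_sum\<close> in the coordinates \<open>[a, b, c, d]\<close>; the second plane is written in the order \<open>d, c\<close>, hence the reversals.\<close>

definition inv_forms :: "lform list" where
  "inv_forms = concat (map (\<lambda>z. map (\<lambda>w. z @ rev (map mul_inv_tau w)) pentv) pentv) @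
     concat (map (\<lambda>z. map (\<lambda>w. map (neg \<circ> mul_inv_tau) z @ rev w) pentv) pentv) @
     map (\<lambda>z. z @ [(0, 0), (0, 0)]) pentv' @ map (\<lambda>w. (0, 0) # (0, 0) # rev w) pentv'"

definition even_triples :: "(nat \<times> nat \<times> nat) list" where
  "even_triples = [(0,1,2),(0,2,3),(0,3,1),(1,0,3),(1,2,0),(1,3,2),(2,0,1),(2,1,3),(2,3,0),(3,0,2),(3,1,0),(3,2,1)]"

text \<open>The positive roots in the original coordinates.\<close>

definition root_forms :: "lform list" where
  "root_forms = map (\<lambda>i. [(0,0),(0,0),(0,0),(0,0)][i := (2, 0)]) [0,1,2,3] @
     concat (map (\<lambda>a. concat (map (\<lambda>b. map (\<lambda>c. [(1, 0), (a, 0), (b, 0), (c, 0)]) [1, -1]) [1, -1])) [1, -1]) @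
     concat (map (\<lambda>(i, j, k). concat (map (\<lambda>a. map (\<lambda>b. [(0,0),(0,0),(0,0),(0,0)][i := (0, a), j := (- b, b), k := (1, 0)]) [1, -1]) [1, -1])) even_triples)"

fun change_coords :: "lform \<Rightarrow> lform" where
  "change_coords [r1, r2, r3, r4] = [r4, pls r1 (mul_inv_tau r2), pls (mul_inv_tau r1) (neg r2), r3]"
| "change_coords _ = []"

text \<open>Even powers ignore signs, so that the two lists of roots are compared after making the leading coefficient positive.\<close>

fun normalize_sign :: "lform \<Rightarrow> lform" where
  "normalize_sign [] = []"
| "normalize_sign ((u, v) # ps) = (if u > 0 \<or> u = 0 \<and> v > 0 then (u, v) # ps
     else if u = 0 \<and> v = 0 then (u, v) # normalize_sign ps else map neg ((u, v) # ps))"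

lemma distinct_root_forms: "distinct (map (normalize_sign \<circ> change_coords) root_forms)"
  by code_simp

lemma distinct_inv_forms: "distinct (map normalize_sign inv_forms)"
  by code_simp

lemma roots_eq_inv_forms: "list_all (\<lambda>L. L \<in> set (map normalize_sign inv_forms)) (map (normalize_sign \<circ> change_coords) root_forms)"
    "length root_forms = length inv_forms" "list_all (\<lambda>L. length L = 4) root_forms" "list_all (\<lambda>L. length L = 4) inv_forms"
  by code_simp+

lemma mset_roots: "mset (map (normalize_sign \<circ> change_coords) root_forms) = mset (map normalize_sign inv_forms)"
proof -
  have sub: "set (map (normalize_sign \<circ> change_coords) root_forms) \<subseteq> set (map normalize_sign inv_forms)"
    using roots_eq_inv_forms(1) unfolding list_all_iff by blast
  have "card (set (map (normalize_sign \<circ> change_coords) root_forms)) = card (set (map normalize_sign inv_forms))"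
    using distinct_card[OF distinct_root_forms] distinct_card[OF distinct_inv_forms] roots_eq_inv_forms(2) by simp
  then have "set (map (normalize_sign \<circ> change_coords) root_forms) = set (map normalize_sign inv_forms)"
    using card_subset_eq[OF _ sub] by simp
  then show ?thesis using set_eq_iff_mset_eq_distinct[OF distinct_root_forms distinct_inv_forms] by blast
qed

lemma zev_pent: "map (zev T [x, y]) pent = map (lin_val T [x, y]) pentv" "map (zev T [x, y]) pent' = map (lin_val T [x, y]) pentv'"
  by (simp_all add: pent_def pent'_def pentv_def pentv'_def zev_zpoly)

lemma length_pentv: "z \<in> set pentv \<Longrightarrow> length z = 2" "z \<in> set pentv' \<Longrightarrow> length z = 2"
  by (auto simp: pentv_def pentv'_def)

context
  fixes T :: "'a::comm_ring_1"
  assumes T: "T * T = T + 1"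
begin

abbreviation val :: "int \<times> int \<Rightarrow> 'a" where "val p \<equiv> of_int (fst p) + of_int (snd p) * T"

lemma val_neg: "val (neg p) = - val p"
  by (cases p) simp
lemma val_pls: "val (pls p q) = val p + val q"
  by (cases p; cases q) (simp add: algebra_simps)
lemma val_mul_inv_tau: "val (mul_inv_tau p) = (T - 1) * val p"
proof -
  obtain u v where p: "p = (u, v)" by (cases p)
  have "(T - 1) * val p = of_int u * (T - 1) + of_int v * (T * T - T)" by (simp add: p algebra_simps)
  then show ?thesis by (simp add: p T algebra_simps)
qed

lemma lin_val_Cons: "lin_val T (x # xs) (p # ps) = val p * x + lin_val T xs ps"
  by (cases p) simp

lemma lin_val_Nil: "lin_val T [] ps = 0" "lin_val T xs [] = 0"
  by (cases xs; simp)+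

lemma lin_val_neg: "lin_val T xs (map neg ps) = - lin_val T xs ps"
proof (induction ps arbitrary: xs)
  case (Cons p ps)
  show ?case by (cases xs) (simp_all only: list.map lin_val_Cons val_neg Cons lin_val_Nil, simp_all add: algebra_simps)
qed (simp add: lin_val_Nil)

lemma lin_val_normalize_sign: "lin_val T xs (normalize_sign ps) = lin_val T xs ps \<or> lin_val T xs (normalize_sign ps) = - lin_val T xs ps"
proof (induction ps arbitrary: xs rule: normalize_sign.induct)
  case (2 u v ps)
  show ?case
  proof (cases "u = 0 \<and> v = 0")
    case True
    then show ?thesis using 2 by (cases xs) auto
  next
    case False
    then show ?thesis using lin_val_neg[of xs "(u, v) # ps"] by auto
  qed
qed (simp add: lin_val_Nil)

lemma lin_val_normalize_sign_pow:
  assumes "even n" shows "lin_val T xs (normalize_sign ps) ^ n = lin_val T xs ps ^ n"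
  using lin_val_normalize_sign[of xs ps] assms by (auto simp: power_minus_even)

lemma lin_val_change_coords:
  assumes "length r = 4"
  shows "lin_val T [a, b, c, d] (change_coords r) = lin_val T [b + (T - 1) * c, (T - 1) * b - c, d, a] r"
proof -
  obtain r1 r2 r3 r4 where r: "r = [r1, r2, r3, r4]"
    using assms by (auto simp: numeral_eq_Suc length_Suc_conv)
  show ?thesis
    unfolding r change_coords.simps lin_val_Cons lin_val_Nil val_pls val_mul_inv_tau val_neg
    by (simp add: algebra_simps)
qed

lemma sum_roots_eq_inv_forms:
  assumes "even n"
  shows "(\<Sum>r\<leftarrow>root_forms. lin_val T [b + (T - 1) * c, (T - 1) * b - c, d, a] r ^ n) = (\<Sum>r\<leftarrow>inv_forms. lin_val T [a, b, c, d] r ^ n)"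
proof -
  have "map (\<lambda>r. lin_val T [b + (T - 1) * c, (T - 1) * b - c, d, a] r ^ n) root_forms =
      map (\<lambda>L. lin_val T [a, b, c, d] L ^ n) (map (normalize_sign \<circ> change_coords) root_forms)"
    using roots_eq_inv_forms(3) by (simp add: list_all_iff lin_val_normalize_sign_pow[OF assms] lin_val_change_coords)
  moreover have "map (\<lambda>r. lin_val T [a, b, c, d] r ^ n) inv_forms = map (\<lambda>L. lin_val T [a, b, c, d] L ^ n) (map normalize_sign inv_forms)"
    by (simp add: lin_val_normalize_sign_pow[OF assms])
  ultimately show ?thesis
    using mset_roots by (metis (no_types, lifting) mset_map sum_mset_sum_list)
qed

lemma lin_val_append4: "length p = 2 \<Longrightarrow> length q = 2 \<Longrightarrow> lin_val T [a, b, c, d] (p @ q) = lin_val T [a, b] p + lin_val T [d, c] (rev q)"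
proof -
  assume "length p = 2" "length q = 2"
  then obtain p1 p2 q1 q2 where "p = [p1, p2]" "q = [q1, q2]" by (auto simp: numeral_eq_Suc length_Suc_conv)
  then show ?thesis by (simp only: append.simps rev.simps lin_val_Cons lin_val_Nil) simp
qed

lemma lin_val_map_mul_inv_tau: "lin_val T xs (map mul_inv_tau ps) = (T - 1) * lin_val T xs ps"
proof (induction ps arbitrary: xs)
  case (Cons p ps)
  show ?case by (cases xs) (simp_all only: list.map lin_val_Cons val_mul_inv_tau Cons lin_val_Nil, simp_all add: algebra_simps)
qed (simp add: lin_val_Nil)

end

lemma sum_list_concat_map:
  "(\<Sum>r\<leftarrow>concat (map (\<lambda>z. map (f z) B) A). h r) = (\<Sum>z\<leftarrow>A. \<Sum>w\<leftarrow>B. h (f z w))"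
  by (induction A) (simp_all add: o_def)

context h4_forms
begin

lemma inv_sum_eq_forms: "inv_sum n = (\<Sum>r\<leftarrow>inv_forms. lin_val T [a, b, c, d] r ^ n)"
proof -
  have m: "lin_val T [d, c] (map mul_inv_tau w) = (T - 1) * lin_val T [d, c] w"
     "lin_val T [a, b] (map (neg \<circ> mul_inv_tau) w) = - ((T - 1) * lin_val T [a, b] w)" for w
    using lin_val_neg[OF T, of "[a, b]" "map mul_inv_tau w"] by (simp_all add: lin_val_map_mul_inv_tau[OF T])
  have 1: "lin_val T [a, b, c, d] (z @ rev (map mul_inv_tau w)) = lin_val T [a, b] z + (T - 1) * lin_val T [d, c] w"
    if "z \<in> set pentv" "w \<in> set pentv" for z w
    using that by (simp add: lin_val_append4[OF T] length_pentv m)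
  have 2: "lin_val T [a, b, c, d] (map (neg \<circ> mul_inv_tau) z @ rev w) = lin_val T [d, c] w - (T - 1) * lin_val T [a, b] z"
    if "z \<in> set pentv" "w \<in> set pentv" for z w
    using that by (subst lin_val_append4[OF T]) (simp_all add: length_pentv m)
  have 3: "lin_val T [a, b, c, d] (z @ [(0, 0), (0, 0)]) = lin_val T [a, b] z" if "z \<in> set pentv'" for z
    using that by (simp add: lin_val_append4[OF T] length_pentv)
  have 4: "lin_val T [a, b, c, d] ((0, 0) # (0, 0) # rev z) = lin_val T [d, c] z" if "z \<in> set pentv'" for z
    using that lin_val_append4[OF T, of "[(0, 0), (0, 0)]" "rev z" a b c d] by (simp add: length_pentv)
  have cc: "(\<Sum>r\<leftarrow>concat (map (\<lambda>z. map (f z) pentv) pentv). h r) = (\<Sum>z\<leftarrow>pentv. \<Sum>w\<leftarrow>pentv. h (f z w))"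
    for f and h :: "lform \<Rightarrow> 'a"
    by (rule sum_list_concat_map)
  have 1: "(\<Sum>r\<leftarrow>concat (map (\<lambda>z. map (\<lambda>w. z @ rev (map mul_inv_tau w)) pentv) pentv). lin_val T [a, b, c, d] r ^ n) =
      (\<Sum>z\<leftarrow>map (lin_val T [a, b]) pentv. \<Sum>w\<leftarrow>map (lin_val T [d, c]) pentv. (z + (T - 1) * w) ^ n)"
    unfolding cc map_map o_def by (intro arg_cong[where f = sum_list] map_cong refl) (simp add: 1)
  have 2: "(\<Sum>r\<leftarrow>concat (map (\<lambda>z. map (\<lambda>w. map (neg \<circ> mul_inv_tau) z @ rev w) pentv) pentv). lin_val T [a, b, c, d] r ^ n) =
      (\<Sum>z\<leftarrow>map (lin_val T [a, b]) pentv. \<Sum>w\<leftarrow>map (lin_val T [d, c]) pentv. (w - (T - 1) * z) ^ n)"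
    unfolding cc map_map o_def by (intro arg_cong[where f = sum_list] map_cong refl) (simp add: 2[unfolded o_def])
  have 3: "(\<Sum>r\<leftarrow>map (\<lambda>z. z @ [(0, 0), (0, 0)]) pentv'. lin_val T [a, b, c, d] r ^ n) = (\<Sum>z\<leftarrow>map (lin_val T [a, b]) pentv'. z ^ n)"
    unfolding map_map o_def by (intro arg_cong[where f = sum_list] map_cong refl) (simp add: 3)
  have 4: "(\<Sum>r\<leftarrow>map (\<lambda>w. (0, 0) # (0, 0) # rev w) pentv'. lin_val T [a, b, c, d] r ^ n) = (\<Sum>z\<leftarrow>map (lin_val T [d, c]) pentv'. z ^ n)"
    unfolding map_map o_def by (intro arg_cong[where f = sum_list] map_cong refl) (simp only: 4)
  show ?thesis
    unfolding inv_sum_def Let_def zev_pent inv_forms_def map_append sum_list_append 1 2 3 4 by (simp only: add.assoc)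
qed

end


section \<open>The set of the positive roots\<close>

text \<open>Infinite descent: both numbers are even, by parity.\<close>

lemma golden_ratio_irrational_aux:
  fixes m n :: int
  assumes "n * n = n * m + m * m" shows "m = 0"
  using assms
proof (induction "nat \<bar>m\<bar>" arbitrary: m n rule: less_induct)
  case less
  have "even (n * n) \<longleftrightarrow> even (n * m + m * m)" by (simp only: less.prems)
  then have "even n" "even m" by auto
  then obtain n' m' where nm: "n = 2 * n'" "m = 2 * m'" by (auto elim!: evenE)
  then have e: "n' * n' = n' * m' + m' * m'" using less.prems by simp
  show ?case
  proof (rule ccontr)
    assume "m \<noteq> 0"
    then have "nat \<bar>m'\<bar> < nat \<bar>m\<bar>" using nm by auto
    then have "m' = 0" using less.hyps e by blast
    then show False using nm \<open>m \<noteq> 0\<close> by simp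
  qed
qed

lemma golden_ratio_independent:
  fixes \<tau> :: real
  assumes "\<tau> * \<tau> = \<tau> + 1" "of_int u + of_int v * \<tau> = of_int u' + of_int v' * \<tau>"
  shows "u = u' \<and> v = v'"
proof -
  define n m where "n = u' - u" "m = v - v'"
  have nm: "of_int n = of_int m * \<tau>" using assms(2) by (simp add: n_m_def algebra_simps)
  have "of_int (n * n) = of_int m * of_int m * (\<tau> * \<tau>)" by (simp add: nm)
  also have "\<dots> = of_int (n * m + m * m)" unfolding assms(1) by (simp add: nm algebra_simps)
  finally have "n * n = n * m + m * m" using of_int_eq_iff by blast
  then have "m = 0" by (rule golden_ratio_irrational_aux)
  then show ?thesis using nm by (simp add: n_m_def)
qed

abbreviation xs4 :: "mpoly4 list" where "xs4 \<equiv> [Var 1, Var 2, Var 3, Var 4]"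

lemma single_1_eq_iff: "Poly_Mapping.single i (1::nat) = Poly_Mapping.single j 1 \<longleftrightarrow> i = j"
proof
  assume "Poly_Mapping.single i (1::nat) = Poly_Mapping.single j 1"
  then have "Poly_Mapping.lookup (Poly_Mapping.single i (1::nat)) i = Poly_Mapping.lookup (Poly_Mapping.single j 1) i" by simp
  then show "i = j" by (simp add: lookup_single when_def split: if_splits)
qed simp

lemma lookup_Const_Var: "Poly_Mapping.lookup (Const c * Var i) (Poly_Mapping.single j 1) = (if i = j then c else 0)"
  by (simp add: scaleR_mpoly4[symmetric] lookup_scaleR Var_def lookup_single single_1_eq_iff[simplified] when_def)

lemma Const_arith: "of_int u + of_int v * Const \<tau> = Const (of_int u + of_int v * \<tau>)"
proof -
  have "of_int u + of_int v * (of_real \<tau> :: mpoly4) = of_real (of_int u + of_int v * \<tau>)" by simp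
  then show ?thesis by (simp only: of_real_mpoly4)
qed

lemma inj_lin_val:
  assumes \<tau>: "\<tau> * \<tau> = \<tau> + 1" and len: "length r = 4" "length r' = 4"
    and eq: "lin_val (Const \<tau>) xs4 r = lin_val (Const \<tau>) xs4 r'"
  shows "r = r'"
proof -
  obtain u1 v1 u2 v2 u3 v3 u4 v4 where r: "r = [(u1, v1), (u2, v2), (u3, v3), (u4, v4)]"
    using len(1) by (auto simp: numeral_eq_Suc length_Suc_conv)
  obtain p1 q1 p2 q2 p3 q3 p4 q4 where r': "r' = [(p1, q1), (p2, q2), (p3, q3), (p4, q4)]"
    using len(2) by (auto simp: numeral_eq_Suc length_Suc_conv)
  have "Poly_Mapping.lookup (lin_val (Const \<tau>) xs4 r) (Poly_Mapping.single j 1) =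
      Poly_Mapping.lookup (lin_val (Const \<tau>) xs4 r') (Poly_Mapping.single j 1)" for j by (simp only: eq)
  from this[of 1] this[of 2] this[of 3] this[of 4] show ?thesis
    unfolding r r' lin_val.simps Const_arith lookup_add lookup_Const_Var
    using golden_ratio_independent[OF \<tau>] by simp
qed

text \<open>Every permutation is a product of transpositions \<open>(1 i) (2 j) (3 k)\<close>, and its parity can be read off from this form.\<close>

lemma even_permutations_4:
  "{(\<sigma> 1, \<sigma> 2, \<sigma> 3) | \<sigma> :: 4 \<Rightarrow> 4. \<sigma> permutes UNIV \<and> evenperm \<sigma>} =
   (\<lambda>(i, j, k). ([1, 2, 3, 4] ! i, [1, 2, 3, 4] ! j, [1, 2, 3, 4] ! k)) ` set even_triples"
proof -
  define P where "P i j k = transpose 1 i \<circ> (transpose 2 j \<circ> transpose 3 k)" for i j k :: 4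
  have perm: "\<sigma> permutes UNIV \<longleftrightarrow> (\<exists>i\<in>{1, 2, 3, 4}. \<exists>j\<in>{2, 3, 4}. \<exists>k\<in>{3, 4}. \<sigma> = P i j k)" for \<sigma>
  proof -
    have ins: "p permutes insert a S \<longleftrightarrow> (\<exists>b\<in>insert a S. \<exists>q. q permutes S \<and> p = transpose a b \<circ> q)" for p and a :: 4 and S
    proof -
      have "p \<in> {p. p permutes insert a S} \<longleftrightarrow> (\<exists>b\<in>insert a S. \<exists>q. q permutes S \<and> p = transpose a b \<circ> q)"
        unfolding permutes_insert by (simp only: image_iff Bex_def split_paired_Ex mem_Collect_eq case_prod_conv conj_assoc) blast
      then show ?thesis by (simp only: mem_Collect_eq)
    qed
    have gen: "(\<exists>i\<in>A. \<exists>q. (\<exists>j\<in>B. \<exists>q'. (\<exists>k\<in>C. \<exists>q''. q'' = id \<and> q' = f k \<circ> q'') \<and> q = g j \<circ> q') \<and> \<sigma> = h i \<circ> q) \<longleftrightarrow>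
      (\<exists>i\<in>A. \<exists>j\<in>B. \<exists>k\<in>C. \<sigma> = h i \<circ> (g j \<circ> f k))" for A B C :: "4 set" and f g h :: "4 \<Rightarrow> 4 \<Rightarrow> 4"
      by auto blast
    show ?thesis
      unfolding UNIV_4 ins[of _ 1 "{2, 3, 4}"] ins[of _ 2 "{3, 4}"] ins[of _ 3 "{4}"] permutes_sing P_def by (rule gen)
  qed
  have ev: "evenperm (P i j k) \<longleftrightarrow> ((1 = i) = ((2 = j) = (3 = k)))" for i j k
    unfolding P_def by (simp add: evenperm_comp permutation_compose permutation_swap_id evenperm_swap)
  have "{(\<sigma> 1, \<sigma> 2, \<sigma> 3) | \<sigma> :: 4 \<Rightarrow> 4. \<sigma> permutes UNIV \<and> evenperm \<sigma>} =
    (\<Union>i\<in>{1, 2, 3, 4}. \<Union>j\<in>{2, 3, 4}. \<Union>k\<in>{3, 4}. if (1 = i) = ((2 = j) = (3 = k)) then {(P i j k 1, P i j k 2, P i j k 3)} else {})"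
    (is "?L = ?R")
  proof (intro equalityI subsetI)
    fix z assume "z \<in> ?L"
    then obtain \<sigma> where \<sigma>: "z = (\<sigma> 1, \<sigma> 2, \<sigma> 3)" "\<sigma> permutes UNIV" "evenperm \<sigma>" by blast
    from perm[THEN iffD1, OF \<sigma>(2)] obtain i j k where
      ijk: "i \<in> {1, 2, 3, 4}" "j \<in> {2, 3, 4}" "k \<in> {3, 4}" "\<sigma> = P i j k" by (elim bexE)
    have c: "(1 = i) = ((2 = j) = (3 = k))" using \<sigma>(3) unfolding ijk(4) ev .
    have z: "z \<in> (if (1 = i) = ((2 = j) = (3 = k)) then {(P i j k 1, P i j k 2, P i j k 3)} else {})"
      by (simp only: if_P[OF c] \<sigma>(1) ijk(4) singleton_iff)
    show "z \<in> ?R"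
      by (rule UN_I[OF ijk(1)], rule UN_I[OF ijk(2)], rule UN_I[OF ijk(3)], rule z)
  next
    fix z assume "z \<in> ?R"
    then obtain i j k where ijk: "i \<in> {1, 2, 3, 4}" "j \<in> {2, 3, 4}" "k \<in> {3, 4}"
      "z \<in> (if (1 = i) = ((2 = j) = (3 = k)) then {(P i j k 1, P i j k 2, P i j k 3)} else {})"
      unfolding UN_iff by (elim bexE)
    then have c: "(1 = i) = ((2 = j) = (3 = k))" and z: "z = (P i j k 1, P i j k 2, P i j k 3)"
      by (simp_all only: empty_iff singleton_iff split: if_splits)
    have "P i j k permutes UNIV" unfolding perm using ijk(1-3) by (intro bexI[of _ i] bexI[of _ j] bexI[of _ k]) (rule refl)
    then show "z \<in> ?L" using c unfolding ev[symmetric] z by blast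
  qed
  also have "\<dots> = (\<lambda>(i, j, k). ([1, 2, 3, 4] ! i, [1, 2, 3, 4] ! j, [1, 2, 3, 4] ! k)) ` set even_triples"
    unfolding P_def even_triples_def
    by (rule equalityI) (simp_all add: transpose_def UN_subset_iff del: One_nat_def)
  finally show ?thesis .
qed


lemma all4_triple: "{f i | i::4. True} = {f 1, f 2, f 3, f 4}"
proof -
  have "{f i | i::4. True} = f ` UNIV" by auto
  then show ?thesis unfolding UNIV_4 by simp
qed

lemma UN_triples:
  "{F (\<sigma> 1) (\<sigma> 2) (\<sigma> 3) a b | \<sigma> a b. P \<sigma> \<and> Q \<sigma> \<and> a \<in> A \<and> b \<in> A} =
   (\<Union>z\<in>{(\<sigma> 1, \<sigma> 2, \<sigma> 3) | \<sigma>. P \<sigma> \<and> Q \<sigma>}. \<Union>a\<in>A. \<Union>b\<in>A. {case z of (i, j, k) \<Rightarrow> F i j k a b})"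
  by auto blast+

lemma H4_positive_roots_eq:
  assumes \<tau>: "\<tau> * \<tau> = \<tau> + 1"
  shows "H4_positive_roots \<tau> = lin_val (Const \<tau>) xs4 ` set root_forms"
proof -
  define L where "L = lin_val (Const \<tau>) xs4"
  have L: "L [(u1, v1), (u2, v2), (u3, v3), (u4, v4)] = Const (of_int u1 + of_int v1 * \<tau>) * Var 1 +
     Const (of_int u2 + of_int v2 * \<tau>) * Var 2 + Const (of_int u3 + of_int v3 * \<tau>) * Var 3 +
     Const (of_int u4 + of_int v4 * \<tau>) * Var 4" for u1 v1 u2 v2 u3 v3 u4 v4
    unfolding L_def lin_val.simps Const_arith by (simp add: add.assoc)
  have C: "Const 0 = 0" "Const 1 = 1" "Const 2 = 2" "Const (- 1) = - 1"
    using of_real_mpoly4[of 0] of_real_mpoly4[of 1] of_real_mpoly4[of 2] of_real_mpoly4[of "- 1"] by simp_all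
  have inv: "inverse \<tau> = \<tau> - 1"
    by (rule inverse_unique) (simp add: algebra_simps \<tau>)
  define f3 where "f3 = (\<lambda>z a b. case z of (i, j, k) \<Rightarrow> Const (a * \<tau>) * Var i + Const (b * inverse \<tau>) * Var j + Var k)"
  define idx4 where "idx4 = (\<lambda>(i, j, k). ([1, 2, 3, 4 :: 4] ! i, [1, 2, 3, 4 :: 4] ! j, [1, 2, 3, 4 :: 4] ! k))"
  define v3 where "v3 = (\<lambda>(i :: nat, j, k) a b. [(0,0),(0,0),(0,0),(0,0)][i := (0, a), j := (- b, b), k := (1 :: int, 0 :: int)])"
  have 1: "{2 * Var i | i. True} = L ` set (map (\<lambda>i. [(0,0),(0,0),(0,0),(0,0)][i := (2, 0)]) [0,1,2,3])"
    unfolding all4_triple by (simp add: L C numeral_2_eq_2 numeral_3_eq_3)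
  have "{Var 1 + Const a * Var 2 + Const b * Var 3 + Const c * Var 4 | a b c. a \<in> {1, -1} \<and> b \<in> {1, -1} \<and> c \<in> {1, -1}} =
    (\<Union>a\<in>{1, -1}. \<Union>b\<in>{1, -1}. \<Union>c\<in>{1, -1}. {Var 1 + Const a * Var 2 + Const b * Var 3 + Const c * Var 4})" by blast
  also have "\<dots> = L ` set (concat (map (\<lambda>a. concat (map (\<lambda>b. map (\<lambda>c. [(1, 0), (a, 0), (b, 0), (c, 0)]) [1, -1]) [1, -1])) [1, -1]))"
    by (simp add: L C image_Un) blast
  finally have 2: "{Var 1 + Const a * Var 2 + Const b * Var 3 + Const c * Var 4 | a b c. a \<in> {1, -1} \<and> b \<in> {1, -1} \<and> c \<in> {1, -1}} =
    L ` set (concat (map (\<lambda>a. concat (map (\<lambda>b. map (\<lambda>c. [(1, 0), (a, 0), (b, 0), (c, 0)]) [1, -1]) [1, -1])) [1, -1]))" .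
  have Lv3: "L (v3 t a b) = f3 (idx4 t) (of_int a) (of_int b)" if "t \<in> set even_triples" for t a b
  proof -
    have "of_int b * (\<tau> - 1) = - of_int b + of_int b * \<tau>" by (simp add: algebra_simps)
    then show ?thesis using that unfolding even_triples_def
      by (auto simp: v3_def f3_def idx4_def inv numeral_2_eq_2 numeral_3_eq_3 L C ac_simps)
  qed
  have "{Const (a * \<tau>) * Var (\<sigma> 1) + Const (b * inverse \<tau>) * Var (\<sigma> 2) + Var (\<sigma> 3) | \<sigma> a b.
        \<sigma> permutes UNIV \<and> evenperm \<sigma> \<and> a \<in> {1, -1} \<and> b \<in> {1, -1}} =
     (\<Union>z\<in>{(\<sigma> 1, \<sigma> 2, \<sigma> 3) | \<sigma> :: 4 \<Rightarrow> 4. \<sigma> permutes UNIV \<and> evenperm \<sigma>}. \<Union>a\<in>{1, -1}. \<Union>b\<in>{1, -1}. {f3 z a b})"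
    unfolding f3_def by (rule UN_triples)
  also have "\<dots> = (\<Union>t\<in>set even_triples. \<Union>a\<in>{1, -1}. \<Union>b\<in>{1, -1}. {f3 (idx4 t) a b})"
    unfolding even_permutations_4 idx4_def[symmetric] by (simp only: image_image)
  also have "\<dots> = (\<Union>t\<in>set even_triples. L ` set (concat (map (\<lambda>a. map (\<lambda>b. v3 t a b) [1, -1]) [1, -1])))"
    by (intro SUP_cong refl) (simp add: Lv3 insert_commute)
  also have "\<dots> = L ` set (concat (map (\<lambda>t. concat (map (\<lambda>a. map (\<lambda>b. v3 t a b) [1, -1]) [1, -1])) even_triples))"
    by (simp only: set_concat set_map image_UN image_image)
  finally have 3: "{Const (a * \<tau>) * Var (\<sigma> 1) + Const (b * inverse \<tau>) * Var (\<sigma> 2) + Var (\<sigma> 3) | \<sigma> a b.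
        \<sigma> permutes UNIV \<and> evenperm \<sigma> \<and> a \<in> {1, -1} \<and> b \<in> {1, -1}} = 
     L ` set (concat (map (\<lambda>t. concat (map (\<lambda>a. map (\<lambda>b. v3 t a b) [1, -1]) [1, -1])) even_triples))" .
  have v3': "(\<lambda>t. concat (map (\<lambda>a. map (\<lambda>b. v3 t a b) [1, -1]) [1, -1])) =
    (\<lambda>(i, j, k). concat (map (\<lambda>a. map (\<lambda>b. [(0,0),(0,0),(0,0),(0,0)][i := (0, a), j := (- b, b), k := (1, 0)]) [1, -1]) [1, -1]))"
    unfolding v3_def by (rule ext) (simp only: case_prod_beta)
  show ?thesis
    unfolding H4_positive_roots_def 1 2 3 root_forms_def L_def[symmetric] v3' set_append image_Un Un_assoc ..
qed

lemma H4_invariant_eq: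
  assumes \<tau>: "\<tau> * \<tau> = \<tau> + 1"
  shows "H4_invariant \<tau> n = (\<Sum>r\<leftarrow>root_forms. lin_val (Const \<tau>) xs4 r ^ n)"
proof -
  have d: "distinct root_forms" using distinct_root_forms by (simp add: distinct_map)
  have "inj_on (lin_val (Const \<tau>) xs4) (set root_forms)"
    using inj_lin_val[OF \<tau>] roots_eq_inv_forms(3) by (auto simp: inj_on_def list_all_iff)
  then show ?thesis
    unfolding H4_invariant_def H4_positive_roots_eq[OF \<tau>]
    by (simp add: sum.reindex sum_list_distinct_conv_sum_set[OF d])
qed


section \<open>The Hilbert series\<close>

text \<open>The factor from \<open>d\<close>, \<open>c\<close> and \<open>b\<close> is the Hilbert series of \<open>H\<^sub>3\<close>, of degrees 2, 6 and 10; the sum over \<open>s\<close> is \<open>(1 + X ^ 6) * (1 + X ^ 10) * (1 - X ^ 30)\<close>.\<close>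

lemma hilbert_H4:
  fixes x :: "'a::comm_ring_1"
  shows "(\<Sum>s<4. \<Sum>t<2. x ^ ([0, 6, 10, 16] ! s + 5 * t) *
      ((1 - x ^ 2) * (1 - x ^ 5) * (1 - x ^ (if t = 0 then 11 else 1)) * (1 - x ^ ([46, 34, 26, 14] ! s)))) =
    (1 - x ^ 2) * (1 - x ^ 12) * (1 - x ^ 20) * (1 - x ^ 30)"
proof -
  define u v w where "u = x ^ 5" "v = x ^ 6" "w = x ^ 30"
  have e: "x ^ 11 = u * v" "x ^ 12 = v ^ 2" "x ^ 20 = u ^ 4" "v = x * u" "x ^ 10 = u ^ 2" "x ^ 16 = u ^ 2 * v"
    by (simp_all add: u_v_w_def power_add[symmetric] power_mult[symmetric] flip: power_Suc)
  have m: "x ^ 46 = u ^ 2 * v * w" "v * x ^ 34 = u ^ 2 * w" "u ^ 2 * x ^ 26 = v * w" "u ^ 2 * v * x ^ 14 = w"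
    by (simp_all add: u_v_w_def power_add[symmetric] power_mult[symmetric])
  define P where "P = (1 - x ^ 2) * (1 - u) * ((1 - u * v) + u * (1 - x))"
  have two: "(\<Sum>t<2. h t) = h 0 + h 1" for h :: "nat \<Rightarrow> 'a" by (simp add: numeral_2_eq_2)
  have four: "(\<Sum>t<4. h t) = h 0 + h 1 + h 2 + h 3" for h :: "nat \<Rightarrow> 'a" by (simp add: eval_nat_numeral)
  have "(\<Sum>t<2. x ^ (j + 5 * t) * ((1 - x ^ 2) * (1 - x ^ 5) * (1 - x ^ (if t = 0 then 11 else 1)) * (1 - x ^ l))) =
      P * (x ^ j - x ^ j * x ^ l)" for j l
    unfolding two P_def by (simp add: power_add e(1) flip: u_v_w_def(1)) (simp add: algebra_simps)
  then have "(\<Sum>s<4. \<Sum>t<2. x ^ ([0, 6, 10, 16] ! s + 5 * t) *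
      ((1 - x ^ 2) * (1 - x ^ 5) * (1 - x ^ (if t = 0 then 11 else 1)) * (1 - x ^ ([46, 34, 26, 14] ! s)))) =
    P * ((1 - x ^ 46) + (v - v * x ^ 34) + (u ^ 2 - u ^ 2 * x ^ 26) + (u ^ 2 * v - u ^ 2 * v * x ^ 14))"
    by (simp add: four e(5,6) distrib_left flip: u_v_w_def(2))
  also have "\<dots> = P * ((1 + u ^ 2) * (1 + v) * (1 - w))" unfolding m by (simp add: algebra_simps)
  also have "\<dots> = (1 - x ^ 2) * (1 - v ^ 2) * (1 - u ^ 4) * (1 - w)"
  proof -
    have 1: "(1 - u * v) + u * (1 - x) = (1 + u) * (1 - v)" by (simp add: e(4) algebra_simps)
    have "(1 - u) * (1 + u) * (1 + u ^ 2) = 1 - u ^ 4"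
      by (simp add: algebra_simps power2_eq_square power4_eq_xxxx)
    moreover have "(1 - v) * (1 + v) = 1 - v ^ 2" by (simp add: algebra_simps power2_eq_square)
    ultimately have "(1 - x ^ 2) * ((1 - u) * (1 + u) * (1 + u ^ 2)) * ((1 - v) * (1 + v)) * (1 - w) = (1 - x ^ 2) * (1 - v ^ 2) * (1 - u ^ 4) * (1 - w)"
      by (simp only: mult_ac)
    then show ?thesis unfolding P_def 1 by (simp only: mult_ac)
  qed
  finally show ?thesis by (simp add: e(2,3) u_v_w_def(3))
qed


section \<open>The strong Lefschetz property\<close>

lemma homogeneous_Var_Suc [simp]: "homogeneous (Suc 0) (Var i)"
  using homogeneous_Var by simp

fun zlin :: "lform \<Rightarrow> zpol" where
  "zlin [] = Cst 0 0"
| "zlin ((u, v) # ps) = zPX (zlin ps) (Cst u v)"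

lemma zev_zlin: "zev T xs (zlin ps) = lin_val T xs ps"
proof (induction ps arbitrary: xs)
  case (Cons p ps)
  have nil: "zev T [] (zlin ps) = 0" for ps by (induction ps rule: zlin.induct) (simp_all add: zev_zPX)
  obtain u v where "p = (u, v)" by (cases p)
  then show ?case using nil[of ps] Cons by (cases xs) (simp_all add: zev_zPX mult.commute)
qed simp

lemma square_sum_roots: "zeq (foldr zadd (map (\<lambda>r. zpow (zlin r) 2) root_forms) (Cst 0 0))
    (zpoly [(60, 0, [2, 0, 0, 0]), (60, 0, [0, 2, 0, 0]), (60, 0, [0, 0, 2, 0]), (60, 0, [0, 0, 0, 2])])"
  by code_simp

lemma H4_invariant_2:
  assumes "\<tau> * \<tau> = \<tau> + 1"
  shows "H4_invariant \<tau> 2 = 60 * (Var 1 ^ 2 + Var 2 ^ 2 + Var 3 ^ 2 + Var 4 ^ 2)"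
proof -
  have T: "Const \<tau> * Const \<tau> = Const \<tau> + 1" 
    using assms by (metis of_real_mpoly4 of_real_mult of_real_add of_real_1)
  have f: "zev T xs (foldr zadd ps (Cst 0 0)) = (\<Sum>p\<leftarrow>ps. zev T xs p)" for T :: mpoly4 and xs ps
    by (induction ps) (simp_all add: zev_zadd)
  have "H4_invariant \<tau> 2 = zev (Const \<tau>) xs4 (foldr zadd (map (\<lambda>r. zpow (zlin r) 2) root_forms) (Cst 0 0))"
    unfolding f H4_invariant_eq[OF assms] map_map o_def zev_zpow[OF T] zev_zlin ..
  also have "\<dots> = 60 * (Var 1 ^ 2 + Var 2 ^ 2 + Var 3 ^ 2 + Var 4 ^ 2)"
    unfolding zev_zeq[OF T square_sum_roots] by (simp add: zev_zpoly distrib_left)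
  finally show ?thesis .
qed

lemma homogeneous_of_real: "homogeneous 0 (of_int u + of_int v * of_real \<tau> :: mpoly4)"
  unfolding of_real_mpoly4 Const_arith by simp

lemma homogeneous_lin_val:
  "(\<And>x. x \<in> set xs \<Longrightarrow> homogeneous 1 x) \<Longrightarrow> homogeneous 1 (lin_val (of_real \<tau>) xs r)"
proof (induction r arbitrary: xs)
  case (Cons p ps)
  obtain u v where p: "p = (u, v)" by (cases p)
  show ?case
  proof (cases xs)
    case Nil then show ?thesis by simp
  next
    case (Cons y ys)
    have "homogeneous (0 + 1) ((of_int u + of_int v * of_real \<tau>) * y)"
      by (intro homogeneous_mult homogeneous_of_real Cons.prems) (simp add: Cons)
    then show ?thesis using Cons Cons.IH[of ys] Cons.prems by (simp add: p homogeneous_add)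
  qed
qed simp

lemma homogeneous_H4_invariant:
  assumes "\<tau> * \<tau> = \<tau> + 1" shows "homogeneous n (H4_invariant \<tau> n)"
  unfolding H4_invariant_def H4_positive_roots_eq[OF assms]
proof (rule homogeneous_sum)
  fix r assume "r \<in> lin_val (Const \<tau>) xs4 ` set root_forms"
  then have "homogeneous 1 r" proof
    fix x assume "r = lin_val (Const \<tau>) xs4 x"
    moreover have "homogeneous 1 (lin_val (of_real \<tau>) xs4 x)" by (rule homogeneous_lin_val) auto
    ultimately show "homogeneous 1 r" by (simp only: of_real_mpoly4)
  qed
  from homogeneous_pow[OF this, of n] show "homogeneous n (r ^ n)" by simp
qed

fun weighted_homogeneous :: "nat list \<Rightarrow> nat \<Rightarrow> zpol \<Rightarrow> bool" where
  "weighted_homogeneous ws n (Cst u v) \<longleftrightarrow> n = 0 \<or> u = 0 \<and> v = 0"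
| "weighted_homogeneous [] n (PX p q) \<longleftrightarrow> weighted_homogeneous [] n p"
| "weighted_homogeneous (w # ws) n (PX p q) \<longleftrightarrow> weighted_homogeneous ws n p \<and>
     (if w \<le> n then weighted_homogeneous (w # ws) (n - w) q else zzero q)"

lemma homogeneous_zev:
  "weighted_homogeneous ws n p \<Longrightarrow> list_all2 homogeneous ws xs \<Longrightarrow> homogeneous n (zev (of_real \<tau>) xs p)"
proof (induction ws n p arbitrary: xs rule: weighted_homogeneous.induct)
  case (1 ws n u v)
  then show ?case using homogeneous_of_real by auto
next
  case (3 w ws n p q)
  obtain y ys where xs: "xs = y # ys" "homogeneous w y" "list_all2 homogeneous ws ys"
    using "3.prems"(2) by (auto simp: list_all2_Cons1)
  have 1: "homogeneous n (zev (of_real \<tau>) ys p)" using 3 xs by simp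
  show ?case
  proof (cases "w \<le> n")
    case True
    have "homogeneous (w + (n - w)) (y * zev (of_real \<tau>) xs q)"
      by (intro homogeneous_mult xs(2) "3.IH"(2)) (use True 3 in simp_all)
    then show ?thesis using 1 True by (simp add: xs(1) homogeneous_add)
  next
    case False
    then show ?thesis using 1 "3.prems" by (simp add: xs(1) zev_zzero)
  qed
qed auto

lemma weighted_homogeneous_forms:
  "weighted_homogeneous [1, 1] 5 quint" "weighted_homogeneous [5, 1, 2] 6 phi6_pol" "weighted_homogeneous [5, 1, 2] 10 phi10_pol"
  "weighted_homogeneous [2, 6, 10] 0 (sigs ! 0)" "weighted_homogeneous [2, 6, 10] 6 (sigs ! 1)"
  "weighted_homogeneous [2, 6, 10] 10 (sigs ! 2)" "weighted_homogeneous [2, 6, 10] 16 (sigs ! 3)"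
  by code_simp+

text \<open>The golden ratio or its Galois conjugate.\<close>

locale golden_ratio =
  fixes \<tau> :: real
  assumes \<tau>: "\<tau> * \<tau> = \<tau> + 1"
begin

definition degrees4 :: "4 \<Rightarrow> nat" where
  "degrees4 v = (if v = 1 then 2 else if v = 2 then 12 else if v = 3 then 20 else 30)"
definition gens :: "4 \<Rightarrow> mpoly4" where "gens v = H4_invariant \<tau> (degrees4 v)"

text \<open>With \<open>y3\<close>, an orthogonal basis of the plane of the first two coordinates. The factor makes \<open>Var 1\<close> and \<open>Var 2\<close> integral combinations over \<open>\<tau>\<close>.\<close>

definition y2 :: mpoly4 where "y2 = Const ((2 * \<tau> - 1) / 5) * (Const \<tau> * Var 1 + Var 2)"
definition y3 :: mpoly4 where "y3 = Const ((2 * \<tau> - 1) / 5) * (Var 1 - Const \<tau> * Var 2)"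

lemma T: "of_real \<tau> * of_real \<tau> = (of_real \<tau> + 1 :: mpoly4)"
  using \<tau> by (metis of_real_mult of_real_add of_real_1)

lemma Var_eq: "Var 1 = y2 + (of_real \<tau> - 1) * y3" "Var 2 = (of_real \<tau> - 1) * y2 - y3"
proof -
  define t q :: mpoly4 where "t = of_real \<tau>" "q = of_real ((2 * \<tau> - 1) / 5)"
  have t: "t * t = t + 1" unfolding t_q_def by (rule T)
  have "(2 * \<tau> - 1) / 5 * (2 * \<tau> - 1) = 1" using \<tau> by (simp add: algebra_simps)
  then have q: "q * (2 * t - 1) = 1" unfolding t_q_def by (metis of_real_1 of_real_diff of_real_mult of_real_numeral)
  have y: "y2 = q * (t * Var 1 + Var 2)" "y3 = q * (Var 1 - t * Var 2)"
    by (simp_all only: y2_def y3_def t_q_def of_real_mpoly4)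
  have tt: "(t - 1) * t = 1" using t by (simp add: algebra_simps)
  have "y2 + (t - 1) * y3 = q * (2 * t - 1) * Var 1 + q * (1 - (t - 1) * t) * Var 2"
    "(t - 1) * y2 - y3 = q * ((t - 1) * t - 1) * Var 1 + q * (2 * t - 1) * Var 2"
    by (simp_all add: y algebra_simps)
  then show "Var 1 = y2 + (of_real \<tau> - 1) * y3" "Var 2 = (of_real \<tau> - 1) * y2 - y3"
    by (simp_all add: q tt flip: t_q_def(1))
qed

sublocale homogeneous_generators gens degrees4
  by unfold_locales (simp_all add: gens_def homogeneous_H4_invariant[OF \<tau>] degrees4_def)

sublocale h4_forms "gen_ideal gens" "of_real \<tau>" "Var 4" y2 y3 "Var 3"
  by unfold_locales (rule subspace_gen_ideal gen_ideal_mult T | assumption)+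

lemma H4_invariant_eq_inv_sum: "even n \<Longrightarrow> H4_invariant \<tau> n = inv_sum n"
  unfolding inv_sum_eq_forms H4_invariant_eq[OF \<tau>]
  using sum_roots_eq_inv_forms[OF T, of n y2 y3 "Var 3" "Var 4"]
  by (simp only: of_real_mpoly4[symmetric] Var_eq[symmetric])

lemma gens_in_ideal: "H4_invariant \<tau> 2 \<in> gen_ideal gens" "H4_invariant \<tau> 12 \<in> gen_ideal gens"
    "H4_invariant \<tau> 20 \<in> gen_ideal gens" "H4_invariant \<tau> 30 \<in> gen_ideal gens"
  using gen_ideal_generator[of gens 1] gen_ideal_generator[of gens 2] gen_ideal_generator[of gens 3]
    gen_ideal_generator[of gens 4] by (simp_all add: gens_def degrees4_def)

lemma S_add_G: "S + G \<in> gen_ideal gens"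
proof -
  have "S + G = of_real \<tau> * (Var 1 ^ 2 + Var 2 ^ 2 + Var 3 ^ 2 + Var 4 ^ 2)"
  proof -
    define t where "t = (of_real \<tau> :: mpoly4)"
    have t: "t * t = t + 1" unfolding t_def by (rule T)
    have 1: "t * (1 + (t - 1) * (t - 1)) = 2 * t - 1"
    proof -
      have "t * (1 + (t - 1) * (t - 1)) = t * (t * t) - 2 * (t * t) + 2 * t" by (simp add: algebra_simps)
      also have "\<dots> = 2 * t - 1" unfolding t by (simp add: t algebra_simps)
      finally show ?thesis .
    qed
    have 2: "(y2 + (t - 1) * y3) ^ 2 + ((t - 1) * y2 - y3) ^ 2 = (1 + (t - 1) * (t - 1)) * (y2 ^ 2 + y3 ^ 2)"
      by (simp add: power2_eq_square algebra_simps)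
    have "t * (Var 1 ^ 2 + Var 2 ^ 2) = (2 * t - 1) * (y2 ^ 2 + y3 ^ 2)"
      unfolding Var_eq t_def[symmetric] 2 mult.assoc[symmetric] 1 ..
    moreover have "S = t * Var 4 ^ 2 + (2 * t - 1) * y2 ^ 2" "G = t * Var 3 ^ 2 + (2 * t - 1) * y3 ^ 2"
      unfolding t_def by (simp_all add: S_def G_def quad_def zev_zpoly)
    ultimately show ?thesis unfolding t_def[symmetric] by (simp add: distrib_left)
  qed
  also have "\<dots> = (of_real \<tau> * Const (1 / 60)) * H4_invariant \<tau> 2"
  proof -
    have "Const (1 / 60) * (60 * f) = f" for f :: mpoly4
    proof -
      have "(of_real (1 / 60) * of_real 60 :: mpoly4) = 1" by (simp only: of_real_mult[symmetric]) simp
      then show ?thesis by (simp only: of_real_mpoly4[symmetric] of_real_numeral mult.assoc[symmetric] mult_1_left)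
    qed
    then show ?thesis by (simp only: H4_invariant_2[OF \<tau>] mult.assoc)
  qed
  finally show ?thesis using gen_ideal_mult[OF gens_in_ideal(1)] by simp
qed

sublocale h4_relations "gen_ideal gens" \<tau> "Var 4" y2 y3 "Var 3"
proof unfold_locales
  show "\<tau> * \<tau> = \<tau> + 1" by (rule \<tau>)
  show "S + G \<in> gen_ideal gens" by (rule S_add_G)
  have "inv_sum (2 * 6) \<in> gen_ideal gens" "inv_sum (2 * 10) \<in> gen_ideal gens" "inv_sum (2 * 15) \<in> gen_ideal gens"
    using gens_in_ideal by (simp_all add: H4_invariant_eq_inv_sum)
  note inv = F_in_J[OF S_add_G this(1) inv_12] F_in_J[OF S_add_G this(2) inv_20] F_in_J[OF S_add_G this(3) inv_30]
  show "zev (of_real \<tau>) [\<alpha>, \<phi>6, \<phi>10] F12 \<in> gen_ideal gens" by (rule inv(1)) simp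
  show "zev (of_real \<tau>) [\<alpha>, \<phi>6, \<phi>10] F20 \<in> gen_ideal gens" by (rule inv(2)) simp
  show "zev (of_real \<tau>) [\<alpha>, \<phi>6, \<phi>10] F30 \<in> gen_ideal gens" by (rule inv(3)) simp
qed

lemma homogeneous_y: "homogeneous 1 y2" "homogeneous 1 y3"
proof -
  have "homogeneous (0 + 1) (Const c * Var i)" for c i by (intro homogeneous_mult) simp_all
  then have "homogeneous (0 + 1) y2" "homogeneous (0 + 1) y3"
    unfolding y2_def y3_def
    by (intro homogeneous_mult homogeneous_add homogeneous_diff homogeneous_Const; simp)+
  then show "homogeneous 1 y2" "homogeneous 1 y3" by simp_all
qed

lemma homogeneous_vars: "homogeneous 1 (vars v)"
  using homogeneous_y[simplified] by (simp add: vars_def)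

lemma homogeneous_top_elt:
  assumes "i \<in> tops" shows "homogeneous (top_deg i) (top_elt i)"
proof -
  have g: "homogeneous 5 g"
    unfolding g_def by (rule homogeneous_zev[OF weighted_homogeneous_forms(1)]) (simp add: homogeneous_y[simplified])
  have \<alpha>: "homogeneous 2 \<alpha>"
    using homogeneous_scaleR[OF homogeneous_pow[OF homogeneous_Var, of 2 4], of \<tau>] by (simp add: \<alpha>_def scaleR_conv_of_real)
  have \<phi>6: "homogeneous 6 \<phi>6"
    unfolding \<phi>6_def by (rule homogeneous_zev[OF weighted_homogeneous_forms(2)]) (simp add: homogeneous_y[simplified] g \<alpha>)
  have \<phi>10: "homogeneous 10 \<phi>10"
    unfolding \<phi>10_def by (rule homogeneous_zev[OF weighted_homogeneous_forms(3)]) (simp add: homogeneous_y[simplified] g \<alpha>)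
  have l: "list_all2 homogeneous [2, 6, 10] [\<alpha>, \<phi>6, \<phi>10]" by (simp add: \<alpha> \<phi>6 \<phi>10)
  have \<sigma>: "homogeneous (string_degree ! s) (\<sigma> s)" if "s < 4" for s
    using that unfolding \<sigma>_def string_degree_def
    by (rule ex_less_4[rotated -1]) (simp_all only: nth_Cons_0 nth_Cons_numeral nth_Cons_Suc One_nat_def, simp_all add: homogeneous_zev[OF _ l] weighted_homogeneous_forms weighted_homogeneous_forms(5)[simplified])
  have \<sigma>5: "homogeneous 5 \<sigma>5"
  proof -
    have "homogeneous (1 * 5) (y2 ^ 5)" by (rule homogeneous_pow[OF homogeneous_y(1)])
    then have "homogeneous 5 (11 *\<^sub>R y2 ^ 5)" by (intro homogeneous_scaleR) simp
    then show ?thesis unfolding \<sigma>5_def using homogeneous_add[OF g] by (simp add: scaleR_conv_of_real)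
  qed
  obtain s t where i: "i = (s, t)" "s < 4" "t = 0 \<or> t = 1"
  proof -
    obtain s t where st: "i = (s, t)" by (cases i)
    moreover have "s < 4" "t = 0 \<or> t = 1" using assms by (auto simp: st tops_def)
    ultimately show ?thesis using that by blast
  qed
  from i(3) show ?thesis
  proof
    assume "t = 0" then show ?thesis using \<sigma>[OF i(2)] by (simp add: i(1) top_elt_def top_deg_def)
  next
    assume "t = 1" then show ?thesis using homogeneous_mult[OF \<sigma>[OF i(2)] \<sigma>5] by (simp add: i(1) top_elt_def top_deg_def)
  qed
qed

lemma Var_mult_D1: "p \<in> D1 n \<Longrightarrow> Var i * p \<in> D1 (Suc n)"
proof -
  assume p: "p \<in> D1 n"
  have s: "(of_real \<tau> - 1) * f = (\<tau> - 1) *\<^sub>R f" for f :: mpoly4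
    by (simp add: scaleR_conv_of_real)
  have "Var 1 * p = y2 * p + (\<tau> - 1) *\<^sub>R (y3 * p)" "Var 2 * p = (\<tau> - 1) *\<^sub>R (y2 * p) - y3 * p"
    unfolding Var_eq s by (simp_all add: distrib_right left_diff_distrib)
  then have "Var 1 * p \<in> D1 (Suc n)" "Var 2 * p \<in> D1 (Suc n)"
    using D1_b[OF p] D1_c[OF p] subspace_D1
    by (simp_all add: subspace_add subspace_scale subspace_diff)
  moreover have "Var 3 * p \<in> D1 (Suc n)" "Var 4 * p \<in> D1 (Suc n)" using D1_d[OF p] D1_a[OF p] .
  ultimately have "\<forall>i. Var i * p \<in> D1 (Suc n)" unfolding all4 by blast
  then show ?thesis by blast
qed

lemma spanning: "homogeneous n f \<Longrightarrow> f \<in> span (elt ` idx n \<union> gen_ideal gens)"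
proof -
  assume "homogeneous n f"
  then have "f \<in> span (mono4 ` {m. mdeg m = n})" by (rule homogeneous_in_span)
  moreover have "mono4 m \<in> D1 (mdeg m)" for m
    by (rule mono4_induct[where P = "\<lambda>n p. p \<in> D1 n"]) (auto intro: D1_1 Var_mult_D1)
  then have "mono4 ` {m. mdeg m = n} \<subseteq> D1 n" by auto
  then have "span (mono4 ` {m. mdeg m = n}) \<subseteq> D1 n" by (rule span_minimal[OF _ subspace_D1])
  ultimately show ?thesis using D1_in_span by blast
qed

sublocale graded_string_basis gens degrees4 vars weights tops top_elt sides top_deg top_wt 60
proof (intro graded_string_basis.intro graded_string_basis_axioms.intro)
  show "straightened_string_basis (gen_ideal gens) vars weights tops top_elt sides top_deg top_wt 60"
    by (rule straightened_string_basis_axioms)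
  show "homogeneous_generators gens degrees4" by (rule homogeneous_generators_axioms)
  show "homogeneous 1 (vars v)" for v by (rule homogeneous_vars)
  show "homogeneous (top_deg i) (top_elt i)" if "i \<in> tops" for i using homogeneous_top_elt[OF that] .
  show "f \<in> span (elt ` idx n \<union> gen_ideal gens)" if "homogeneous n f" for n f using spanning[OF that] .
  have "(\<Sum>i\<in>tops. fps_X ^ top_deg i * (\<Prod>v\<in>UNIV. 1 - fps_X ^ sides i v)) =
     (\<Sum>s<4. \<Sum>t<2. fps_X ^ ([0, 6, 10, 16] ! s + 5 * t) *
      ((1 - fps_X ^ 2) * (1 - fps_X ^ 5) * (1 - fps_X ^ (if t = 0 then 11 else 1)) * (1 - fps_X ^ ([46, 34, 26, 14] ! s)) :: int fps))"
    unfolding tops_def sum.cartesian_product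
    by (intro sum.cong refl) (auto simp: top_deg_def string_degree_def string_length_def prod4 sides_def simp del: power_Suc)
  also have "\<dots> = (\<Prod>v\<in>UNIV. 1 - fps_X ^ degrees4 v)"
    unfolding hilbert_H4 prod4 by (simp add: degrees4_def)
  finally show "(\<Sum>i\<in>tops. fps_X ^ top_deg i * (\<Prod>v\<in>UNIV. 1 - fps_X ^ sides i v)) = (\<Prod>v\<in>UNIV. 1 - fps_X ^ degrees4 v :: int fps)" .
qed

lemma H4_ideal_eq: "H4_ideal \<tau> = gen_ideal gens"
proof -
  have "range gens = H4_invariant \<tau> ` {2, 12, 20, 30}"
    unfolding UNIV_4 by (simp add: gens_def degrees4_def)
  then show ?thesis unfolding H4_ideal_def using genideal_range[of gens] by simp
qed

end

theorem theorem5: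
  fixes \<tau> :: real
  assumes "\<tau>\<^sup>2 - \<tau> - 1 = 0"
  shows "graded_algebra (H4_coinvariant_ring \<tau>) (H4_scalars \<tau>) (H4_grading \<tau>) \<and>
         strong_lefschetz_property (H4_coinvariant_ring \<tau>) (H4_grading \<tau>)"
proof -
  interpret golden_ratio \<tau> by unfold_locales (use assms in \<open>simp add: power2_eq_square\<close>)
  obtain l where l: "homogeneous 1 l"
    "\<And>j f. 2 * j \<le> 60 \<Longrightarrow> homogeneous (60 - j) f \<Longrightarrow> \<exists>h. homogeneous j h \<and> f - l ^ (60 - 2 * j) * h \<in> gen_ideal gens"
    "\<And>j h. 2 * j \<le> 60 \<Longrightarrow> homogeneous j h \<Longrightarrow> l ^ (60 - 2 * j) * h \<in> gen_ideal gens \<Longrightarrow> h \<in> gen_ideal gens"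
    "\<And>n f. 60 < n \<Longrightarrow> homogeneous n f \<Longrightarrow> f \<in> gen_ideal gens"
    using lefschetz by blast
  have gr: "H4_grading \<tau> = (\<lambda>i. {gen_ideal gens +>\<^bsub>poly_ring4\<^esub> f | f. homogeneous i f})"
    by (rule ext) (simp only: H4_grading_def H4_ideal_eq)
  show ?thesis
    unfolding strong_lefschetz_property_def gr H4_coinvariant_ring_def H4_scalars_def H4_ideal_eq
  proof
    show "graded_algebra Q scalars grade" by (rule graded_algebra_quotient)
    have "strong_lefschetz_element Q grade (cls l)"
      by (rule strong_lefschetz_quotient[where N = 60 and l = l]) (rule l; assumption)+
    then show "Ex (strong_lefschetz_element Q grade)" by (rule exI)
  qed
qed


end
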